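(* Let $n\ge 2$. For any points $x,y\in\mathbb{S}^{n-1}$ there exists a co-adapted coupling $(X(t),Y(t))_{t\ge0}$ of Brownian motions on $\mathbb{S}^{n-1}$ starting at $(x,y)$ such that $d(X(t),Y(t))=d(x,y)$ for all $t\ge 0$. Moreover, the coupling can be chosen so that the joint process $(X,Y)$ is a diffusion.
   Context: $\mathbb{S}^{n-1}=\{x\in\mathbb{R}^{n}:|x|=1\}$ is the unit sphere with its induced Riemannian metric and geodesic distance $d$. Brownian motion on $\mathbb{S}^{n-1}$ is the continuous diffusion with generator $\frac12\Delta$, $\Delta$ the Laplace–Beltrami operator. A coupling of Brownian motions on $\mathbb{S}^{n-1}$ is a pair of processes $(X(t),Y(t))_{t\ge0}$ on the same probability space, each of which is a Brownian motion on $\mathbb{S}^{n-1}$. It is co-adapted if, moreover, for all $s,t\ge 0$ and all measurable $A\subset\mathbb{S}^{n-1}$, $$P(X(s+t)\in A\mid X(s)=z,\ X(u),Y(u):0\le u\le s)=P^z(X(t)\in A),$$ $$P(Y(s+t)\in A\mid Y(s)=z,\ X(u),Y(u):0\le u\le s)=P^z(Y(t)\in A),$$ where $P^z$ is the law of Brownian motion on the sphere started at $z$. A diffusion is a (time-homogeneous) strong Markov process with continuous paths. *)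

theory Defs
  imports "HOL-Probability.Probability"
begin

section \<open>Riemannian geometry of the unit sphere\<close>

text \<open>
  Length of a piecewise continuously differentiable curve. It is a relation, since the integral
  of a nonintegrable speed would be \<open>0\<close> by convention.
\<close>

definition has_length :: "(real \<Rightarrow> 'a::real_normed_vector) \<Rightarrow> real \<Rightarrow> bool" where
  "has_length \<gamma> l \<longleftrightarrow>
     valid_path \<gamma> \<and> ((\<lambda>t. norm (vector_derivative \<gamma> (at t))) has_integral l) {0..1}"

definition sphere_dist :: "'a::euclidean_space \<Rightarrow> 'a \<Rightarrow> real" where
  "sphere_dist x y =
     Inf {l. \<exists>\<gamma>. has_length \<gamma> l \<and> path_image \<gamma> \<subseteq> sphere 0 1 \<and> pathstart \<gamma> = x \<and> pathfinish \<gamma> = y}"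

text \<open>
  In the following, \<open>f\<close> and \<open>V\<close> matter only on the sphere: a derivative \<open>at z within sphere 0 1\<close> is
  determined exactly on the tangent space \<open>{h. h \<bullet> z = 0}\<close> (in dimension at least 2). The
  gradient is the tangent vector representing the differential. The derivative of a field is
  normalized to vanish in the normal direction.
\<close>

definition sphere_grad :: "('a::euclidean_space \<Rightarrow> real) \<Rightarrow> 'a \<Rightarrow> 'a" where
  "sphere_grad f z =
     (THE v. v \<bullet> z = 0 \<and> (f has_derivative (\<lambda>h. v \<bullet> h)) (at z within sphere 0 1))"

definition sphere_deriv :: "('a::euclidean_space \<Rightarrow> 'a) \<Rightarrow> 'a \<Rightarrow> 'a \<Rightarrow> 'a" where
  "sphere_deriv V z = (THE D. D z = 0 \<and> (V has_derivative D) (at z within sphere 0 1))"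

text \<open>
  The Levi-Civita derivative \<open>\<nabla>\<^sub>h V\<close> is the tangential part of \<open>sphere_deriv V z h\<close>. Its trace over the
  tangent space is the trace of \<open>sphere_deriv V z\<close> over the whole space, because the latter
  map kills \<open>z\<close>.
\<close>

definition sphere_div :: "('a::euclidean_space \<Rightarrow> 'a) \<Rightarrow> 'a \<Rightarrow> real" where
  "sphere_div V z = (\<Sum>b\<in>Basis. sphere_deriv V z b \<bullet> b)"

definition laplace_beltrami :: "('a::euclidean_space \<Rightarrow> real) \<Rightarrow> 'a \<Rightarrow> real" where
  "laplace_beltrami f z = sphere_div (sphere_grad f) z"

definition sphere_C2 :: "('a::euclidean_space \<Rightarrow> real) \<Rightarrow> bool" where
  "sphere_C2 f \<longleftrightarrow>
     f differentiable_on sphere 0 1 \<and>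
     sphere_grad f differentiable_on sphere 0 1 \<and>
     (\<forall>h. continuous_on (sphere 0 1) (\<lambda>z. sphere_deriv (sphere_grad f) z h))"


section \<open>Diffusions\<close>

definition transition_function ::
    "'a::topological_space set \<Rightarrow> (real \<Rightarrow> 'a \<Rightarrow> 'a measure) \<Rightarrow> bool" where
  "transition_function S P \<longleftrightarrow>
     (\<forall>t\<ge>0. P t \<in> restrict_space borel S \<rightarrow>\<^sub>M prob_algebra (restrict_space borel S)) \<and>
     (\<forall>z\<in>S. P 0 z = return (restrict_space borel S) z) \<and>
     (\<forall>s\<ge>0. \<forall>t\<ge>0. \<forall>z\<in>S. P (s + t) z = P s z \<bind> P t)"

text \<open>
  The natural filtration is indexed by \<open>[0,\<infinity>]\<close>, i.e. by \<^typ>\<open>ennreal\<close>, so that the library notions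
  of stopping time and of the \<open>\<sigma>\<close>-algebra of a stopping time cover stopping times with value \<open>\<infinity>\<close>.
  Processes are indexed by the reals, and only nonnegative times matter.
\<close>

definition natural_filtration ::
    "'w measure \<Rightarrow> (real \<Rightarrow> 'w \<Rightarrow> 'a::topological_space) \<Rightarrow> ennreal \<Rightarrow> 'w measure" where
  "natural_filtration M X t =
     sigma (space M)
       {X s -` A \<inter> space M | s A. 0 \<le> s \<and> ennreal s \<le> t \<and> A \<in> sets borel}"

lemma filtration_natural_filtration: "filtration (space M) (natural_filtration M X)"
proof
  show "space (natural_filtration M X t) = space M" for t
    unfolding natural_filtration_def by (rule space_measure_of) auto
  fix s t :: ennreal assume "s \<le> t"
  then show "sets (natural_filtration M X s) \<subseteq> sets (natural_filtration M X t)"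
    unfolding natural_filtration_def
    by (intro sigma_le_sets[THEN iffD2]) (auto intro: order_trans)
qed

definition strong_markov ::
    "'w measure \<Rightarrow> 'a::topological_space set \<Rightarrow> (real \<Rightarrow> 'a \<Rightarrow> 'a measure) \<Rightarrow>
     (real \<Rightarrow> 'w \<Rightarrow> 'a) \<Rightarrow> bool" where
  "strong_markov M S P X \<longleftrightarrow>
     (\<forall>\<tau>. stopping_time (natural_filtration M X) \<tau> \<longrightarrow>
       (\<forall>t\<ge>0. \<forall>A\<in>sets (restrict_space borel S).
         AE \<omega> in M. \<tau> \<omega> < \<infinity> \<longrightarrow>
           real_cond_exp M (filtration.pre_sigma (space M) (natural_filtration M X) \<tau>)
             (indicator {\<omega> \<in> space M. \<tau> \<omega> < \<infinity> \<and> X (enn2real (\<tau> \<omega>) + t) \<omega> \<in> A}) \<omega>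
           = measure (P t (X (enn2real (\<tau> \<omega>)) \<omega>)) A))"

definition diffusion_with ::
    "'w measure \<Rightarrow> 'a::topological_space set \<Rightarrow> (real \<Rightarrow> 'a \<Rightarrow> 'a measure) \<Rightarrow>
     (real \<Rightarrow> 'w \<Rightarrow> 'a) \<Rightarrow> bool" where
  "diffusion_with M S P X \<longleftrightarrow>
     prob_space M \<and>
     (\<forall>t\<ge>0. X t \<in> M \<rightarrow>\<^sub>M restrict_space borel S) \<and>
     (\<forall>\<omega>\<in>space M. continuous_on {0..} (\<lambda>t. X t \<omega>)) \<and>
     transition_function S P \<and>
     strong_markov M S P X"

definition diffusion ::
    "'w measure \<Rightarrow> 'a::topological_space set \<Rightarrow> (real \<Rightarrow> 'w \<Rightarrow> 'a) \<Rightarrow> bool" where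
  "diffusion M S X \<longleftrightarrow> (\<exists>P. diffusion_with M S P X)"

text \<open>
  \<open>in_generator S P f g\<close>: with respect to uniform convergence on \<open>S\<close>, \<open>f\<close> is in the domain of the
  infinitesimal generator of the semigroup given by \<open>P\<close>, which maps it to \<open>g\<close>.
\<close>

definition in_generator ::
    "'a set \<Rightarrow> (real \<Rightarrow> 'a \<Rightarrow> 'a measure) \<Rightarrow> ('a \<Rightarrow> real) \<Rightarrow> ('a \<Rightarrow> real) \<Rightarrow> bool" where
  "in_generator S P f g \<longleftrightarrow>
     uniform_limit S (\<lambda>t z. ((\<integral>w. f w \<partial>P t z) - f z) / t) g (at_right 0)"


section \<open>Spherical Brownian motion and its couplings\<close>

text \<open>
  The generator is \<open>\<Delta>/2\<close> on \<open>C\<^sup>2\<close> functions. This determines \<open>P t z\<close> for \<open>t \<ge> 0\<close> and \<open>z\<close> in the sphere, since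
  the heat semigroup \<open>H\<close> preserves \<open>C\<^sup>2\<close> and \<open>s \<mapsto> P\<^sub>t\<^sub>-\<^sub>s (H\<^sub>s f)\<close> has derivative \<open>0\<close>.
  Hence \<open>P t z A\<close> is the probability that Brownian motion started at \<open>z\<close> is in \<open>A\<close> at time \<open>t\<close>.
\<close>

definition brownian_transition :: "(real \<Rightarrow> 'a::euclidean_space \<Rightarrow> 'a measure) \<Rightarrow> bool" where
  "brownian_transition P \<longleftrightarrow>
     transition_function (sphere 0 1) P \<and>
     (\<forall>f. sphere_C2 f \<longrightarrow> in_generator (sphere 0 1) P f (\<lambda>z. laplace_beltrami f z / 2))"

definition sphere_brownian_motion ::
    "'w measure \<Rightarrow> (real \<Rightarrow> 'w \<Rightarrow> 'a::euclidean_space) \<Rightarrow> bool" where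
  "sphere_brownian_motion M X \<longleftrightarrow>
     (\<exists>P. brownian_transition P \<and> diffusion_with M (sphere 0 1) P X)"

definition brownian_coupling ::
    "'w measure \<Rightarrow> (real \<Rightarrow> 'w \<Rightarrow> 'a::euclidean_space) \<Rightarrow> (real \<Rightarrow> 'w \<Rightarrow> 'a) \<Rightarrow> bool" where
  "brownian_coupling M X Y \<longleftrightarrow> sphere_brownian_motion M X \<and> sphere_brownian_motion M Y"

definition coadapted_coupling ::
    "'w measure \<Rightarrow> (real \<Rightarrow> 'w \<Rightarrow> 'a::euclidean_space) \<Rightarrow> (real \<Rightarrow> 'w \<Rightarrow> 'a) \<Rightarrow> bool" where
  "coadapted_coupling M X Y \<longleftrightarrow>
     brownian_coupling M X Y \<and>
     (\<exists>P. brownian_transition P \<and>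
       (\<forall>s\<ge>0. \<forall>t\<ge>0. \<forall>A\<in>sets (restrict_space borel (sphere 0 1)).
         (AE \<omega> in M.
           real_cond_exp M (natural_filtration M (\<lambda>u \<omega>. (X u \<omega>, Y u \<omega>)) (ennreal s))
             (indicator {\<omega> \<in> space M. X (s + t) \<omega> \<in> A}) \<omega> = measure (P t (X s \<omega>)) A) \<and>
         (AE \<omega> in M.
           real_cond_exp M (natural_filtration M (\<lambda>u \<omega>. (X u \<omega>, Y u \<omega>)) (ennreal s))
             (indicator {\<omega> \<in> space M. Y (s + t) \<omega> \<in> A}) \<omega> = measure (P t (Y s \<omega>)) A)))"

end

theory Submission
  imports Defs
begin

text \<open>
  Let \<open>G\<close> be a Brownian motion on the orthogonal group, started at the identity. Then \<open>X = G x\<close> and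
  \<open>Y = G y\<close> are spherical Brownian motions, and their distance is constant because \<open>G t\<close> is an isometry.
  Every process \<open>G z\<close> with \<open>G\<close> acting on some closed set, in particular the pair, inherits the strong
  Markov property from the independent increments of \<open>G\<close>, even with respect to the filtration of \<open>G\<close>.

  \<open>G\<close> is a limit of random products \<open>(1 + b\<^sub>k) \<cdots> (1 + b\<^sub>1)\<close> with independent Gaussian skew-symmetric
  matrices \<open>b\<^sub>i\<close> of variance \<open>h = 2\<^sup>-\<^sup>m\<close>, normalized by \<open>exp (- (n - 1) t / 2)\<close>. The increments at level \<open>m\<close>
  are sums of pairs of increments at level \<open>m + 1\<close>, whence the products at dyadic times form a Cauchy
  sequence in \<open>L\<^sup>2\<close>. Second and fourth moments show that the limit is orthogonal; the
  fourth moment of the displacement yields continuity in the manner of Chentsov. The generator is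
  obtained from the exact first and second moments of \<open>G t\<close> by a second order Taylor expansion along great circles.
\<close>

section \<open>Independent normal variables at all dyadic scales\<close>

text \<open>Left multiplication makes orbits Markov: \<open>G (s + t) = R ** G s\<close>, where
  \<open>R\<close> is independent of the past and distributed as \<open>G t\<close>, so that the
  motion of \<open>G z\<close> after time \<open>s\<close> depends on its present position only. One
  orthogonal matrix moves both points, hence cut loci never enter. The factors are Euler steps
  instead of exponentials. Skew-symmetry makes \<open>b v\<close> orthogonal to \<open>v\<close>,
  and first and second moments obey exact scalar recursions without any stochastic integral. The
  price is that the products are orthogonal only in the limit: the variance of the squared norm has
  to be shown to vanish. A step at \<open>v\<close> has covariance \<open>h (|v|^2 - v v^T)\<close>,
  which on the unit sphere is \<open>h\<close> times the tangential projection; this is the source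
  of half the Laplacian. First and second moments determine the generator because the Taylor
  polynomial can be written as a quadratic polynomial in the ambient coordinates of the endpoint.
  Continuity needs the fourth moment since the second moment of a displacement is only of order
  \<open>t\<close>, while its fourth moment is of order \<open>t^2\<close>; on the sphere it is a
  quadratic polynomial in an inner product and again reduces to the first two moments.\<close>

text \<open>The joint law is prescribed on the product over the whole index type, instead of
  independence plus marginals: reindexing and regrouping then reduce to images of one product
  measure.\<close>

definition iid_family :: "'w measure \<Rightarrow> 'a measure \<Rightarrow> ('i \<Rightarrow> 'w \<Rightarrow> 'a) \<Rightarrow> bool" where
  "iid_family M N X \<longleftrightarrow> (\<forall>i. X i \<in> M \<rightarrow>\<^sub>M N) \<and>
     distr M (PiM UNIV (\<lambda>_. N)) (\<lambda>\<omega> i. X i \<omega>) = PiM UNIV (\<lambda>_. N)"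

lemma iid_family_measurable: "iid_family M N X \<Longrightarrow> X i \<in> M \<rightarrow>\<^sub>M N"
  by (auto simp: iid_family_def)

lemma measurable_PiM_UNIV:
  "(\<And>i. X i \<in> M \<rightarrow>\<^sub>M N i) \<Longrightarrow> (\<lambda>\<omega> i. X i \<omega>) \<in> M \<rightarrow>\<^sub>M PiM UNIV N"
  by (rule measurable_PiM_single') (auto simp: measurable_def)

text \<open>Finite cylinders determine a product measure. The empty \<open>J\<close> is included and
  forces \<open>M\<close> to have total mass 1.\<close>

lemma iid_familyI:
  fixes X :: "'i \<Rightarrow> 'w \<Rightarrow> 'a"
  assumes "prob_space N" and X: "\<And>i. X i \<in> M \<rightarrow>\<^sub>M N"
    and eq: "\<And>J A. finite J \<Longrightarrow> (\<And>j. j \<in> J \<Longrightarrow> A j \<in> sets N) \<Longrightarrow>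
      emeasure M {\<omega>\<in>space M. \<forall>j\<in>J. X j \<omega> \<in> A j} = (\<Prod>j\<in>J. emeasure N (A j))"
  shows "iid_family M N X"
proof -
  interpret N: prob_space N by fact
  interpret P: product_prob_space "\<lambda>_. N" UNIV ..
  have "distr M (PiM UNIV (\<lambda>_. N)) (\<lambda>\<omega> i. X i \<omega>) = PiM UNIV (\<lambda>_. N)"
  proof (rule P.PiM_eq)
    fix J :: "'i set" and F assume J: "finite J" and F: "\<And>j. j \<in> J \<Longrightarrow> F j \<in> sets N"
    have "(\<lambda>\<omega> i. X i \<omega>) -` prod_emb UNIV (\<lambda>_. N) J (Pi\<^sub>E J F) \<inter> space M
      = {\<omega>\<in>space M. \<forall>j\<in>J. X j \<omega> \<in> F j}"
      using measurable_space[OF X] by (auto simp: prod_emb_def PiE_iff)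
    then show "emeasure (distr M (PiM UNIV (\<lambda>_. N)) (\<lambda>\<omega> i. X i \<omega>)) (prod_emb UNIV (\<lambda>_. N) J (Pi\<^sub>E J F))
        = (\<Prod>j\<in>J. emeasure N (F j))"
      using J F by (subst emeasure_distr) (auto simp: eq intro!: measurable_PiM_UNIV X)
  qed simp
  with X show ?thesis by (simp add: iid_family_def)
qed

lemma iid_family_distr:
  assumes "prob_space N" "iid_family M N X"
  shows "distr M N (X i) = N"
proof -
  have "distr M N (X i) = distr (distr M (PiM UNIV (\<lambda>_. N)) (\<lambda>\<omega> i. X i \<omega>)) N (\<lambda>w. w i)"
    by (subst distr_distr) (auto simp: comp_def intro!: measurable_PiM_UNIV iid_family_measurable[OF assms(2)])
  also have "\<dots> = N"
    using assms distr_PiM_component[of UNIV "\<lambda>_. N" i] by (simp add: iid_family_def)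
  finally show ?thesis .
qed

lemma (in prob_space) iid_family_indep_vars:
  assumes "prob_space N" "iid_family M N X"
  shows "indep_vars (\<lambda>_. N) X UNIV"
  using assms
  by (subst indep_vars_iff_distr_eq_PiM)
     (auto simp: iid_family_distr iid_family_measurable restrict_UNIV, simp add: iid_family_def)

lemma iid_family_reindex:
  assumes "prob_space N" "iid_family M N X" "inj f"
  shows "iid_family M N (\<lambda>i. X (f i))"
proof -
  have "distr M (PiM UNIV (\<lambda>_. N)) (\<lambda>\<omega> i. X (f i) \<omega>)
     = distr (distr M (PiM UNIV (\<lambda>_. N)) (\<lambda>\<omega> i. X i \<omega>)) (PiM UNIV (\<lambda>_. N)) (\<lambda>w i. w (f i))"
    by (subst distr_distr) (auto simp: comp_def intro!: measurable_PiM_UNIV iid_family_measurable[OF assms(2)])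
  also have "\<dots> = PiM UNIV (\<lambda>_. N)"
    using assms distr_PiM_reindex[of UNIV "\<lambda>_. N" f UNIV] by (simp add: iid_family_def restrict_UNIV)
  finally show ?thesis
    using assms by (auto simp: iid_family_def)
qed

lemma (in prob_space) iid_family_distr_Pair:
  assumes N: "prob_space N" and X: "iid_family M N X" and ij: "i \<noteq> j"
  shows "distr M (N \<Otimes>\<^sub>M N) (\<lambda>\<omega>. (X i \<omega>, X j \<omega>)) = N \<Otimes>\<^sub>M N"
proof -
  have "indep_var N ((\<lambda>w. w i) \<circ> (\<lambda>\<omega>. restrict (\<lambda>k. X k \<omega>) {i})) N ((\<lambda>w. w j) \<circ> (\<lambda>\<omega>. restrict (\<lambda>k. X k \<omega>) {j}))"
    using ij by (intro indep_var_compose[OF indep_var_restrict[OF iid_family_indep_vars[OF N X], of "{i}" "{j}"]]) auto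
  then have "indep_var N (X i) N (X j)"
    by (simp add: comp_def)
  then show ?thesis
    using iid_family_distr[OF N X] by (simp add: indep_var_distribution_eq)
qed

text \<open>Disjoint pairs are independent of each other, and a map that preserves
  \<open>N \<Otimes>\<^sub>M N\<close> leaves the two components of a pair independent with law
  \<open>N\<close>. The map may vary with the block, so that mixed and merely copied pairs are
  treated together.\<close>

lemma (in prob_space) iid_family_blocks:
  fixes X :: "'i \<Rightarrow> 'a \<Rightarrow> 'b" and e :: "'k \<times> bool \<Rightarrow> 'i"
  assumes N: "prob_space N" and X: "iid_family M N X" and e: "inj e"
    and \<phi>: "\<And>k. \<phi> k \<in> N \<Otimes>\<^sub>M N \<rightarrow>\<^sub>M N \<Otimes>\<^sub>M N" "\<And>k. distr (N \<Otimes>\<^sub>M N) (N \<Otimes>\<^sub>M N) (\<phi> k) = N \<Otimes>\<^sub>M N"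
  defines "V \<equiv> \<lambda>k \<omega>. \<phi> k (X (e (k, True)) \<omega>, X (e (k, False)) \<omega>)"
  shows "iid_family M N (\<lambda>(k, b) \<omega>. if b then fst (V k \<omega>) else snd (V k \<omega>))"
proof -
  interpret N: prob_space N by fact
  interpret NN: pair_prob_space N N ..
  have e_eq: "e x = e y \<longleftrightarrow> x = y" for x y using e by (auto dest: injD)
  have X_m[measurable]: "X i \<in> M \<rightarrow>\<^sub>M N" for i using X by (rule iid_family_measurable)
  note \<phi>(1)[measurable]
  have V_m[measurable]: "V k \<in> M \<rightarrow>\<^sub>M N \<Otimes>\<^sub>M N" for k unfolding V_def by measurable
  have V_law: "distr M (N \<Otimes>\<^sub>M N) (V k) = N \<Otimes>\<^sub>M N" for k
  proof -
    have "distr M (N \<Otimes>\<^sub>M N) (V k) = distr (distr M (N \<Otimes>\<^sub>M N) (\<lambda>\<omega>. (X (e (k, True)) \<omega>, X (e (k, False)) \<omega>))) (N \<Otimes>\<^sub>M N) (\<phi> k)"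
      by (subst distr_distr) (auto simp: V_def comp_def)
    also have "\<dots> = N \<Otimes>\<^sub>M N"
      by (subst iid_family_distr_Pair[OF N X]) (auto simp: e_eq \<phi>)
    finally show ?thesis .
  qed
  have V_indep: "indep_vars (\<lambda>_. N \<Otimes>\<^sub>M N) V UNIV"
  proof -
    have "indep_vars (\<lambda>_. N \<Otimes>\<^sub>M N)
        (\<lambda>k. (\<lambda>w. \<phi> k (w (e (k, True)), w (e (k, False)))) \<circ> (\<lambda>\<omega>. restrict (\<lambda>i. X i \<omega>) {e (k, True), e (k, False)})) UNIV"
      by (rule indep_vars_compose[OF indep_vars_restrict[OF iid_family_indep_vars[OF N X]]])
         (auto simp: disjoint_family_on_def e_eq)
    then show ?thesis by (simp add: V_def comp_def)
  qed
  let ?Y = "\<lambda>(k, b) \<omega>. if b then fst (V k \<omega>) else snd (V k \<omega>)"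
  show ?thesis
  proof (rule iid_familyI[OF N])
    show "?Y i \<in> M \<rightarrow>\<^sub>M N" for i by (cases i) auto
    fix J :: "('k \<times> bool) set" and A assume J: "finite J" and A: "\<And>j. j \<in> J \<Longrightarrow> A j \<in> sets N"
    \<comment> \<open>A block is tested with both of its components at once; a component that
      \<open>J\<close> does not mention gets the whole space, at the cost of a factor 1.\<close>
    define A' where "A' j = (if j \<in> J then A j else space N)" for j
    have A'[measurable]: "A' j \<in> sets N" for j using A by (auto simp: A'_def)
    define K where "K = fst ` J"
    have K: "finite K" "J \<subseteq> K \<times> UNIV" using J by (auto simp: K_def rev_image_eqI)
    have sp: "fst (V k \<omega>) \<in> space N" "snd (V k \<omega>) \<in> space N" if "\<omega> \<in> space M" for k \<omega>
      using measurable_space[OF V_m that, of k] by (auto simp: space_pair_measure)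
    have "emeasure M {\<omega>\<in>space M. \<forall>j\<in>J. ?Y j \<omega> \<in> A j} = (\<Prod>j\<in>J. emeasure N (A j))"
    proof (cases "K = {}")
      case True
      then show ?thesis by (simp add: K_def emeasure_space_1)
    next
      case False
      have "{\<omega>\<in>space M. \<forall>j\<in>J. ?Y j \<omega> \<in> A j} = (\<Inter>k\<in>K. V k -` (A' (k, True) \<times> A' (k, False)) \<inter> space M)"
      proof (intro set_eqI iffI)
        fix \<omega> assume "\<omega> \<in> {\<omega>\<in>space M. \<forall>j\<in>J. ?Y j \<omega> \<in> A j}"
        then show "\<omega> \<in> (\<Inter>k\<in>K. V k -` (A' (k, True) \<times> A' (k, False)) \<inter> space M)"
          using sp[of \<omega>] by (fastforce simp: A'_def mem_Times_iff)
      next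
        fix \<omega> assume *: "\<omega> \<in> (\<Inter>k\<in>K. V k -` (A' (k, True) \<times> A' (k, False)) \<inter> space M)"
        have "?Y j \<omega> \<in> A j" if "j \<in> J" for j
        proof -
          have "fst j \<in> K" using that by (auto simp: K_def)
          with * have "V (fst j) \<omega> \<in> A' (fst j, True) \<times> A' (fst j, False)" by blast
          then show ?thesis using that
            by (cases j) (auto simp: A'_def mem_Times_iff split: if_splits)
        qed
        with * False show "\<omega> \<in> {\<omega>\<in>space M. \<forall>j\<in>J. ?Y j \<omega> \<in> A j}" by auto
      qed
      also have "emeasure M \<dots> = (\<Prod>k\<in>K. emeasure M (V k -` (A' (k, True) \<times> A' (k, False)) \<inter> space M))"
        using indep_varsD[OF V_indep False K(1), of "\<lambda>k. A' (k, True) \<times> A' (k, False)"]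
        by (simp add: emeasure_eq_measure prod_ennreal)
      also have "\<dots> = (\<Prod>k\<in>K. emeasure (N \<Otimes>\<^sub>M N) (A' (k, True) \<times> A' (k, False)))"
      proof (rule prod.cong[OF refl])
        fix k
        have "emeasure M (V k -` (A' (k, True) \<times> A' (k, False)) \<inter> space M)
          = emeasure (distr M (N \<Otimes>\<^sub>M N) (V k)) (A' (k, True) \<times> A' (k, False))"
          by (subst emeasure_distr) auto
        then show "emeasure M (V k -` (A' (k, True) \<times> A' (k, False)) \<inter> space M)
          = emeasure (N \<Otimes>\<^sub>M N) (A' (k, True) \<times> A' (k, False))"
          by (simp add: V_law)
      qed
      also have "\<dots> = (\<Prod>k\<in>K. \<Prod>b\<in>UNIV. emeasure N (A' (k, b)))"
        by (simp add: N.emeasure_pair_measure_Times UNIV_bool mult.commute)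
      also have "\<dots> = (\<Prod>j\<in>K \<times> UNIV. emeasure N (A' j))"
        by (subst prod.cartesian_product) simp
      also have "\<dots> = (\<Prod>j\<in>J. emeasure N (A' j))"
        using K by (intro prod.mono_neutral_right) (auto simp: A'_def N.emeasure_space_1)
      also have "\<dots> = (\<Prod>j\<in>J. emeasure N (A j))"
        by (intro prod.cong) (auto simp: A'_def)
      finally show ?thesis .
    qed
    then show "emeasure M {\<omega> \<in> space M. \<forall>j\<in>J. ?Y j \<omega> \<in> A j} = (\<Prod>j\<in>J. emeasure N (A j))" .
  qed
qed

section \<open>Invariance of the planar standard normal law under an orthogonal map\<close>

definition std_normal :: "real measure" where
  "std_normal = density lborel std_normal_density"

lemma sets_std_normal[measurable_cong, simp]: "sets std_normal = sets borel"
  by (simp add: std_normal_def)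

lemma prob_space_std_normal: "prob_space std_normal"
  unfolding std_normal_def by (rule prob_space_normal_density) simp

text \<open>An orthogonal involution. Applied to a coarse variable and a fresh one it yields two
  finer variables, and since it is its own inverse, their normalized sum is the coarse variable
  again.\<close>

definition gauss_rot :: "real \<times> real \<Rightarrow> real \<times> real" where
  "gauss_rot p = ((fst p + snd p) / sqrt 2, (fst p - snd p) / sqrt 2)"

lemma measurable_gauss_rot[measurable]: "gauss_rot \<in> borel \<Otimes>\<^sub>M borel \<rightarrow>\<^sub>M borel \<Otimes>\<^sub>M borel"
  unfolding gauss_rot_def by measurable

text \<open>Two affine substitutions, each in one variable: the first produces a factor
  \<open>sqrt 2\<close>, which the second absorbs.\<close>

lemma nn_integral_gauss_rot:
  fixes f :: "real \<times> real \<Rightarrow> ennreal"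
  assumes [measurable]: "f \<in> borel_measurable (borel \<Otimes>\<^sub>M borel)"
  shows "(\<integral>\<^sup>+x. \<integral>\<^sup>+y. f (gauss_rot (x, y)) \<partial>lborel \<partial>lborel) = (\<integral>\<^sup>+x. \<integral>\<^sup>+y. f (x, y) \<partial>lborel \<partial>lborel)"
proof -
  define s where "s = sqrt 2"
  have s: "s > 0" "s * s = 2" "2 / s = s" by (auto simp: s_def real_div_sqrt)
  have "(\<integral>\<^sup>+x. \<integral>\<^sup>+y. f (gauss_rot (x, y)) \<partial>lborel \<partial>lborel)
      = (\<integral>\<^sup>+y. \<integral>\<^sup>+x. f ((x + y) / s, (x - y) / s) \<partial>lborel \<partial>lborel)"
    by (subst lborel_pair.Fubini') (auto simp: gauss_rot_def s_def)
  also have "\<dots> = (\<integral>\<^sup>+y. ennreal s * (\<integral>\<^sup>+x. f (x, x - 2 / s * y) \<partial>lborel) \<partial>lborel)"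
  proof (rule nn_integral_cong)
    fix y
    have "(\<integral>\<^sup>+x. f ((x + y) / s, (x - y) / s) \<partial>lborel) = \<bar>s\<bar> * (\<integral>\<^sup>+x. f ((- y + s * x + y) / s, (- y + s * x - y) / s) \<partial>lborel)"
      using s by (intro nn_integral_real_affine) auto
    also have "(\<lambda>x. f ((- y + s * x + y) / s, (- y + s * x - y) / s)) = (\<lambda>x. f (x, x - 2 / s * y))"
      using s by (auto simp: fun_eq_iff divide_simps mult.commute)
    finally show "(\<integral>\<^sup>+x. f ((x + y) / s, (x - y) / s) \<partial>lborel) = ennreal s * (\<integral>\<^sup>+x. f (x, x - 2 / s * y) \<partial>lborel)"
      using s by simp
  qed
  also have "\<dots> = ennreal s * (\<integral>\<^sup>+x. \<integral>\<^sup>+y. f (x, x - s * y) \<partial>lborel \<partial>lborel)"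
    by (subst nn_integral_cmult, simp, subst lborel_pair.Fubini') (auto simp: s)
  also have "\<dots> = (\<integral>\<^sup>+x. ennreal s * (\<integral>\<^sup>+y. f (x, x + (- s) * y) \<partial>lborel) \<partial>lborel)"
    by (subst nn_integral_cmult) auto
  also have "\<dots> = (\<integral>\<^sup>+x. \<integral>\<^sup>+y. f (x, y) \<partial>lborel \<partial>lborel)"
  proof (rule nn_integral_cong)
    fix x
    have "(\<integral>\<^sup>+y. f (x, y) \<partial>lborel) = \<bar>- s\<bar> * (\<integral>\<^sup>+y. f (x, x + (- s) * y) \<partial>lborel)"
      using s by (intro nn_integral_real_affine) auto
    then show "ennreal s * (\<integral>\<^sup>+y. f (x, x + (- s) * y) \<partial>lborel) = (\<integral>\<^sup>+y. f (x, y) \<partial>lborel)"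
      using s by simp
  qed
  finally show ?thesis .
qed

lemma std_normal_density_gauss_rot:
  "std_normal_density (fst (gauss_rot (x, y))) * std_normal_density (snd (gauss_rot (x, y)))
    = std_normal_density x * std_normal_density y"
proof -
  have "((x + y) / sqrt 2)\<^sup>2 + ((x - y) / sqrt 2)\<^sup>2 = x\<^sup>2 + y\<^sup>2"
    by (simp add: power_divide power2_eq_square algebra_simps flip: add_divide_distrib)
  then have "exp (- ((x + y) / sqrt 2)\<^sup>2 / 2) * exp (- ((x - y) / sqrt 2)\<^sup>2 / 2) = exp (- x\<^sup>2 / 2) * exp (- y\<^sup>2 / 2)"
    by (simp add: exp_add[symmetric] add_divide_distrib[symmetric])
  then show ?thesis
    by (simp add: std_normal_density_def gauss_rot_def)
qed

lemma nn_integral_std_normal_pair: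
  fixes f :: "real \<times> real \<Rightarrow> ennreal"
  assumes [measurable]: "f \<in> borel_measurable (borel \<Otimes>\<^sub>M borel)"
  shows "(\<integral>\<^sup>+p. f p \<partial>(std_normal \<Otimes>\<^sub>M std_normal))
    = (\<integral>\<^sup>+x. \<integral>\<^sup>+y. ennreal (std_normal_density x * std_normal_density y) * f (x, y) \<partial>lborel \<partial>lborel)"
proof -
  interpret N: prob_space std_normal by (rule prob_space_std_normal)
  have "(\<integral>\<^sup>+p. f p \<partial>(std_normal \<Otimes>\<^sub>M std_normal)) = (\<integral>\<^sup>+x. \<integral>\<^sup>+y. f (x, y) \<partial>std_normal \<partial>std_normal)"
    by (rule N.nn_integral_fst[symmetric]) (simp cong: measurable_cong_sets)
  also have "\<dots> = (\<integral>\<^sup>+x. ennreal (std_normal_density x) * (\<integral>\<^sup>+y. ennreal (std_normal_density y) * f (x, y) \<partial>lborel) \<partial>lborel)"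
    unfolding std_normal_def by (simp add: nn_integral_density)
  also have "\<dots> = (\<integral>\<^sup>+x. \<integral>\<^sup>+y. ennreal (std_normal_density x * std_normal_density y) * f (x, y) \<partial>lborel \<partial>lborel)"
    by (intro nn_integral_cong, subst nn_integral_cmult[symmetric]) (auto simp: ennreal_mult mult.assoc)
  finally show ?thesis .
qed

lemma distr_gauss_rot:
  "distr (std_normal \<Otimes>\<^sub>M std_normal) (std_normal \<Otimes>\<^sub>M std_normal) gauss_rot = std_normal \<Otimes>\<^sub>M std_normal"
proof (rule measure_eqI)
  have s[measurable_cong]: "sets (std_normal \<Otimes>\<^sub>M std_normal) = sets (borel \<Otimes>\<^sub>M borel)"
    by (intro sets_pair_measure_cong) auto
  fix A assume "A \<in> sets (distr (std_normal \<Otimes>\<^sub>M std_normal) (std_normal \<Otimes>\<^sub>M std_normal) gauss_rot)"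
  then have A[measurable]: "A \<in> sets (borel \<Otimes>\<^sub>M borel)" by (simp add: s)
  have [measurable]: "gauss_rot \<in> std_normal \<Otimes>\<^sub>M std_normal \<rightarrow>\<^sub>M std_normal \<Otimes>\<^sub>M std_normal"
    by measurable
  let ?g = "\<lambda>p::real\<times>real. ennreal (std_normal_density (fst p) * std_normal_density (snd p)) * indicator A p"
  have "emeasure (distr (std_normal \<Otimes>\<^sub>M std_normal) (std_normal \<Otimes>\<^sub>M std_normal) gauss_rot) A
    = (\<integral>\<^sup>+p. indicator A (gauss_rot p) \<partial>(std_normal \<Otimes>\<^sub>M std_normal))"
    by (subst nn_integral_indicator[symmetric], simp add: s, subst nn_integral_distr) (auto simp: s)
  also have "\<dots> = (\<integral>\<^sup>+x. \<integral>\<^sup>+y. ?g (gauss_rot (x, y)) \<partial>lborel \<partial>lborel)"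
    by (subst nn_integral_std_normal_pair) (auto simp: std_normal_density_gauss_rot)
  also have "\<dots> = (\<integral>\<^sup>+x. \<integral>\<^sup>+y. ?g (x, y) \<partial>lborel \<partial>lborel)"
    by (rule nn_integral_gauss_rot) measurable
  also have "\<dots> = (\<integral>\<^sup>+p. indicator A p \<partial>(std_normal \<Otimes>\<^sub>M std_normal))"
    by (subst nn_integral_std_normal_pair) auto
  also have "\<dots> = emeasure (std_normal \<Otimes>\<^sub>M std_normal) A"
    by (simp add: s)
  finally show "emeasure (distr (std_normal \<Otimes>\<^sub>M std_normal) (std_normal \<Otimes>\<^sub>M std_normal) gauss_rot) A
    = emeasure (std_normal \<Otimes>\<^sub>M std_normal) A" .
qed simp

text \<open>
  At each level, the variables with \<open>m = 0\<close> form the current scale and the others are a stock of fresh ones: the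
  next level splits the former with the help of those with \<open>m = 1\<close>, and moves the rest of the stock down by one.
\<close>

fun gauss_tower :: "(nat \<times> nat \<times> 'i \<Rightarrow> 'w \<Rightarrow> real) \<Rightarrow> nat \<Rightarrow> nat \<times> nat \<times> 'i \<Rightarrow> 'w \<Rightarrow> real" where
  "gauss_tower \<zeta> 0 = \<zeta>"
| "gauss_tower \<zeta> (Suc l) = (\<lambda>(m, j, i) \<omega>.
     let V = (if m = 0 then gauss_rot (gauss_tower \<zeta> l (0, j div 2, i) \<omega>, gauss_tower \<zeta> l (1, j div 2, i) \<omega>)
              else (gauss_tower \<zeta> l (m + 1, 2 * (j div 2), i) \<omega>, gauss_tower \<zeta> l (m + 1, 2 * (j div 2) + 1, i) \<omega>))
     in if even j then fst V else snd V)"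

lemma (in prob_space) iid_gauss_tower:
  assumes \<zeta>: "iid_family M std_normal \<zeta>"
  shows "iid_family M std_normal (gauss_tower \<zeta> l)"
proof (induction l)
  case 0
  then show ?case using \<zeta> by simp
next
  case (Suc l)
  note N = prob_space_std_normal
  \<comment> \<open>\<open>e\<close> names the two variables that block \<open>k\<close> consumes,
    \<open>\<phi>\<close> is what happens to them, and \<open>f\<close> locates a new variable as
    one half of a block. For \<open>m = 0\<close> a scale variable is mixed with a fresh one; for
    \<open>m > 0\<close> two neighbours of the stock are passed on unchanged, grouped in pairs only
    to fit the same lemma.\<close>
  define e :: "(nat \<times> nat \<times> 'b) \<times> bool \<Rightarrow> nat \<times> nat \<times> 'b" where
    "e = (\<lambda>((m, j, i), b). if m = 0 then (if b then 0 else 1, j, i) else (m + 1, 2 * j + (if b then 0 else 1), i))"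
  define \<phi> :: "nat \<times> nat \<times> 'b \<Rightarrow> real \<times> real \<Rightarrow> real \<times> real" where
    "\<phi> = (\<lambda>(m, j, i). if m = 0 then gauss_rot else (\<lambda>x. x))"
  define f :: "nat \<times> nat \<times> 'b \<Rightarrow> (nat \<times> nat \<times> 'b) \<times> bool" where
    "f = (\<lambda>(m, j, i). ((m, j div 2, i), even j))"
  have "inj e"
  proof (rule injI)
    fix x y assume "e x = e y"
    then show "x = y"
      by (cases x; cases y) (auto simp: e_def split: if_splits; presburger)
  qed
  moreover have "\<phi> k \<in> std_normal \<Otimes>\<^sub>M std_normal \<rightarrow>\<^sub>M std_normal \<Otimes>\<^sub>M std_normal" for k
    by (cases k) (auto simp: \<phi>_def)
  moreover have "distr (std_normal \<Otimes>\<^sub>M std_normal) (std_normal \<Otimes>\<^sub>M std_normal) (\<phi> k) = std_normal \<Otimes>\<^sub>M std_normal" for k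
    by (cases k) (auto simp: \<phi>_def distr_gauss_rot distr_id2)
  ultimately have "iid_family M std_normal (\<lambda>(k, b) \<omega>.
      if b then fst (\<phi> k (gauss_tower \<zeta> l (e (k, True)) \<omega>, gauss_tower \<zeta> l (e (k, False)) \<omega>))
      else snd (\<phi> k (gauss_tower \<zeta> l (e (k, True)) \<omega>, gauss_tower \<zeta> l (e (k, False)) \<omega>)))" (is "iid_family M _ ?Z")
    by (rule iid_family_blocks[OF N Suc])
  moreover have "inj f"
  proof (rule injI)
    fix x y assume "f x = f y"
    then show "x = y"
      by (cases x; cases y) (auto simp: f_def; metis even_two_times_div_two odd_two_times_div_two_succ)
  qed
  ultimately have "iid_family M std_normal (\<lambda>i. ?Z (f i))"
    by (rule iid_family_reindex[OF N])
  also have "(\<lambda>i. ?Z (f i)) = gauss_tower \<zeta> (Suc l)"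
    by (auto simp: fun_eq_iff f_def e_def \<phi>_def Let_def)
  finally show ?case .
qed

text \<open>The sample space is to consist of functions from the reals to a Euclidean space. A
  product measure on it carries a real normal variable along one basis vector at each real index,
  and an injection of \<open>'k\<close> into the reals selects the family.\<close>

lemma ex_iid_normal:
  fixes f :: "'k \<Rightarrow> real"
  assumes f: "inj f"
  shows "\<exists>(M :: (real \<Rightarrow> 'b::euclidean_space) measure) X. prob_space M \<and> iid_family M std_normal (X :: 'k \<Rightarrow> _)"
proof -
  obtain b :: 'b where b: "b \<in> Basis" using nonempty_Basis by blast
  define \<kappa> where "\<kappa> = distr std_normal borel (\<lambda>r. r *\<^sub>R b)"
  interpret N: prob_space std_normal by (rule prob_space_std_normal)
  interpret K: prob_space \<kappa> unfolding \<kappa>_def by (rule N.prob_space_distr) measurable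
  define M :: "(real \<Rightarrow> 'b) measure" where "M = PiM UNIV (\<lambda>_. \<kappa>)"
  interpret P: product_prob_space "\<lambda>_::real. \<kappa>" UNIV ..
  have [measurable_cong]: "sets \<kappa> = sets borel" by (simp add: \<kappa>_def)
  have dist: "distr \<kappa> std_normal (\<lambda>v. v \<bullet> b) = std_normal"
  proof -
    have "distr \<kappa> std_normal (\<lambda>v. v \<bullet> b) = distr std_normal std_normal (\<lambda>r. r)"
      unfolding \<kappa>_def using b by (subst distr_distr) (auto simp: comp_def inner_Basis)
    then show ?thesis by (simp add: distr_id2)
  qed
  have "iid_family M std_normal (\<lambda>t w. w t \<bullet> b)"
  proof (rule iid_familyI[OF prob_space_std_normal])
    show "(\<lambda>w. w t \<bullet> b) \<in> M \<rightarrow>\<^sub>M std_normal" for t unfolding M_def by measurable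
    fix J :: "real set" and A assume J: "finite J" and A: "\<And>j. j \<in> J \<Longrightarrow> A j \<in> sets std_normal"
    have "{w \<in> space M. \<forall>j\<in>J. w j \<bullet> b \<in> A j} = prod_emb UNIV (\<lambda>_. \<kappa>) J (Pi\<^sub>E J (\<lambda>j. (\<lambda>v. v \<bullet> b) -` A j \<inter> space \<kappa>))"
      by (auto simp: M_def prod_emb_def PiE_iff space_PiM)
    also have "emeasure M \<dots> = (\<Prod>j\<in>J. emeasure \<kappa> ((\<lambda>v. v \<bullet> b) -` A j \<inter> space \<kappa>))"
      unfolding M_def using J A by (intro P.emeasure_PiM_emb) (auto intro!: measurable_sets_borel)
    also have "\<dots> = (\<Prod>j\<in>J. emeasure (distr \<kappa> std_normal (\<lambda>v. v \<bullet> b)) (A j))"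
      using A by (intro prod.cong refl emeasure_distr[symmetric]) auto
    finally show "emeasure M {w \<in> space M. \<forall>j\<in>J. w j \<bullet> b \<in> A j} = (\<Prod>j\<in>J. emeasure std_normal (A j))"
      by (simp add: dist)
  qed
  from iid_family_reindex[OF prob_space_std_normal this f] show ?thesis
    using P.prob_space_axioms unfolding M_def by (intro exI[of _ "PiM UNIV (\<lambda>_. \<kappa>)"]) auto
qed

text \<open>Only the current scales \<open>m = 0\<close> of the levels are kept. With steps of
  variance \<open>2^-l\<close>, the last clause says that a coarse increment is the sum of its two
  halves.\<close>

theorem ex_normal_tower:
  "\<exists>(M :: (real \<Rightarrow> 'b::euclidean_space) measure) (X :: nat \<Rightarrow> nat \<times> 'i::countable \<Rightarrow> _).
     prob_space M \<and> (\<forall>l. iid_family M std_normal (X l)) \<and>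
     (\<forall>l j i \<omega>. X l (j, i) \<omega> = (X (Suc l) (2 * j, i) \<omega> + X (Suc l) (2 * j + 1, i) \<omega>) / sqrt 2)"
proof -
  have "inj (\<lambda>k::nat \<times> nat \<times> 'i. real (to_nat k))"
    by (auto simp: inj_def)
  from ex_iid_normal[OF this] obtain M :: "(real \<Rightarrow> 'b) measure" and \<zeta> :: "nat \<times> nat \<times> 'i \<Rightarrow> _"
    where M: "prob_space M" and \<zeta>: "iid_family M std_normal \<zeta>" by blast
  interpret prob_space M by fact
  define X where "X l = (\<lambda>(j, i). gauss_tower \<zeta> l (0, j, i))" for l
  have "iid_family M std_normal (X l)" for l
    using iid_family_reindex[OF prob_space_std_normal iid_gauss_tower[OF \<zeta>, of l], of "\<lambda>(j, i). (0, j, i)"]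
    by (auto simp: X_def inj_def case_prod_unfold)
  moreover have "X l (j, i) \<omega> = (X (Suc l) (2 * j, i) \<omega> + X (Suc l) (2 * j + 1, i) \<omega>) / sqrt 2" for l j i \<omega>
    by (simp add: X_def gauss_rot_def field_simps)
  ultimately show ?thesis using M by blast
qed

section \<open>Borel measurability of matrix and vector expressions\<close>

lemma borel_measurable_matrix_vector_mult[measurable (raw)]:
  fixes A :: "'w \<Rightarrow> real ^ 'n ^ 'm"
  assumes [measurable]: "A \<in> borel_measurable M" "x \<in> borel_measurable M"
  shows "(\<lambda>\<omega>. A \<omega> *v x \<omega>) \<in> borel_measurable M"
  by (rule borel_measurable_continuous_Pair) (auto simp: matrix_vector_mult_def intro!: continuous_intros)

lemma borel_measurable_matrix_matrix_mult[measurable (raw)]: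
  fixes A :: "'w \<Rightarrow> real ^ 'n ^ 'm" and B :: "'w \<Rightarrow> real ^ 'k ^ 'n"
  assumes [measurable]: "A \<in> borel_measurable M" "B \<in> borel_measurable M"
  shows "(\<lambda>\<omega>. A \<omega> ** B \<omega>) \<in> borel_measurable M"
  by (rule borel_measurable_continuous_Pair) (auto simp: matrix_matrix_mult_def intro!: continuous_intros)

lemma borel_measurable_vec_nth[measurable (raw)]:
  fixes x :: "'w \<Rightarrow> 'a::euclidean_space ^ 'n"
  assumes [measurable]: "x \<in> borel_measurable M"
  shows "(\<lambda>\<omega>. x \<omega> $ i) \<in> borel_measurable M"
  by (rule borel_measurable_continuous_on[where f="\<lambda>x. x $ i"]) (auto intro!: continuous_intros)

lemma borel_measurable_vec_lambda[measurable (raw)]: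
  fixes x :: "'w \<Rightarrow> 'n::finite \<Rightarrow> 'a::euclidean_space"
  assumes [measurable]: "\<And>i. (\<lambda>\<omega>. x \<omega> i) \<in> borel_measurable M"
  shows "(\<lambda>\<omega>. \<chi> i. x \<omega> i) \<in> borel_measurable M"
proof (subst borel_measurable_euclidean_space, intro ballI)
  fix b :: "'a ^ 'n" assume "b \<in> Basis"
  then obtain i u where b: "b = axis i u" by (auto simp: Basis_vec_def)
  show "(\<lambda>\<omega>. (\<chi> i. x \<omega> i) \<bullet> b) \<in> borel_measurable M"
    by (simp add: b inner_axis)
qed

section \<open>Random variables with finite moments\<close>

text \<open>All moments are demanded because this class, unlike the integrable functions, is closed
  under products. Integrability of any polynomial in the normal variables thereby becomes a
  syntactic matter.\<close>

definition fin_mom :: "'w measure \<Rightarrow> ('w \<Rightarrow> real) \<Rightarrow> bool" where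
  "fin_mom M X \<longleftrightarrow> X \<in> borel_measurable M \<and> (\<forall>p. integrable M (\<lambda>\<omega>. \<bar>X \<omega>\<bar> ^ p))"

lemma fin_mom_measurable: "fin_mom M X \<Longrightarrow> X \<in> borel_measurable M"
  by (simp add: fin_mom_def)

lemma fin_mom_integrable: "fin_mom M X \<Longrightarrow> integrable M X"
  using integrable_abs_cancel[of M X] by (auto simp: fin_mom_def dest: spec[of _ 1])

context prob_space
begin

lemma fin_mom_const[intro, simp]: "fin_mom M (\<lambda>_. c)"
  by (simp add: fin_mom_def)

lemma fin_mom_add:
  assumes "fin_mom M X" "fin_mom M Y" shows "fin_mom M (\<lambda>\<omega>. X \<omega> + Y \<omega>)"
  unfolding fin_mom_def
proof (intro conjI allI)
  have [measurable]: "X \<in> borel_measurable M" "Y \<in> borel_measurable M" using assms by (auto simp: fin_mom_def)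
  show "(\<lambda>\<omega>. X \<omega> + Y \<omega>) \<in> borel_measurable M" by measurable
  fix p :: nat
  show "integrable M (\<lambda>\<omega>. \<bar>X \<omega> + Y \<omega>\<bar> ^ p)"
  proof (rule Bochner_Integration.integrable_bound[where f="\<lambda>\<omega>. 2 ^ p * (\<bar>X \<omega>\<bar> ^ p + \<bar>Y \<omega>\<bar> ^ p)"])
    show "integrable M (\<lambda>\<omega>. 2 ^ p * (\<bar>X \<omega>\<bar> ^ p + \<bar>Y \<omega>\<bar> ^ p))"
      using assms by (auto simp: fin_mom_def)
    have "\<bar>x + y\<bar> ^ p \<le> 2 ^ p * (\<bar>x\<bar> ^ p + \<bar>y\<bar> ^ p)" for x y :: real
    proof -
      have "\<bar>x + y\<bar> ^ p \<le> (2 * max \<bar>x\<bar> \<bar>y\<bar>) ^ p" by (intro power_mono) auto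
      also have "\<dots> = 2 ^ p * (max \<bar>x\<bar> \<bar>y\<bar>) ^ p" by (rule power_mult_distrib)
      also have "\<dots> \<le> 2 ^ p * (\<bar>x\<bar> ^ p + \<bar>y\<bar> ^ p)"
        by (intro mult_left_mono) (auto simp: max_def)
      finally show ?thesis .
    qed
    then show "AE \<omega> in M. norm (\<bar>X \<omega> + Y \<omega>\<bar> ^ p) \<le> norm (2 ^ p * (\<bar>X \<omega>\<bar> ^ p + \<bar>Y \<omega>\<bar> ^ p))"
      by simp
  qed measurable
qed

lemma fin_mom_mult:
  assumes "fin_mom M X" "fin_mom M Y" shows "fin_mom M (\<lambda>\<omega>. X \<omega> * Y \<omega>)"
  unfolding fin_mom_def
proof (intro conjI allI)
  have [measurable]: "X \<in> borel_measurable M" "Y \<in> borel_measurable M" using assms by (auto simp: fin_mom_def)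
  show "(\<lambda>\<omega>. X \<omega> * Y \<omega>) \<in> borel_measurable M" by measurable
  fix p :: nat
  show "integrable M (\<lambda>\<omega>. \<bar>X \<omega> * Y \<omega>\<bar> ^ p)"
  proof (rule Bochner_Integration.integrable_bound[where f="\<lambda>\<omega>. \<bar>X \<omega>\<bar> ^ (2 * p) + \<bar>Y \<omega>\<bar> ^ (2 * p)"])
    show "integrable M (\<lambda>\<omega>. \<bar>X \<omega>\<bar> ^ (2 * p) + \<bar>Y \<omega>\<bar> ^ (2 * p))"
      using assms by (auto simp: fin_mom_def)
    have "\<bar>x * y\<bar> ^ p \<le> \<bar>x\<bar> ^ (2 * p) + \<bar>y\<bar> ^ (2 * p)" for x y :: real
    proof -
      have "a * b \<le> a\<^sup>2 + b\<^sup>2" for a b :: real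
        using zero_le_power2[of "a - b"] zero_le_power2[of "a + b"]
        by (simp add: power2_sum power2_diff)
      from this[of "\<bar>x\<bar> ^ p" "\<bar>y\<bar> ^ p"] show ?thesis
        by (simp add: abs_mult power_mult_distrib power_mult[symmetric] mult.commute)
    qed
    then show "AE \<omega> in M. norm (\<bar>X \<omega> * Y \<omega>\<bar> ^ p) \<le> norm (\<bar>X \<omega>\<bar> ^ (2 * p) + \<bar>Y \<omega>\<bar> ^ (2 * p))"
      by simp
  qed measurable
qed

lemma fin_mom_minus: "fin_mom M X \<Longrightarrow> fin_mom M (\<lambda>\<omega>. - X \<omega>)"
  by (simp add: fin_mom_def)

lemma fin_mom_diff: "fin_mom M X \<Longrightarrow> fin_mom M Y \<Longrightarrow> fin_mom M (\<lambda>\<omega>. X \<omega> - Y \<omega>)"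
  using fin_mom_add[of X "\<lambda>\<omega>. - Y \<omega>"] fin_mom_minus[of Y] by simp

lemma fin_mom_sum: "(\<And>i. i \<in> I \<Longrightarrow> fin_mom M (X i)) \<Longrightarrow> fin_mom M (\<lambda>\<omega>. \<Sum>i\<in>I. X i \<omega>)"
  by (induction I rule: infinite_finite_induct) (auto intro: fin_mom_add)

lemma fin_mom_power: "fin_mom M X \<Longrightarrow> fin_mom M (\<lambda>\<omega>. X \<omega> ^ k)"
  by (induction k) (auto intro: fin_mom_mult)

lemmas fin_mom_intros = fin_mom_add fin_mom_mult fin_mom_diff fin_mom_minus fin_mom_sum fin_mom_power fin_mom_const

definition fin_momv :: "('a \<Rightarrow> real ^ 'n) \<Rightarrow> bool" where
  "fin_momv X \<longleftrightarrow> (\<forall>i. fin_mom M (\<lambda>\<omega>. X \<omega> $ i))"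

definition fin_momm :: "('a \<Rightarrow> real ^ 'n ^ 'm) \<Rightarrow> bool" where
  "fin_momm X \<longleftrightarrow> (\<forall>i j. fin_mom M (\<lambda>\<omega>. X \<omega> $ i $ j))"

lemma fin_momv_measurable:
  fixes X :: "'a \<Rightarrow> real ^ 'n" shows "fin_momv X \<Longrightarrow> X \<in> borel_measurable M"
  using borel_measurable_vec_lambda[of "\<lambda>\<omega> i. X \<omega> $ i" M]
  by (simp add: fin_momv_def fin_mom_measurable)

lemma fin_momm_measurable:
  fixes X :: "'a \<Rightarrow> real ^ 'n ^ 'm" assumes "fin_momm X" shows "X \<in> borel_measurable M"
proof -
  have "(\<lambda>\<omega>. \<chi> i j. X \<omega> $ i $ j) \<in> borel_measurable M"
    using assms by (intro borel_measurable_vec_lambda) (auto simp: fin_momm_def fin_mom_measurable)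
  then show ?thesis by simp
qed

lemma fin_momv_const: "fin_momv (\<lambda>_. x)"
  by (simp add: fin_momv_def)

lemma fin_momv_add: "fin_momv X \<Longrightarrow> fin_momv Y \<Longrightarrow> fin_momv (\<lambda>\<omega>. X \<omega> + Y \<omega>)"
  by (simp add: fin_momv_def fin_mom_add)

lemma fin_momv_diff: "fin_momv X \<Longrightarrow> fin_momv Y \<Longrightarrow> fin_momv (\<lambda>\<omega>. X \<omega> - Y \<omega>)"
  by (simp add: fin_momv_def fin_mom_diff)

lemma fin_momv_mult: "fin_momm A \<Longrightarrow> fin_momv X \<Longrightarrow> fin_momv (\<lambda>\<omega>. A \<omega> *v X \<omega>)"
  by (auto simp: fin_momv_def fin_momm_def matrix_vector_mult_def intro!: fin_mom_intros)

lemma fin_mom_inner: "fin_momv X \<Longrightarrow> fin_momv Y \<Longrightarrow> fin_mom M (\<lambda>\<omega>. X \<omega> \<bullet> Y \<omega>)"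
  by (auto simp: fin_momv_def inner_vec_def intro!: fin_mom_intros)

lemma fin_mom_norm2: "fin_momv X \<Longrightarrow> fin_mom M (\<lambda>\<omega>. (norm (X \<omega>))\<^sup>2)"
  by (simp add: power2_norm_eq_inner fin_mom_inner)

lemma fin_mom_norm4: "fin_momv X \<Longrightarrow> fin_mom M (\<lambda>\<omega>. (norm (X \<omega>)) ^ 4)"
  using fin_mom_power[OF fin_mom_norm2, of X 2] by (simp flip: power_mult)

lemma fin_momm_const: "fin_momm (\<lambda>_. x)"
  by (simp add: fin_momm_def)

lemma fin_momm_add: "fin_momm X \<Longrightarrow> fin_momm Y \<Longrightarrow> fin_momm (\<lambda>\<omega>. X \<omega> + Y \<omega>)"
  by (simp add: fin_momm_def fin_mom_add)

lemma fin_momm_mult: "fin_momm A \<Longrightarrow> fin_momm X \<Longrightarrow> fin_momm (\<lambda>\<omega>. A \<omega> ** X \<omega>)"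
  by (auto simp: fin_momm_def matrix_matrix_mult_def intro!: fin_mom_intros)

lemmas fin_mom_all = fin_mom_intros fin_momv_const fin_momv_add fin_momv_diff fin_momv_mult
  fin_mom_inner fin_mom_norm2 fin_mom_norm4 fin_momm_const fin_momm_add fin_momm_mult

text \<open>Unlike \<^const>\<open>indep_var\<close>, this allows two different codomain types.\<close>

definition indep_pair :: "'b measure \<Rightarrow> ('a \<Rightarrow> 'b) \<Rightarrow> 'c measure \<Rightarrow> ('a \<Rightarrow> 'c) \<Rightarrow> bool" where
  "indep_pair S X T Y \<longleftrightarrow> X \<in> M \<rightarrow>\<^sub>M S \<and> Y \<in> M \<rightarrow>\<^sub>M T \<and>
     distr M S X \<Otimes>\<^sub>M distr M T Y = distr M (S \<Otimes>\<^sub>M T) (\<lambda>\<omega>. (X \<omega>, Y \<omega>))"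

lemma indep_pair_compose:
  assumes ind: "indep_var S X T Y" and f[measurable]: "f \<in> S \<rightarrow>\<^sub>M S'" and g[measurable]: "g \<in> T \<rightarrow>\<^sub>M T'"
  shows "indep_pair S' (\<lambda>\<omega>. f (X \<omega>)) T' (\<lambda>\<omega>. g (Y \<omega>))"
proof -
  have X[measurable]: "X \<in> M \<rightarrow>\<^sub>M S" and Y[measurable]: "Y \<in> M \<rightarrow>\<^sub>M T"
    using indep_var_rv1[OF ind] indep_var_rv2[OF ind] by auto
  interpret Y: prob_space "distr M T' (\<lambda>\<omega>. g (Y \<omega>))" by (rule prob_space_distr) measurable
  have "distr M S' (\<lambda>\<omega>. f (X \<omega>)) \<Otimes>\<^sub>M distr M T' (\<lambda>\<omega>. g (Y \<omega>))
      = distr (distr M S X) S' f \<Otimes>\<^sub>M distr (distr M T Y) T' g"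
    by (simp add: distr_distr comp_def)
  also have "\<dots> = distr (distr M S X \<Otimes>\<^sub>M distr M T Y) (S' \<Otimes>\<^sub>M T') (\<lambda>(x, y). (f x, g y))"
    using Y.sigma_finite_measure_axioms by (intro pair_measure_distr) (auto simp: distr_distr comp_def)
  also have "\<dots> = distr M (S' \<Otimes>\<^sub>M T') (\<lambda>\<omega>. (f (X \<omega>), g (Y \<omega>)))"
    using ind by (subst indep_var_distribution_eq[THEN iffD1, THEN conjunct2, THEN conjunct2]) (auto simp: distr_distr comp_def)
  finally show ?thesis by (simp add: indep_pair_def)
qed

text \<open>Freezing: the first variable is integrated out while the second one is held fixed. With
  the new increment first and the past second, this takes the place of conditional expectations in
  all moment recursions.\<close>

lemma indep_pair_Fubini:
  fixes \<phi> :: "'b \<times> 'c \<Rightarrow> real"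
  assumes ind: "indep_pair S X T Y" and \<phi>[measurable]: "\<phi> \<in> borel_measurable (S \<Otimes>\<^sub>M T)"
    and int: "integrable M (\<lambda>\<omega>. \<phi> (X \<omega>, Y \<omega>))"
  shows "(\<integral>\<omega>. \<phi> (X \<omega>, Y \<omega>) \<partial>M) = (\<integral>\<omega>. (\<integral>\<omega>'. \<phi> (X \<omega>', Y \<omega>) \<partial>M) \<partial>M)"
proof -
  have X[measurable]: "X \<in> M \<rightarrow>\<^sub>M S" and Y[measurable]: "Y \<in> M \<rightarrow>\<^sub>M T"
    using ind by (auto simp: indep_pair_def)
  interpret X: prob_space "distr M S X" by (rule prob_space_distr) fact
  interpret Y: prob_space "distr M T Y" by (rule prob_space_distr) fact
  interpret XY: pair_prob_space "distr M S X" "distr M T Y" ..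
  have eq: "distr M S X \<Otimes>\<^sub>M distr M T Y = distr M (S \<Otimes>\<^sub>M T) (\<lambda>\<omega>. (X \<omega>, Y \<omega>))"
    using ind by (simp add: indep_pair_def)
  have "integrable (distr M S X \<Otimes>\<^sub>M distr M T Y) \<phi>"
    unfolding eq by (subst integrable_distr_eq) (use int in auto)
  then have i: "integrable (distr M S X \<Otimes>\<^sub>M distr M T Y) (\<lambda>(x, y). \<phi> (x, y))"
    by simp
  have "(\<integral>\<omega>. \<phi> (X \<omega>, Y \<omega>) \<partial>M) = (\<integral>p. \<phi> p \<partial>(distr M S X \<Otimes>\<^sub>M distr M T Y))"
    unfolding eq by (subst integral_distr) auto
  also have "\<dots> = (\<integral>y. (\<integral>x. \<phi> (x, y) \<partial>distr M S X) \<partial>distr M T Y)"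
    using XY.integral_snd[OF i] by simp
  also have "\<dots> = (\<integral>\<omega>. (\<integral>x. \<phi> (x, Y \<omega>) \<partial>distr M S X) \<partial>M)"
    by (subst integral_distr) auto
  also have "\<dots> = (\<integral>\<omega>. (\<integral>\<omega>'. \<phi> (X \<omega>', Y \<omega>) \<partial>M) \<partial>M)"
    by (intro Bochner_Integration.integral_cong refl, subst integral_distr)
       (auto simp: measurable_space[OF Y])
  finally show ?thesis .
qed

end

lemma integrable_std_normal_power: "integrable std_normal (\<lambda>x. \<bar>x\<bar> ^ p)"
  unfolding std_normal_def
  by (subst integrable_density) (auto simp: integrable_std_normal_moment_abs)

lemma integral_std_normal:
  "(\<integral>x. x \<partial>std_normal) = 0" "(\<integral>x. x\<^sup>2 \<partial>std_normal) = 1" "(\<integral>x. x ^ 4 \<partial>std_normal) = 3"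
proof -
  have *: "(\<integral>x. x ^ k \<partial>std_normal) = (\<integral>x. std_normal_density x * x ^ k \<partial>lborel)" for k
    unfolding std_normal_def by (subst integral_density) auto
  show "(\<integral>x. x \<partial>std_normal) = 0"
    using *[of 1] integral_std_normal_moment_odd[of 0] by simp
  show "(\<integral>x. x\<^sup>2 \<partial>std_normal) = 1"
    using *[of 2] integral_std_normal_moment_even[of 1] by (simp add: fact_numeral)
  show "(\<integral>x. x ^ 4 \<partial>std_normal) = 3"
    using *[of 4] integral_std_normal_moment_even[of 2] by (simp add: fact_numeral)
qed

section \<open>Products of random skew-symmetric perturbations\<close>

text \<open>The factor \<open>sqrt (h / 2)\<close> gives each off-diagonal entry variance
  \<open>h\<close>. Antisymmetrizing a full array of normals avoids choosing an order on the index
  type.\<close>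

definition skew_mat :: "real \<Rightarrow> ('n::finite \<times> 'n \<Rightarrow> real) \<Rightarrow> real ^ 'n ^ 'n" where
  "skew_mat h a = (\<chi> p q. sqrt (h / 2) * (a (p, q) - a (q, p)))"

text \<open>New factors enter on the left: they act on the position reached so far, and the past
  remains a right factor.\<close>

fun mprod :: "(nat \<Rightarrow> real ^ 'n ^ 'n) \<Rightarrow> nat \<Rightarrow> real ^ 'n ^ 'n" where
  "mprod B 0 = mat 1"
| "mprod B (Suc k) = (mat 1 + B k) ** mprod B k"

lemma mprod_cong: "(\<And>j. j < k \<Longrightarrow> B j = B' j) \<Longrightarrow> mprod B k = mprod B' k"
  by (induction k) auto

lemma mprod_add: "mprod B (i + k) = mprod (\<lambda>j. B (i + j)) k ** mprod B i"
  by (induction k) (simp_all add: matrix_mul_assoc)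

lemma measurable_mprod[measurable (raw)]:
  assumes [measurable]: "\<And>i. (\<lambda>\<omega>. B \<omega> i) \<in> borel_measurable M"
  shows "(\<lambda>\<omega>. mprod (B \<omega>) k) \<in> borel_measurable M"
  by (induction k) auto

text \<open>The coefficients are the components of \<open>u \<and> v\<close> as a bivector. They
  vanish for \<open>u = v\<close>, which is the orthogonality of each step, and otherwise their
  squares give the variance.\<close>

lemma inner_skew_mat:
  "u \<bullet> (skew_mat h a *v v) = sqrt (h / 2) * (\<Sum>i\<in>UNIV. (u $ fst i * v $ snd i - u $ snd i * v $ fst i) * a i)"
proof -
  have "u \<bullet> (skew_mat h a *v v) = sqrt (h / 2) * ((\<Sum>p\<in>UNIV. \<Sum>q\<in>UNIV. u $ p * v $ q * a (p, q)) - (\<Sum>p\<in>UNIV. \<Sum>q\<in>UNIV. u $ p * v $ q * a (q, p)))"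
    by (simp add: skew_mat_def inner_vec_def matrix_vector_mult_def sum_distrib_left sum_subtractf[symmetric] algebra_simps)
  also have "(\<Sum>p\<in>UNIV. \<Sum>q\<in>UNIV. u $ p * v $ q * a (q, p)) = (\<Sum>p\<in>UNIV. \<Sum>q\<in>UNIV. u $ q * v $ p * a (p, q))"
    by (rule sum.swap)
  also have "(\<Sum>p\<in>UNIV. \<Sum>q\<in>UNIV. u $ p * v $ q * a (p, q)) - \<dots> = (\<Sum>p\<in>UNIV. \<Sum>q\<in>UNIV. (u $ p * v $ q - u $ q * v $ p) * a (p, q))"
    by (simp add: sum_subtractf[symmetric] algebra_simps)
  also have "\<dots> = (\<Sum>i\<in>UNIV. (u $ fst i * v $ snd i - u $ snd i * v $ fst i) * a i)"
    by (simp add: sum.cartesian_product UNIV_Times_UNIV[symmetric] case_prod_unfold del: UNIV_Times_UNIV)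
  finally show ?thesis .
qed

lemma skew_mat_orth: "v \<bullet> (skew_mat h a *v v) = 0"
  by (simp add: inner_skew_mat mult.commute)

text \<open>Lagrange's identity, with every pair of indices counted twice.\<close>

lemma sum_antisym_squares:
  fixes u v :: "real ^ 'n"
  shows "(\<Sum>i\<in>UNIV. (u $ fst i * v $ snd i - u $ snd i * v $ fst i)\<^sup>2) = 2 * ((norm u)\<^sup>2 * (norm v)\<^sup>2 - (u \<bullet> v)\<^sup>2)"
proof -
  have "(\<Sum>i\<in>UNIV. (u $ fst i * v $ snd i - u $ snd i * v $ fst i)\<^sup>2)
    = (\<Sum>p\<in>UNIV. \<Sum>q\<in>UNIV. (u $ p * v $ q - u $ q * v $ p)\<^sup>2)"
    by (simp add: sum.cartesian_product UNIV_Times_UNIV[symmetric] case_prod_unfold del: UNIV_Times_UNIV)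
  also have "\<dots> = (\<Sum>p\<in>UNIV. \<Sum>q\<in>UNIV. (u $ p * u $ p) * (v $ q * v $ q)) + (\<Sum>p\<in>UNIV. \<Sum>q\<in>UNIV. (v $ p * v $ p) * (u $ q * u $ q))
      - 2 * (\<Sum>p\<in>UNIV. \<Sum>q\<in>UNIV. (u $ p * v $ p) * (u $ q * v $ q))"
    by (simp add: sum.distrib[symmetric] sum_subtractf[symmetric] sum_distrib_left power2_eq_square algebra_simps)
  also have "\<dots> = 2 * ((norm u)\<^sup>2 * (norm v)\<^sup>2 - (u \<bullet> v)\<^sup>2)"
    unfolding sum_product[symmetric] power2_norm_eq_inner by (simp add: inner_vec_def power2_eq_square)
  finally show ?thesis .
qed

lemma norm_vec_sum_inner: "(norm (x :: real ^ 'n))\<^sup>2 = (\<Sum>p\<in>UNIV. (axis p 1 \<bullet> x)\<^sup>2)"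
  unfolding power2_norm_eq_inner inner_vec_def[of x x] by (simp add: inner_axis' power2_eq_square)

locale skew_walk = prob_space M for M :: "'w measure" +
  fixes \<xi> :: "nat \<times> ('n::finite \<times> 'n) \<Rightarrow> 'w \<Rightarrow> real" and h :: real
  assumes iid: "iid_family M std_normal \<xi>" and h_pos: "0 < h"
begin

definition b :: "nat \<Rightarrow> 'w \<Rightarrow> real ^ 'n ^ 'n" where
  "b j \<omega> = skew_mat h (\<lambda>i. \<xi> (j, i) \<omega>)"

definition V :: "nat \<Rightarrow> 'w \<Rightarrow> real ^ 'n ^ 'n" where
  "V k \<omega> = mprod (\<lambda>j. b j \<omega>) k"

lemma xi_measurable[measurable]: "\<xi> i \<in> borel_measurable M"
  using iid_family_measurable[OF iid, of i] by (simp cong: measurable_cong_sets)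

lemma fin_mom_xi: "fin_mom M (\<xi> i)"
proof -
  have "integrable (distr M std_normal (\<xi> i)) (\<lambda>x. \<bar>x\<bar> ^ p)" for p
    by (simp add: iid_family_distr[OF prob_space_std_normal iid] integrable_std_normal_power)
  then have "integrable M (\<lambda>\<omega>. \<bar>\<xi> i \<omega>\<bar> ^ p)" for p
    by (subst (asm) integrable_distr_eq) auto
  then show ?thesis by (simp add: fin_mom_def)
qed

lemma xi_moment:
  fixes f :: "real \<Rightarrow> real"
  assumes [measurable]: "f \<in> borel_measurable borel"
  shows "(\<integral>\<omega>. f (\<xi> i \<omega>) \<partial>M) = (\<integral>x. f x \<partial>std_normal)"
  by (subst iid_family_distr[OF prob_space_std_normal iid, of i, symmetric], subst integral_distr) auto

lemma xi_cov: "(\<integral>\<omega>. \<xi> i \<omega> * \<xi> j \<omega> \<partial>M) = (if i = j then 1 else 0)"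
proof (cases "i = j")
  case True
  then show ?thesis
    using xi_moment[of "\<lambda>x. x\<^sup>2" j] by (simp add: power2_eq_square integral_std_normal[unfolded power2_eq_square])
next
  case False
  have "indep_var borel ((\<lambda>w. w i) \<circ> (\<lambda>\<omega>. restrict (\<lambda>k. \<xi> k \<omega>) {i})) borel ((\<lambda>w. w j) \<circ> (\<lambda>\<omega>. restrict (\<lambda>k. \<xi> k \<omega>) {j}))"
    using False by (intro indep_var_compose[OF indep_var_restrict[OF iid_family_indep_vars[OF prob_space_std_normal iid], of "{i}" "{j}"]]) auto
  then have "indep_var borel (\<xi> i) borel (\<xi> j)"
    by (simp add: comp_def)
  then show ?thesis
    using False xi_moment[of "\<lambda>x. x" i]
    by (subst indep_var_lebesgue_integral) (auto simp: fin_mom_integrable fin_mom_xi integral_std_normal)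
qed

lemma lin_moment:
  fixes a :: "'n \<times> 'n \<Rightarrow> real"
  shows "(\<integral>\<omega>. (\<Sum>i\<in>UNIV. a i * \<xi> (k, i) \<omega>) \<partial>M) = 0"
    and "(\<integral>\<omega>. (\<Sum>i\<in>UNIV. a i * \<xi> (k, i) \<omega>)\<^sup>2 \<partial>M) = (\<Sum>i\<in>UNIV. (a i)\<^sup>2)"
proof -
  note fin = fin_mom_xi fin_mom_integrable fin_mom_intros
  show "(\<integral>\<omega>. (\<Sum>i\<in>UNIV. a i * \<xi> (k, i) \<omega>) \<partial>M) = 0"
    using xi_moment[of "\<lambda>x. x"] by (subst Bochner_Integration.integral_sum) (auto simp: integral_std_normal intro!: fin)
  have "(\<integral>\<omega>. (\<Sum>i\<in>UNIV. a i * \<xi> (k, i) \<omega>)\<^sup>2 \<partial>M)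
    = (\<integral>\<omega>. (\<Sum>i\<in>UNIV. \<Sum>j\<in>UNIV. (a i * a j) * (\<xi> (k, i) \<omega> * \<xi> (k, j) \<omega>)) \<partial>M)"
    by (simp add: power2_eq_square sum_product algebra_simps)
  also have "\<dots> = (\<Sum>i\<in>UNIV. \<Sum>j\<in>UNIV. (a i * a j) * (\<integral>\<omega>. \<xi> (k, i) \<omega> * \<xi> (k, j) \<omega> \<partial>M))"
    by (subst Bochner_Integration.integral_sum, intro fin,
        intro sum.cong refl, subst Bochner_Integration.integral_sum) (auto intro!: fin)
  also have "\<dots> = (\<Sum>i\<in>UNIV. (a i)\<^sup>2)"
    by (simp add: xi_cov if_distrib power2_eq_square cong: if_cong)
  finally show "(\<integral>\<omega>. (\<Sum>i\<in>UNIV. a i * \<xi> (k, i) \<omega>)\<^sup>2 \<partial>M) = (\<Sum>i\<in>UNIV. (a i)\<^sup>2)" .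
qed

lemma fin_momm_b: "fin_momm (b j)"
  unfolding b_def skew_mat_def fin_momm_def by (auto intro!: fin_mom_intros fin_mom_xi)

lemma b_measurable[measurable]: "b j \<in> borel_measurable M"
  by (rule fin_momm_measurable[OF fin_momm_b])

lemma fin_momm_mprod:
  assumes "\<And>i. fin_momm (B i)"
  shows "fin_momm (\<lambda>\<omega>. mprod (\<lambda>i. B i \<omega>) k)"
  by (induction k) (auto intro!: fin_mom_all assms)

lemma fin_momm_V: "fin_momm (V k)"
  unfolding V_def by (intro fin_momm_mprod fin_momm_b)

lemma V_measurable[measurable]: "V j \<in> borel_measurable M"
  by (rule fin_momm_measurable[OF fin_momm_V])

lemmas fin = fin_mom_integrable fin_mom_all fin_momm_b fin_momm_V

lemma b_mean: "(\<integral>\<omega>. u \<bullet> (b k \<omega> *v v) \<partial>M) = 0"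
  by (simp add: b_def inner_skew_mat lin_moment)

lemma b_cov: "(\<integral>\<omega>. (u \<bullet> (b k \<omega> *v v))\<^sup>2 \<partial>M) = h * ((norm u)\<^sup>2 * (norm v)\<^sup>2 - (u \<bullet> v)\<^sup>2)"
  using h_pos by (simp add: b_def inner_skew_mat lin_moment power_mult_distrib sum_antisym_squares)

text \<open>The dimension of the sphere, that is, the trace of the tangential projection: the rate
  at which a step increases the mean squared norm.\<close>

definition c :: real where "c = real CARD('n) - 1"

lemma c_nonneg: "0 \<le> c"
  using zero_less_card_finite[where 'a='n] by (simp add: c_def Suc_leI del: zero_less_card_finite)

lemma b_norm2: "(\<integral>\<omega>. (norm (b k \<omega> *v v))\<^sup>2 \<partial>M) = c * h * (norm v)\<^sup>2"
proof -
  have "(\<integral>\<omega>. (norm (b k \<omega> *v v))\<^sup>2 \<partial>M) = (\<Sum>p\<in>UNIV. \<integral>\<omega>. (axis p 1 \<bullet> (b k \<omega> *v v))\<^sup>2 \<partial>M)"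
    unfolding norm_vec_sum_inner by (subst Bochner_Integration.integral_sum) (auto intro!: fin)
  also have "\<dots> = (\<Sum>p\<in>UNIV. h * ((norm v)\<^sup>2 - (axis p 1 \<bullet> v)\<^sup>2))"
    by (simp add: b_cov)
  also have "\<dots> = c * h * (norm v)\<^sup>2"
    by (simp add: sum_distrib_left[symmetric] sum_subtractf norm_vec_sum_inner[symmetric] c_def algebra_simps)
  finally show ?thesis .
qed

text \<open>Only the order \<open>h\<^sup>2\<close> matters. The constant is crude: Cauchy-Schwarz
  gives \<open>|b v|^2 \<le> 2 h S |v|^2\<close>, and \<open>S\<^sup>2\<close> is at most
  \<open>n^2\<close> times a sum of \<open>n^2\<close> fourth powers, each with expectation
  3.\<close>

lemma b_norm4: "(\<integral>\<omega>. (norm (b k \<omega> *v v))^4 \<partial>M) \<le> 12 * real CARD('n) ^ 4 * h\<^sup>2 * (norm v)^4"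
proof -
  define S where "S \<omega> = (\<Sum>i\<in>UNIV. (\<xi> (k, i) \<omega>)\<^sup>2)" for \<omega>
  have pw: "(norm (b k \<omega> *v v))^4 \<le> 4 * h\<^sup>2 * (norm v)^4 * (S \<omega>)\<^sup>2" for \<omega>
  proof -
    have "(norm (b k \<omega> *v v))\<^sup>2 = (\<Sum>p\<in>UNIV. (row p (b k \<omega>) \<bullet> v)\<^sup>2)"
      by (simp add: norm_vec_sum_inner inner_axis' matrix_vector_mul_component row_def)
    also have "\<dots> \<le> (\<Sum>p\<in>UNIV. (norm (row p (b k \<omega>)))\<^sup>2 * (norm v)\<^sup>2)"
      by (intro sum_mono) (simp add: Cauchy_Schwarz_ineq power2_norm_eq_inner)
    also have "\<dots> = (norm v)\<^sup>2 * (\<Sum>p\<in>UNIV. \<Sum>q\<in>UNIV. (h / 2) * (\<xi> (k, p, q) \<omega> - \<xi> (k, q, p) \<omega>)\<^sup>2)"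
    proof -
      have "(norm (row p (b k \<omega>)))\<^sup>2 = (\<Sum>q\<in>UNIV. (h / 2) * (\<xi> (k, p, q) \<omega> - \<xi> (k, q, p) \<omega>)\<^sup>2)" for p
        using h_pos by (simp add: norm_vec_sum_inner inner_axis' row_def b_def skew_mat_def power_mult_distrib)
      then show ?thesis by (simp add: sum_distrib_left mult.commute)
    qed
    also have "\<dots> \<le> (norm v)\<^sup>2 * (\<Sum>p\<in>UNIV. \<Sum>q\<in>UNIV. h * ((\<xi> (k, p, q) \<omega>)\<^sup>2 + (\<xi> (k, q, p) \<omega>)\<^sup>2))"
    proof (intro mult_left_mono sum_mono)
      fix x y :: real
      have "(x - y)\<^sup>2 \<le> 2 * (x\<^sup>2 + y\<^sup>2)"
        using zero_le_power2[of "x + y"] by (simp add: power2_sum power2_diff)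
      from mult_left_mono[OF this, of "h / 2"] show "h / 2 * (x - y)\<^sup>2 \<le> h * (x\<^sup>2 + y\<^sup>2)"
        using h_pos by simp
    qed auto
    also have "\<dots> = (norm v)\<^sup>2 * (h * ((\<Sum>p\<in>UNIV. \<Sum>q\<in>UNIV. (\<xi> (k, p, q) \<omega>)\<^sup>2) + (\<Sum>p\<in>UNIV. \<Sum>q\<in>UNIV. (\<xi> (k, q, p) \<omega>)\<^sup>2)))"
      by (simp add: sum_distrib_left[symmetric] sum.distrib)
    also have "(\<Sum>p\<in>UNIV. \<Sum>q\<in>UNIV. (\<xi> (k, q, p) \<omega>)\<^sup>2) = (\<Sum>p\<in>UNIV. \<Sum>q\<in>UNIV. (\<xi> (k, p, q) \<omega>)\<^sup>2)"
      by (rule sum.swap)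
    also have "(\<Sum>p\<in>UNIV. \<Sum>q\<in>UNIV. (\<xi> (k, p, q) \<omega>)\<^sup>2) = S \<omega>"
      unfolding S_def by (simp add: sum.cartesian_product UNIV_Times_UNIV[symmetric] case_prod_unfold del: UNIV_Times_UNIV)
    finally have "((norm (b k \<omega> *v v))\<^sup>2)\<^sup>2 \<le> ((norm v)\<^sup>2 * (h * (S \<omega> + S \<omega>)))\<^sup>2"
      by (rule power_mono) simp
    then show ?thesis by (simp add: power_mult_distrib mult_ac flip: power_mult)
  qed
  have fS: "fin_mom M S" unfolding S_def by (intro fin fin_mom_xi)
  have "(S \<omega>)\<^sup>2 \<le> real CARD('n \<times> 'n) * (\<Sum>i\<in>UNIV. (\<xi> (k, i) \<omega>)^4)" for \<omega>
    using Cauchy_Schwarz_ineq_sum[of "\<lambda>_. 1" "\<lambda>i. (\<xi> (k, i) \<omega>)\<^sup>2" "UNIV :: ('n \<times> 'n) set"]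
    by (simp add: S_def flip: power_mult)
  then have "(\<integral>\<omega>. (S \<omega>)\<^sup>2 \<partial>M) \<le> (\<integral>\<omega>. real CARD('n \<times> 'n) * (\<Sum>i\<in>UNIV. (\<xi> (k, i) \<omega>)^4) \<partial>M)"
    by (intro integral_mono fin fin_mom_xi fS) auto
  also have "\<dots> = 3 * real CARD('n) ^ 4"
    using xi_moment[of "\<lambda>x. x^4"]
    by (simp add: Bochner_Integration.integral_sum fin fin_mom_xi integral_std_normal power4_eq_xxxx[of "real CARD('n)"])
  finally have S2: "(\<integral>\<omega>. (S \<omega>)\<^sup>2 \<partial>M) \<le> 3 * real CARD('n) ^ 4" .
  have "(\<integral>\<omega>. (norm (b k \<omega> *v v))^4 \<partial>M) \<le> (\<integral>\<omega>. 4 * h\<^sup>2 * (norm v)^4 * (S \<omega>)\<^sup>2 \<partial>M)"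
    by (intro integral_mono pw fin fS)
  also have "\<dots> = 4 * h\<^sup>2 * (norm v)^4 * (\<integral>\<omega>. (S \<omega>)\<^sup>2 \<partial>M)" by simp
  also have "\<dots> \<le> 4 * h\<^sup>2 * (norm v)^4 * (3 * real CARD('n) ^ 4)"
    by (intro mult_left_mono S2) auto
  finally show ?thesis by (simp add: mult_ac)
qed

text \<open>\<open>Fc\<close> expresses that \<open>F\<close> sees the increments before
  \<open>k\<close> only. The future comes first in the pair, as the variable that
  \<open>indep_pair_Fubini\<close> integrates out.\<close>

lemma past_future:
  assumes F[measurable]: "F \<in> PiM UNIV (\<lambda>_::nat. borel) \<rightarrow>\<^sub>M N1"
    and Fc: "\<And>B B'. (\<And>j. j < k \<Longrightarrow> B j = B' j) \<Longrightarrow> F B = F B'"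
    and G[measurable]: "G \<in> PiM UNIV (\<lambda>_::nat. borel) \<rightarrow>\<^sub>M N2"
  shows "indep_pair N2 (\<lambda>\<omega>. G (\<lambda>i. b (k + i) \<omega>)) N1 (\<lambda>\<omega>. F (\<lambda>i. b i \<omega>))"
proof -
  let ?A = "{..<k} \<times> (UNIV :: ('n \<times> 'n) set)" and ?B = "{k..} \<times> (UNIV :: ('n \<times> 'n) set)"
  \<comment> \<open>\<open>F'\<close> has to be a function of the block \<open>?A\<close> alone; the
    increments from \<open>k\<close> on are set to 0, which \<open>F\<close> does not notice by
    \<open>Fc\<close>.\<close>
  define F' where "F' w = F (\<lambda>j. if j < k then skew_mat h (\<lambda>i. w (j, i)) else 0)" for w
  define G' where "G' w = G (\<lambda>j. skew_mat h (\<lambda>i. w (k + j, i)))" for w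
  have m1: "(\<lambda>w. w (j, i)) \<in> borel_measurable (PiM ?A (\<lambda>_. std_normal))" if "j < k" for j i
    using measurable_component_singleton[of "(j, i)" ?A "\<lambda>_. std_normal"] that by (simp cong: measurable_cong_sets)
  have m2: "(\<lambda>w. w (k + j, i)) \<in> borel_measurable (PiM ?B (\<lambda>_. std_normal))" for j i
    using measurable_component_singleton[of "(k + j, i)" ?B "\<lambda>_. std_normal"] by (simp cong: measurable_cong_sets)
  have F': "F' \<in> PiM ?A (\<lambda>_. std_normal) \<rightarrow>\<^sub>M N1"
    unfolding F'_def
  proof (rule measurable_compose[OF _ F], rule measurable_PiM_UNIV)
    show "(\<lambda>w. if j < k then skew_mat h (\<lambda>i. w (j, i)) else 0) \<in> borel_measurable (PiM ?A (\<lambda>_. std_normal))" for j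
      using m1[of j] unfolding skew_mat_def by (cases "j < k") auto
  qed
  have G': "G' \<in> PiM ?B (\<lambda>_. std_normal) \<rightarrow>\<^sub>M N2"
    unfolding G'_def
  proof (rule measurable_compose[OF _ G], rule measurable_PiM_UNIV)
    show "(\<lambda>w. skew_mat h (\<lambda>i. w (k + j, i))) \<in> borel_measurable (PiM ?B (\<lambda>_. std_normal))" for j
      using m2[of j] unfolding skew_mat_def by auto
  qed
  have "indep_pair N2 (\<lambda>\<omega>. G' (restrict (\<lambda>k. \<xi> k \<omega>) ?B)) N1 (\<lambda>\<omega>. F' (restrict (\<lambda>k. \<xi> k \<omega>) ?A))"
    by (rule indep_pair_compose[OF indep_var_restrict[OF iid_family_indep_vars[OF prob_space_std_normal iid]] G' F']) auto
  moreover have "(\<lambda>\<omega>. G' (restrict (\<lambda>k. \<xi> k \<omega>) ?B)) = (\<lambda>\<omega>. G (\<lambda>i. b (k + i) \<omega>))"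
    by (auto simp: fun_eq_iff G'_def b_def)
  moreover have "(\<lambda>\<omega>. F' (restrict (\<lambda>k. \<xi> k \<omega>) ?A)) = (\<lambda>\<omega>. F (\<lambda>i. b i \<omega>))"
    by (auto simp: fun_eq_iff F'_def b_def intro!: Fc)
  ultimately show ?thesis by simp
qed

text \<open>Stationarity of the increments: a shift of the time index is an injective reindexing of
  the underlying family.\<close>

lemma shift_law:
  "distr M (PiM UNIV (\<lambda>_. borel)) (\<lambda>\<omega> i. b (k + i) \<omega>) = distr M (PiM UNIV (\<lambda>_. borel)) (\<lambda>\<omega> i. b i \<omega>)"
proof -
  define \<eta> where "\<eta> = (\<lambda>(j, i). \<xi> (k + j, i))"
  have "iid_family M std_normal (\<lambda>x. \<xi> ((\<lambda>(j, i). (k + j, i)) x))"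
    by (rule iid_family_reindex[OF prob_space_std_normal iid]) (auto simp: inj_def)
  then have \<eta>: "iid_family M std_normal \<eta>" by (simp add: \<eta>_def case_prod_unfold)
  let ?T = "\<lambda>w (j::nat). skew_mat h (\<lambda>i. w (j, i))"
  have T[measurable]: "?T \<in> PiM UNIV (\<lambda>_. std_normal) \<rightarrow>\<^sub>M PiM UNIV (\<lambda>_. borel)"
  proof (rule measurable_PiM_UNIV)
    have "(\<lambda>w. w (j, i)) \<in> borel_measurable (PiM UNIV (\<lambda>_. std_normal))" for j :: nat and i :: "'n \<times> 'n"
      using measurable_component_singleton[of "(j, i)" UNIV "\<lambda>_. std_normal"] by (simp cong: measurable_cong_sets)
    then show "(\<lambda>w. skew_mat h (\<lambda>i. w (j, i))) \<in> borel_measurable (PiM UNIV (\<lambda>_. std_normal))" for j :: nat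
      unfolding skew_mat_def by auto
  qed
  have *: "distr M (PiM UNIV (\<lambda>_. borel)) (\<lambda>\<omega>. ?T (\<lambda>i. \<zeta> i \<omega>)) = distr (PiM UNIV (\<lambda>_. std_normal)) (PiM UNIV (\<lambda>_. borel)) ?T"
    if \<zeta>: "iid_family M std_normal \<zeta>" for \<zeta>
  proof -
    have "distr M (PiM UNIV (\<lambda>_. borel)) (\<lambda>\<omega>. ?T (\<lambda>i. \<zeta> i \<omega>))
       = distr (distr M (PiM UNIV (\<lambda>_. std_normal)) (\<lambda>\<omega> i. \<zeta> i \<omega>)) (PiM UNIV (\<lambda>_. borel)) ?T"
      by (subst distr_distr) (auto simp: comp_def intro!: measurable_PiM_UNIV iid_family_measurable[OF \<zeta>])
    with \<zeta> show ?thesis by (simp add: iid_family_def)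
  qed
  have "(\<lambda>\<omega> i. b (k + i) \<omega>) = (\<lambda>\<omega>. ?T (\<lambda>i. \<eta> i \<omega>))" "(\<lambda>\<omega> i. b i \<omega>) = (\<lambda>\<omega>. ?T (\<lambda>i. \<xi> i \<omega>))"
    by (auto simp: b_def \<eta>_def)
  then show ?thesis by (simp add: *[OF \<eta>] *[OF iid])
qed

end

section \<open>Moments of the products and comparison of two successive levels\<close>

context skew_walk
begin

lemma V_0: "V 0 \<omega> *v z = z"
  by (simp add: V_def)

lemma V_Suc: "V (Suc k) \<omega> *v z = V k \<omega> *v z + b k \<omega> *v (V k \<omega> *v z)"
  by (simp add: V_def matrix_vector_mul_assoc[symmetric] matrix_vector_mult_add_rdistrib)

lemma b_orth: "v \<bullet> (b k \<omega> *v v) = 0"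
  by (simp add: b_def skew_mat_orth)

lemma indep_b_V: "indep_pair borel (b k) borel (\<lambda>\<omega>. V k \<omega> *v z)"
proof -
  have "indep_pair borel (\<lambda>\<omega>. (\<lambda>B. B 0) (\<lambda>i. b (k + i) \<omega>)) borel (\<lambda>\<omega>. (\<lambda>B. mprod B k *v z) (\<lambda>i. b i \<omega>))"
    by (rule past_future) (auto intro: mprod_cong[THEN arg_cong[where f="\<lambda>A. A *v z"]])
  then show ?thesis by (simp add: V_def)
qed

lemma b_V_Fubini:
  fixes \<phi> :: "real ^ 'n ^ 'n \<Rightarrow> real ^ 'n \<Rightarrow> real"
  assumes "case_prod \<phi> \<in> borel_measurable (borel \<Otimes>\<^sub>M borel)"
    and "integrable M (\<lambda>\<omega>. \<phi> (b k \<omega>) (V k \<omega> *v z))"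
  shows "(\<integral>\<omega>. \<phi> (b k \<omega>) (V k \<omega> *v z) \<partial>M) = (\<integral>\<omega>. (\<integral>\<omega>'. \<phi> (b k \<omega>') (V k \<omega> *v z) \<partial>M) \<partial>M)"
  using indep_pair_Fubini[OF indep_b_V assms(1)] assms(2) by simp

lemma V_mean: "(\<integral>\<omega>. u \<bullet> (V k \<omega> *v z) \<partial>M) = u \<bullet> z"
proof (induction k)
  case 0
  then show ?case by (simp add: V_0 prob_space)
next
  case (Suc k)
  have "(\<integral>\<omega>. u \<bullet> (V (Suc k) \<omega> *v z) \<partial>M) = (\<integral>\<omega>. u \<bullet> (V k \<omega> *v z) \<partial>M) + (\<integral>\<omega>. u \<bullet> (b k \<omega> *v (V k \<omega> *v z)) \<partial>M)"
    by (simp add: V_Suc inner_add_right fin)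
  also have "(\<integral>\<omega>. u \<bullet> (b k \<omega> *v (V k \<omega> *v z)) \<partial>M) = 0"
    by (subst b_V_Fubini) (auto simp: b_mean intro!: fin)
  finally show ?case using Suc by simp
qed

text \<open>Pythagoras, since the step is orthogonal to the position. Norms can only grow, hence the
  later normalization.\<close>

lemma norm2_step: "(norm (v + b k \<omega> *v v))\<^sup>2 = (norm v)\<^sup>2 + (norm (b k \<omega> *v v))\<^sup>2"
  by (simp add: power2_norm_eq_inner inner_add_left inner_add_right b_orth inner_commute[of "b k \<omega> *v v" v])

lemma V_norm2: "(\<integral>\<omega>. (norm (V k \<omega> *v z))\<^sup>2 \<partial>M) = (1 + c * h) ^ k * (norm z)\<^sup>2"
proof (induction k)
  case 0
  then show ?case by (simp add: V_0 prob_space)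
next
  case (Suc k)
  have "(\<integral>\<omega>. (norm (V (Suc k) \<omega> *v z))\<^sup>2 \<partial>M) = (\<integral>\<omega>. (norm (V k \<omega> *v z))\<^sup>2 \<partial>M) + (\<integral>\<omega>. (norm (b k \<omega> *v (V k \<omega> *v z)))\<^sup>2 \<partial>M)"
    by (simp add: V_Suc norm2_step fin)
  also have "(\<integral>\<omega>. (norm (b k \<omega> *v (V k \<omega> *v z)))\<^sup>2 \<partial>M) = c * h * (\<integral>\<omega>. (norm (V k \<omega> *v z))\<^sup>2 \<partial>M)"
    by (subst b_V_Fubini) (auto simp: b_norm2 intro!: fin)
  finally show ?case using Suc by (simp add: algebra_simps)
qed

text \<open>The coefficient \<open>2 * c * h\<close> is essential: the growth factor agrees with the
  square of the factor \<open>1 + c * h\<close> of the second moment up to order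
  \<open>h\<^sup>2\<close>. After normalization the variance of the squared norm therefore tends to
  0.\<close>

lemma V_norm4:
  "(\<integral>\<omega>. (norm (V k \<omega> *v z))^4 \<partial>M) \<le> (1 + 2 * c * h + 12 * real CARD('n) ^ 4 * h\<^sup>2) ^ k * (norm z)^4"
proof (induction k)
  case 0
  then show ?case by (simp add: V_0 prob_space)
next
  case (Suc k)
  let ?v = "\<lambda>\<omega>. V k \<omega> *v z" and ?K = "12 * real CARD('n) ^ 4 * h\<^sup>2"
  have "(norm (V (Suc k) \<omega> *v z))^4 = (norm (?v \<omega>))^4 + 2 * ((norm (?v \<omega>))\<^sup>2 * (norm (b k \<omega> *v ?v \<omega>))\<^sup>2) + (norm (b k \<omega> *v ?v \<omega>))^4" for \<omega>
  proof -
    have "(norm (V (Suc k) \<omega> *v z))^4 = ((norm (?v \<omega>))\<^sup>2 + (norm (b k \<omega> *v ?v \<omega>))\<^sup>2)\<^sup>2"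
      unfolding norm2_step[symmetric] V_Suc by (simp flip: power_mult)
    then show ?thesis by (simp add: power2_sum flip: power_mult)
  qed
  then have "(\<integral>\<omega>. (norm (V (Suc k) \<omega> *v z))^4 \<partial>M) = (\<integral>\<omega>. (norm (?v \<omega>))^4 \<partial>M)
      + 2 * (\<integral>\<omega>. (norm (?v \<omega>))\<^sup>2 * (norm (b k \<omega> *v ?v \<omega>))\<^sup>2 \<partial>M) + (\<integral>\<omega>. (norm (b k \<omega> *v ?v \<omega>))^4 \<partial>M)"
    by (simp add: fin)
  also have "(\<integral>\<omega>. (norm (?v \<omega>))\<^sup>2 * (norm (b k \<omega> *v ?v \<omega>))\<^sup>2 \<partial>M) = (\<integral>\<omega>. (norm (?v \<omega>))\<^sup>2 * (c * h * (norm (?v \<omega>))\<^sup>2) \<partial>M)"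
    by (subst b_V_Fubini[where \<phi>="\<lambda>B v. (norm v)\<^sup>2 * (norm (B *v v))\<^sup>2"]) (auto simp: b_norm2 intro!: fin)
  also have "\<dots> = c * h * (\<integral>\<omega>. (norm (?v \<omega>))^4 \<partial>M)"
    by (subst integral_mult_right_zero[symmetric]) (simp add: mult_ac power2_eq_square power4_eq_xxxx)
  also have "(\<integral>\<omega>. (norm (b k \<omega> *v ?v \<omega>))^4 \<partial>M) = (\<integral>\<omega>. (\<integral>\<omega>'. (norm (b k \<omega>' *v ?v \<omega>))^4 \<partial>M) \<partial>M)"
    by (rule b_V_Fubini) (auto intro!: fin)
  also have "\<dots> \<le> (\<integral>\<omega>. ?K * (norm (?v \<omega>))^4 \<partial>M)"
  proof (rule integral_mono')
    show "integrable M (\<lambda>\<omega>. ?K * (norm (?v \<omega>))^4)" by (intro fin)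
  qed (auto simp: b_norm4)
  also have "\<dots> = ?K * (\<integral>\<omega>. (norm (?v \<omega>))^4 \<partial>M)" by simp
  finally have "(\<integral>\<omega>. (norm (V (Suc k) \<omega> *v z))^4 \<partial>M) \<le> (1 + 2 * c * h + ?K) * (\<integral>\<omega>. (norm (?v \<omega>))^4 \<partial>M)"
    by (simp add: algebra_simps)
  also have "\<dots> \<le> (1 + 2 * c * h + ?K) * ((1 + 2 * c * h + ?K) ^ k * (norm z)^4)"
    using h_pos c_nonneg by (intro mult_left_mono Suc) auto
  finally show ?case by simp
qed

text \<open>The second moment \<open>m\<close> satisfies
  \<open>m' = (1 - h) m + h |u|^2 E|v|^2\<close>. Its isotropic part grows by
  \<open>1 + c * h\<close>, because \<open>(1 - h) + n h = 1 + (n - 1) h\<close>, and its trace-free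
  part shrinks by \<open>1 - h\<close>.\<close>

lemma V_cov:
  "(\<integral>\<omega>. (u \<bullet> (V k \<omega> *v z))\<^sup>2 \<partial>M) = (norm u)\<^sup>2 * (norm z)\<^sup>2 / real CARD('n) * (1 + c * h) ^ k
     + (1 - h) ^ k * ((u \<bullet> z)\<^sup>2 - (norm u)\<^sup>2 * (norm z)\<^sup>2 / real CARD('n))"
proof (induction k)
  case 0
  then show ?case by (simp add: V_0 prob_space)
next
  case (Suc k)
  let ?v = "\<lambda>\<omega>. V k \<omega> *v z"
  have "(\<integral>\<omega>. (u \<bullet> (V (Suc k) \<omega> *v z))\<^sup>2 \<partial>M) = (\<integral>\<omega>. (u \<bullet> ?v \<omega>)\<^sup>2 \<partial>M)
      + 2 * (\<integral>\<omega>. (u \<bullet> ?v \<omega>) * (u \<bullet> (b k \<omega> *v ?v \<omega>)) \<partial>M) + (\<integral>\<omega>. (u \<bullet> (b k \<omega> *v ?v \<omega>))\<^sup>2 \<partial>M)"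
    by (simp add: V_Suc inner_add_right power2_sum fin mult.assoc)
  also have "(\<integral>\<omega>. (u \<bullet> ?v \<omega>) * (u \<bullet> (b k \<omega> *v ?v \<omega>)) \<partial>M) = 0"
    by (subst b_V_Fubini[where \<phi>="\<lambda>B v. (u \<bullet> v) * (u \<bullet> (B *v v))"]) (auto simp: b_mean intro!: fin)
  also have "(\<integral>\<omega>. (u \<bullet> (b k \<omega> *v ?v \<omega>))\<^sup>2 \<partial>M) = (\<integral>\<omega>. h * ((norm u)\<^sup>2 * (norm (?v \<omega>))\<^sup>2 - (u \<bullet> ?v \<omega>)\<^sup>2) \<partial>M)"
    by (subst b_V_Fubini) (auto simp: b_cov intro!: fin)
  also have "\<dots> = h * ((norm u)\<^sup>2 * (\<integral>\<omega>. (norm (?v \<omega>))\<^sup>2 \<partial>M) - (\<integral>\<omega>. (u \<bullet> ?v \<omega>)\<^sup>2 \<partial>M))"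
    by (simp add: fin)
  finally have *: "(\<integral>\<omega>. (u \<bullet> (V (Suc k) \<omega> *v z))\<^sup>2 \<partial>M) =
     (1 - h) * (\<integral>\<omega>. (u \<bullet> ?v \<omega>)\<^sup>2 \<partial>M) + h * (norm u)\<^sup>2 * ((1 + c * h) ^ k * (norm z)\<^sup>2)"
    by (simp add: V_norm2 algebra_simps)
  have alg: "(1 - h) * (A / N * P + Q * B) + h * A * P = A / N * ((1 + (N - 1) * h) * P) + (1 - h) * Q * B"
    if "N > 0" for A B N P Q :: real
    using that by (simp add: field_simps)
  from alg[of "real CARD('n)" "(norm u)\<^sup>2 * (norm z)\<^sup>2" "(1 + c * h) ^ k" "(1 - h) ^ k"
      "(u \<bullet> z)\<^sup>2 - (norm u)\<^sup>2 * (norm z)\<^sup>2 / real CARD('n)"]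
  show ?case by (simp add: * Suc c_def mult_ac)
qed

text \<open>
  Two fine steps \<open>(1 + b') (1 + b)\<close> and the coarse step \<open>1 + b + b'\<close> differ by \<open>b' b\<close>. These errors are
  martingale differences, so that their squares add up, which yields order \<open>h\<close> in total.
\<close>

lemma W_step:
  "(\<integral>\<omega>. (norm (V (2 * k) \<omega> *v z - mprod (\<lambda>i. b (2 * i) \<omega> + b (2 * i + 1) \<omega>) k *v z))\<^sup>2 \<partial>M)
    \<le> real k * (c * h)\<^sup>2 * (1 + c * h) ^ (2 * k) * (norm z)\<^sup>2"
proof (induction k)
  case 0
  then show ?case by (simp add: V_0 prob_space)
next
  case (Suc k)
  define W where "W \<omega> = mprod (\<lambda>i. b (2 * i) \<omega> + b (2 * i + 1) \<omega>) k *v z" for \<omega>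
  define v where "v \<omega> = V (2 * k) \<omega> *v z" for \<omega>
  define D where "D \<omega> = v \<omega> - W \<omega>" for \<omega>
  have fW: "fin_momv W" unfolding W_def by (intro fin fin_momm_mprod)
  have fv: "fin_momv v" unfolding v_def by (intro fin)
  have fD: "fin_momv D" unfolding D_def by (intro fin fW fv)
  note fin = fin fD fv
  have [measurable]: "v \<in> borel_measurable M" "D \<in> borel_measurable M"
    by (intro fin_momv_measurable fv fD)+
  let ?x = "\<lambda>B (v, D). D + B *v D" and ?y = "\<lambda>B (v, D). D + B *v v"
  \<comment> \<open>There is one independence statement per half-step. The later half-step is
    integrated out first, with the earlier one counted in its past, and then the earlier
    one.\<close>
  have ind1: "indep_pair borel (b (2 * k)) (borel \<Otimes>\<^sub>M borel) (\<lambda>\<omega>. (v \<omega>, D \<omega>))"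
  proof -
    have "indep_pair borel (\<lambda>\<omega>. (\<lambda>B. B 0) (\<lambda>i. b (2 * k + i) \<omega>)) (borel \<Otimes>\<^sub>M borel)
      (\<lambda>\<omega>. (\<lambda>B. (mprod B (2 * k) *v z, mprod B (2 * k) *v z - mprod (\<lambda>i. B (2 * i) + B (2 * i + 1)) k *v z)) (\<lambda>i. b i \<omega>))"
    proof (rule past_future)
      fix B B' :: "nat \<Rightarrow> real^'n^'n" assume eq: "\<And>j. j < 2 * k \<Longrightarrow> B j = B' j"
      have "mprod B (2 * k) = mprod B' (2 * k)" "mprod (\<lambda>i. B (2 * i) + B (2 * i + 1)) k = mprod (\<lambda>i. B' (2 * i) + B' (2 * i + 1)) k"
        by (auto intro!: mprod_cong simp: eq)
      then show "(mprod B (2 * k) *v z, mprod B (2 * k) *v z - mprod (\<lambda>i. B (2 * i) + B (2 * i + 1)) k *v z)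
        = (mprod B' (2 * k) *v z, mprod B' (2 * k) *v z - mprod (\<lambda>i. B' (2 * i) + B' (2 * i + 1)) k *v z)" by simp
    qed auto
    then show ?thesis by (simp add: V_def v_def D_def W_def)
  qed
  have ind2: "indep_pair borel (b (2 * k + 1)) (borel \<Otimes>\<^sub>M borel) (\<lambda>\<omega>. (D \<omega> + b (2 * k) \<omega> *v D \<omega>, D \<omega> + b (2 * k) \<omega> *v v \<omega>))"
  proof -
    have "indep_pair borel (\<lambda>\<omega>. (\<lambda>B. B 0) (\<lambda>i. b (2 * k + 1 + i) \<omega>)) (borel \<Otimes>\<^sub>M borel)
      (\<lambda>\<omega>. (\<lambda>B. let v = mprod B (2 * k) *v z; D = v - mprod (\<lambda>i. B (2 * i) + B (2 * i + 1)) k *v z in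
         (D + B (2 * k) *v D, D + B (2 * k) *v v)) (\<lambda>i. b i \<omega>))"
    proof (rule past_future)
      fix B B' :: "nat \<Rightarrow> real^'n^'n" assume eq: "\<And>j. j < 2 * k + 1 \<Longrightarrow> B j = B' j"
      have "mprod B (2 * k) = mprod B' (2 * k)" "mprod (\<lambda>i. B (2 * i) + B (2 * i + 1)) k = mprod (\<lambda>i. B' (2 * i) + B' (2 * i + 1)) k"
        "B (2 * k) = B' (2 * k)"
        by (auto intro!: mprod_cong simp: eq)
      then show "(let v = mprod B (2 * k) *v z; D = v - mprod (\<lambda>i. B (2 * i) + B (2 * i + 1)) k *v z in
         (D + B (2 * k) *v D, D + B (2 * k) *v v)) = (let v = mprod B' (2 * k) *v z; D = v - mprod (\<lambda>i. B' (2 * i) + B' (2 * i + 1)) k *v z in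
         (D + B' (2 * k) *v D, D + B' (2 * k) *v v))" by simp
    qed (auto simp: Let_def)
    then show ?thesis by (simp add: V_def v_def D_def W_def Let_def)
  qed
  have step: "V (2 * Suc k) \<omega> *v z - mprod (\<lambda>i. b (2 * i) \<omega> + b (2 * i + 1) \<omega>) (Suc k) *v z
    = (D \<omega> + b (2 * k) \<omega> *v D \<omega>) + b (2 * k + 1) \<omega> *v (D \<omega> + b (2 * k) \<omega> *v v \<omega>)" for \<omega>
  proof -
    have "V (2 * Suc k) \<omega> *v z = v \<omega> + b (2 * k) \<omega> *v v \<omega> + b (2 * k + 1) \<omega> *v (v \<omega> + b (2 * k) \<omega> *v v \<omega>)"
      by (simp add: V_Suc v_def)
    moreover have "mprod (\<lambda>i. b (2 * i) \<omega> + b (2 * i + 1) \<omega>) (Suc k) *v z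
        = W \<omega> + b (2 * k) \<omega> *v W \<omega> + b (2 * k + 1) \<omega> *v W \<omega>"
      by (simp add: W_def matrix_vector_mul_assoc[symmetric] matrix_vector_mult_add_rdistrib)
    ultimately show ?thesis
      by (simp add: D_def matrix_vector_right_distrib matrix_vector_mult_diff_distrib algebra_simps)
  qed
  have E2: "(\<integral>\<omega>'. (norm (x + b j \<omega>' *v y))\<^sup>2 \<partial>M) = (norm x)\<^sup>2 + c * h * (norm y)\<^sup>2" for x y j
  proof -
    have "(norm (x + b j \<omega> *v y))\<^sup>2 = (norm x)\<^sup>2 + 2 * (x \<bullet> (b j \<omega> *v y)) + (norm (b j \<omega> *v y))\<^sup>2" for \<omega>
      by (simp add: power2_norm_eq_inner inner_add_left inner_add_right inner_commute)
    then show ?thesis by (simp add: fin b_mean b_norm2 prob_space)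
  qed
  have "(\<integral>\<omega>. (norm (V (2 * Suc k) \<omega> *v z - mprod (\<lambda>i. b (2 * i) \<omega> + b (2 * i + 1) \<omega>) (Suc k) *v z))\<^sup>2 \<partial>M)
    = (\<integral>\<omega>. (\<lambda>(B, x, y). (norm (x + B *v y))\<^sup>2) (b (2 * k + 1) \<omega>, D \<omega> + b (2 * k) \<omega> *v D \<omega>, D \<omega> + b (2 * k) \<omega> *v v \<omega>) \<partial>M)"
    unfolding step by simp
  also have "\<dots> = (\<integral>\<omega>. (norm (D \<omega> + b (2 * k) \<omega> *v D \<omega>))\<^sup>2 + c * h * (norm (D \<omega> + b (2 * k) \<omega> *v v \<omega>))\<^sup>2 \<partial>M)"
    by (subst indep_pair_Fubini[OF ind2]) (auto simp: E2[unfolded One_nat_def add_0_right] E2 intro!: fin)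
  also have "\<dots> = (\<integral>\<omega>. (\<lambda>(B, v, D). (norm (D + B *v D))\<^sup>2 + c * h * (norm (D + B *v v))\<^sup>2) (b (2 * k) \<omega>, v \<omega>, D \<omega>) \<partial>M)"
    by simp
  also have "\<dots> = (\<integral>\<omega>. ((norm (D \<omega>))\<^sup>2 + c * h * (norm (D \<omega>))\<^sup>2) + c * h * ((norm (D \<omega>))\<^sup>2 + c * h * (norm (v \<omega>))\<^sup>2) \<partial>M)"
    by (subst indep_pair_Fubini[OF ind1]) (auto simp: E2 fin intro!: fin)
  also have "\<dots> = (1 + 2 * c * h) * (\<integral>\<omega>. (norm (D \<omega>))\<^sup>2 \<partial>M) + (c * h)\<^sup>2 * (\<integral>\<omega>. (norm (v \<omega>))\<^sup>2 \<partial>M)"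
    by (simp add: fin) (simp add: algebra_simps power2_eq_square)
  also have "(\<integral>\<omega>. (norm (v \<omega>))\<^sup>2 \<partial>M) = (1 + c * h) ^ (2 * k) * (norm z)\<^sup>2"
    by (simp add: v_def V_norm2)
  also have "(1 + 2 * c * h) * (\<integral>\<omega>. (norm (D \<omega>))\<^sup>2 \<partial>M) \<le> (1 + c * h)\<^sup>2 * (real k * (c * h)\<^sup>2 * (1 + c * h) ^ (2 * k) * (norm z)\<^sup>2)"
    using Suc h_pos c_nonneg
    by (intro mult_mono) (auto simp: D_def v_def W_def power2_eq_square algebra_simps)
  also have "(c * h)\<^sup>2 * ((1 + c * h) ^ (2 * k) * (norm z)\<^sup>2) \<le> (c * h)\<^sup>2 * ((1 + c * h) ^ (2 * Suc k) * (norm z)\<^sup>2)"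
    using h_pos c_nonneg by (intro mult_left_mono mult_right_mono power_increasing) auto
  finally show ?case
    by (simp add: algebra_simps power2_eq_square)
qed

end

section \<open>Almost sure convergence from bounds on moments\<close>

context prob_space
begin

text \<open>The gap between \<open>a\<close> and 2 turns decay of means into a pathwise geometric
  rate, because the weighted series still has finite expectation. The uses are
  \<open>a = 64/49\<close> for the convergence of levels and \<open>a = (8/7)^4\<close> for the
  modulus of continuity.\<close>

lemma AE_summable_geometric:
  fixes Z :: "nat \<Rightarrow> 'a \<Rightarrow> real"
  assumes int: "\<And>j. integrable M (Z j)" and pos: "\<And>j \<omega>. 0 \<le> Z j \<omega>"
    and le: "\<And>j. (\<integral>\<omega>. Z j \<omega> \<partial>M) \<le> C * (1/2) ^ j" and a: "0 \<le> a" "a < 2"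
  shows "AE \<omega> in M. summable (\<lambda>j. a ^ j * Z j \<omega>)"
    and "integrable M (\<lambda>\<omega>. \<Sum>j. a ^ j * Z j \<omega>)"
proof -
  have [measurable]: "Z j \<in> borel_measurable M" for j using int by auto
  have C: "0 \<le> C" using le[of 0] Bochner_Integration.integral_nonneg[of M "Z 0", OF pos] by simp
  have sum: "summable (\<lambda>j. C * (a / 2) ^ j)"
    using a by (intro summable_mult summable_geometric) auto
  have b: "(\<integral>\<omega>. a ^ j * Z j \<omega> \<partial>M) \<le> C * (a / 2) ^ j" for j
    using mult_left_mono[OF le[of j], of "a ^ j"] a by (simp add: power_divide mult_ac)
  have "(\<integral>\<^sup>+\<omega>. (\<Sum>j. ennreal (a ^ j * Z j \<omega>)) \<partial>M) = (\<Sum>j. \<integral>\<^sup>+\<omega>. ennreal (a ^ j * Z j \<omega>) \<partial>M)"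
    by (rule nn_integral_suminf) simp
  also have "\<dots> \<le> (\<Sum>j. ennreal (C * (a / 2) ^ j))"
  proof (rule suminf_le)
    fix j
    have "(\<integral>\<^sup>+\<omega>. ennreal (a ^ j * Z j \<omega>) \<partial>M) = ennreal (\<integral>\<omega>. a ^ j * Z j \<omega> \<partial>M)"
      using int pos a by (intro nn_integral_eq_integral) auto
    with b show "(\<integral>\<^sup>+\<omega>. ennreal (a ^ j * Z j \<omega>) \<partial>M) \<le> ennreal (C * (a / 2) ^ j)"
      by (simp add: ennreal_leI)
  qed auto
  also have "\<dots> = ennreal (\<Sum>j. C * (a / 2) ^ j)"
    using sum C a by (intro suminf_ennreal2) auto
  finally have "(\<integral>\<^sup>+\<omega>. (\<Sum>j. ennreal (a ^ j * Z j \<omega>)) \<partial>M) \<noteq> \<infinity>"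
    by (auto simp: top_unique)
  then have "AE \<omega> in M. (\<Sum>j. ennreal (a ^ j * Z j \<omega>)) \<noteq> \<infinity>"
    by (intro nn_integral_PInf_AE) auto
  then show *: "AE \<omega> in M. summable (\<lambda>j. a ^ j * Z j \<omega>)"
    by eventually_elim (use pos a in \<open>auto intro!: summable_suminf_not_top\<close>)
  show "integrable M (\<lambda>\<omega>. \<Sum>j. a ^ j * Z j \<omega>)"
  proof (rule integrable_suminf)
    show "AE \<omega> in M. summable (\<lambda>j. norm (a ^ j * Z j \<omega>))"
      using * pos a by (simp add: abs_mult)
    show "summable (\<lambda>j. \<integral>\<omega>. norm (a ^ j * Z j \<omega>) \<partial>M)"
      using b pos a by (intro summable_comparison_test'[OF sum, of 0]) (auto simp: abs_mult)
  qed (auto intro: int)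
qed

text \<open>An integrable majorant of all \<open>(X m)\<^sup>2\<close> is constructed along with the
  convergence. Dominated convergence then yields the first two moments of every version
  \<open>Y\<close> of the limit.\<close>

lemma L2_Cauchy:
  fixes X :: "nat \<Rightarrow> 'a \<Rightarrow> real"
  assumes X: "\<And>m. fin_mom M (X m)"
    and le: "\<And>m. (\<integral>\<omega>. (X (Suc m) \<omega> - X m \<omega>)\<^sup>2 \<partial>M) \<le> C * (1/2) ^ m"
  shows "AE \<omega> in M. convergent (\<lambda>m. X m \<omega>)"
    and "Y \<in> borel_measurable M \<Longrightarrow> AE \<omega> in M. (\<lambda>m. X m \<omega>) \<longlonglongrightarrow> Y \<omega> \<Longrightarrow>
      (\<lambda>m. \<integral>\<omega>. X m \<omega> \<partial>M) \<longlonglongrightarrow> (\<integral>\<omega>. Y \<omega> \<partial>M) \<and> (\<lambda>m. \<integral>\<omega>. (X m \<omega>)\<^sup>2 \<partial>M) \<longlonglongrightarrow> (\<integral>\<omega>. (Y \<omega>)\<^sup>2 \<partial>M)"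
proof -
  have [measurable]: "X m \<in> borel_measurable M" for m using X by (rule fin_mom_measurable)
  define d where "d m \<omega> = X (Suc m) \<omega> - X m \<omega>" for m \<omega>
  \<comment> \<open>The weight is \<open>(8/7)^2\<close>. Splitting
    \<open>d = (7/8)^j * ((8/7)^j * d)\<close>, Cauchy-Schwarz bounds the square of any partial sum
    by \<open>5 * W\<close>, where 5 exceeds \<open>1 / (1 - 49/64) = 64/15\<close>.\<close>
  define W where "W \<omega> = (\<Sum>j. (64/49) ^ j * (d j \<omega>)\<^sup>2)" for \<omega>
  have fd: "fin_mom M (\<lambda>\<omega>. (d j \<omega>)\<^sup>2)" for j unfolding d_def by (intro fin_mom_intros X)
  note S = AE_summable_geometric[of "\<lambda>j \<omega>. (d j \<omega>)\<^sup>2" C "64/49",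
      OF fin_mom_integrable[OF fd] _ le[folded d_def]]
  have S1: "AE \<omega> in M. summable (\<lambda>j. (64/49) ^ j * (d j \<omega>)\<^sup>2)" by (rule S) auto
  have S2: "integrable M W" unfolding W_def by (rule S) auto
  have tele: "X m \<omega> = X 0 \<omega> + (\<Sum>j<m. d j \<omega>)" for m \<omega>
    by (induction m) (auto simp: d_def)
  have sq: "(((7::real)/8) ^ j)\<^sup>2 = (49/64) ^ j" "(((8::real)/7) ^ j)\<^sup>2 = (64/49) ^ j" for j
    by (simp_all add: power2_eq_square flip: power_mult_distrib)
  have main: "convergent (\<lambda>m. X m \<omega>) \<and> (\<forall>m. (X m \<omega>)\<^sup>2 \<le> 2 * (X 0 \<omega>)\<^sup>2 + 10 * W \<omega>)"
    if s: "summable (\<lambda>j. (64/49) ^ j * (d j \<omega>)\<^sup>2)" for \<omega>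
  proof (intro conjI allI)
    have bd: "norm (d j \<omega>) \<le> (49/64) ^ j + (64/49) ^ j * (d j \<omega>)\<^sup>2" for j
    proof -
      have "(7/8) ^ j * ((8/7) ^ j * \<bar>d j \<omega>\<bar>) \<le> ((7/8) ^ j)\<^sup>2 + ((8/7) ^ j * \<bar>d j \<omega>\<bar>)\<^sup>2"
        using sum_squares_bound[of "(7/8) ^ j" "(8/7) ^ j * \<bar>d j \<omega>\<bar>"]
          zero_le_power2[of "(7/8) ^ j :: real"] zero_le_power2[of "(8/7) ^ j * \<bar>d j \<omega>\<bar>"] by linarith
      moreover have "((7::real)/8) ^ j * ((8/7) ^ j * \<bar>d j \<omega>\<bar>) = \<bar>d j \<omega>\<bar>"
        by (simp add: mult.assoc[symmetric] flip: power_mult_distrib)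
      ultimately show ?thesis by (simp add: power_mult_distrib sq)
    qed
    have "summable (\<lambda>j. d j \<omega>)"
      by (rule summable_comparison_test'[OF summable_add[OF summable_geometric s], of "49/64" 0]) (use bd in auto)
    then have "convergent (\<lambda>m. X 0 \<omega> + (\<Sum>j<m. d j \<omega>))"
      unfolding summable_iff_convergent by (intro convergent_add convergent_const)
    moreover have "(\<lambda>m. X m \<omega>) = (\<lambda>m. X 0 \<omega> + (\<Sum>j<m. d j \<omega>))"
      by (rule ext) (rule tele)
    ultimately show "convergent (\<lambda>m. X m \<omega>)" by simp
    fix m
    have "(\<Sum>j<m. d j \<omega>)\<^sup>2 = (\<Sum>j<m. (7/8) ^ j * ((8/7) ^ j * d j \<omega>))\<^sup>2"
      by (simp add: mult.assoc[symmetric] flip: power_mult_distrib)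
    also have "\<dots> \<le> (\<Sum>j<m. ((7/8) ^ j)\<^sup>2) * (\<Sum>j<m. ((8/7) ^ j * d j \<omega>)\<^sup>2)"
      by (rule Cauchy_Schwarz_ineq_sum)
    also have "\<dots> = (\<Sum>j<m. (49/64) ^ j) * (\<Sum>j<m. (64/49) ^ j * (d j \<omega>)\<^sup>2)"
      by (simp add: power_mult_distrib sq)
    also have "\<dots> \<le> 5 * W \<omega>"
    proof (rule mult_mono)
      have "(\<Sum>j<m. (49/64::real) ^ j) \<le> (\<Sum>j. (49/64) ^ j)"
        by (intro sum_le_suminf summable_geometric) auto
      also have "\<dots> \<le> 5" by (subst suminf_geometric) auto
      finally show "(\<Sum>j<m. (49/64::real) ^ j) \<le> 5" .
      show "(\<Sum>j<m. (64/49) ^ j * (d j \<omega>)\<^sup>2) \<le> W \<omega>"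
        unfolding W_def by (intro sum_le_suminf s) auto
    qed (auto intro!: sum_nonneg)
    finally have "(\<Sum>j<m. d j \<omega>)\<^sup>2 \<le> 5 * W \<omega>" .
    moreover have "(X m \<omega>)\<^sup>2 \<le> 2 * (X 0 \<omega>)\<^sup>2 + 2 * (\<Sum>j<m. d j \<omega>)\<^sup>2"
    proof -
      have "(x + y)\<^sup>2 \<le> 2 * x\<^sup>2 + 2 * y\<^sup>2" for x y :: real
        using sum_squares_bound[of x y] by (simp add: power2_sum)
      then show ?thesis using tele[of m \<omega>] by simp
    qed
    ultimately show "(X m \<omega>)\<^sup>2 \<le> 2 * (X 0 \<omega>)\<^sup>2 + 10 * W \<omega>" by linarith
  qed
  show "AE \<omega> in M. convergent (\<lambda>m. X m \<omega>)"
    using S1 by eventually_elim (use main in auto)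
  assume Y[measurable]: "Y \<in> borel_measurable M" and lim: "AE \<omega> in M. (\<lambda>m. X m \<omega>) \<longlonglongrightarrow> Y \<omega>"
  \<comment> \<open>The summand 1 lets the same majorant serve for \<open>X m\<close> itself,
    through \<open>\<bar>x\<bar> \<le> 1 + x\<^sup>2\<close>.\<close>
  let ?w = "\<lambda>\<omega>. 1 + (2 * (X 0 \<omega>)\<^sup>2 + 10 * W \<omega>)"
  have w: "integrable M ?w" using S2 fin_mom_integrable[OF fin_mom_power[OF X]] by auto
  have "(\<lambda>m. \<integral>\<omega>. X m \<omega> \<partial>M) \<longlonglongrightarrow> (\<integral>\<omega>. Y \<omega> \<partial>M)"
  proof (rule integral_dominated_convergence[OF _ _ w lim])
    have "\<bar>x\<bar> \<le> 1 + x\<^sup>2" for x :: real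
      using zero_le_power2[of "\<bar>x\<bar> - 1"] by (simp add: power2_diff)
    then have b: "\<bar>x\<bar> \<le> 1 + y" if "x\<^sup>2 \<le> y" for x y :: real
      using that by (smt (verit))
    show "AE \<omega> in M. norm (X m \<omega>) \<le> ?w \<omega>" for m
      using S1
    proof eventually_elim
      case (elim \<omega>)
      with main[of \<omega>] have "(X m \<omega>)\<^sup>2 \<le> 2 * (X 0 \<omega>)\<^sup>2 + 10 * W \<omega>" by blast
      from b[OF this] show ?case by simp
    qed
  qed auto
  moreover have "(\<lambda>m. \<integral>\<omega>. (X m \<omega>)\<^sup>2 \<partial>M) \<longlonglongrightarrow> (\<integral>\<omega>. (Y \<omega>)\<^sup>2 \<partial>M)"
  proof (rule integral_dominated_convergence[OF _ _ w])
    show "AE \<omega> in M. (\<lambda>m. (X m \<omega>)\<^sup>2) \<longlonglongrightarrow> (Y \<omega>)\<^sup>2"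
      using lim by eventually_elim (rule tendsto_power)
    show "AE \<omega> in M. norm ((X m \<omega>)\<^sup>2) \<le> ?w \<omega>" for m
      using S1
    proof eventually_elim
      case (elim \<omega>)
      with main[of \<omega>] have "(X m \<omega>)\<^sup>2 \<le> 2 * (X 0 \<omega>)\<^sup>2 + 10 * W \<omega>" by blast
      then show ?case by simp
    qed
  qed auto
  ultimately show "(\<lambda>m. \<integral>\<omega>. X m \<omega> \<partial>M) \<longlonglongrightarrow> (\<integral>\<omega>. Y \<omega> \<partial>M) \<and> (\<lambda>m. \<integral>\<omega>. (X m \<omega>)\<^sup>2 \<partial>M) \<longlonglongrightarrow> (\<integral>\<omega>. (Y \<omega>)\<^sup>2 \<partial>M)"
    by blast
qed

text \<open>Fatou's lemma, which asks for no majorant of the \<open>Y m\<close>; they will contain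
  fourth powers of norms.\<close>

lemma AE_zero_if_L1_tendsto_zero:
  fixes Y :: "nat \<Rightarrow> 'a \<Rightarrow> real"
  assumes int: "\<And>m. integrable M (Y m)" and pos: "\<And>m \<omega>. 0 \<le> Y m \<omega>"
    and lim: "(\<lambda>m. \<integral>\<omega>. Y m \<omega> \<partial>M) \<longlonglongrightarrow> 0" and ae: "AE \<omega> in M. (\<lambda>m. Y m \<omega>) \<longlonglongrightarrow> Z \<omega>"
  shows "AE \<omega> in M. Z \<omega> = 0"
proof -
  have [measurable]: "Y m \<in> borel_measurable M" for m using int by auto
  have "(\<integral>\<^sup>+\<omega>. liminf (\<lambda>m. ennreal (Y m \<omega>)) \<partial>M) \<le> liminf (\<lambda>m. \<integral>\<^sup>+\<omega>. ennreal (Y m \<omega>) \<partial>M)"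
    by (rule nn_integral_liminf) simp
  also have "\<dots> = liminf (\<lambda>m. ennreal (\<integral>\<omega>. Y m \<omega> \<partial>M))"
    using int pos by (simp add: nn_integral_eq_integral)
  also have "\<dots> = 0"
    using tendsto_ennrealI[OF lim] by (intro lim_imp_Liminf) auto
  finally have "(\<integral>\<^sup>+\<omega>. liminf (\<lambda>m. ennreal (Y m \<omega>)) \<partial>M) = 0" by simp
  then have "AE \<omega> in M. liminf (\<lambda>m. ennreal (Y m \<omega>)) = 0"
    by (subst (asm) nn_integral_0_iff_AE) auto
  with ae show ?thesis
  proof eventually_elim
    case (elim \<omega>)
    have "liminf (\<lambda>m. ennreal (Y m \<omega>)) = ennreal (Z \<omega>)"
      using tendsto_ennrealI[OF elim(1)] by (intro lim_imp_Liminf) auto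
    moreover have "0 \<le> Z \<omega>"
      by (rule LIMSEQ_le_const[OF elim(1)]) (auto simp: pos)
    ultimately show ?case using elim(2) by (simp add: ennreal_eq_0_iff)
  qed
qed

end

section \<open>The limit of the normalized products\<close>

definition dyadic_times :: "real set" where
  "dyadic_times = {real k / 2 ^ l | k l. True}"

text \<open>From some level on, a dyadic time is an exact multiple of the step size and rounding has
  no effect.\<close>

lemma dyadic_level:
  assumes "t \<in> dyadic_times"
  shows "\<exists>l. \<forall>m\<ge>l. real (nat \<lfloor>2 ^ m * t\<rfloor>) = 2 ^ m * t"
proof -
  obtain k l where t: "t = real k / 2 ^ l" using assms by (auto simp: dyadic_times_def)
  have "real (nat \<lfloor>2 ^ m * t\<rfloor>) = 2 ^ m * t" if "l \<le> m" for m
  proof -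
    have "(2::real) ^ m / 2 ^ l = 2 ^ (m - l)" using that by (simp add: power_diff)
    then have "2 ^ m * t = real k * 2 ^ (m - l)" by (metis t mult.commute times_divide_eq_left times_divide_eq_right)
    then have "2 ^ m * t = real (k * 2 ^ (m - l))" by (simp only: of_nat_mult of_nat_power of_nat_numeral)
    then show ?thesis by (metis floor_of_nat nat_int)
  qed
  then show ?thesis by blast
qed

lemma dyadic_times_nonneg: "t \<in> dyadic_times \<Longrightarrow> 0 \<le> t"
  by (auto simp: dyadic_times_def)

lemma countable_dyadics: "countable dyadic_times"
proof -
  have "dyadic_times = (\<lambda>(k, l). real k / 2 ^ l) ` UNIV" by (auto simp: dyadic_times_def)
  then show ?thesis by (metis countable_image countableI_type)
qed

lemma dyadic_times_floor: "0 \<le> (t::real) \<Longrightarrow> real_of_int \<lfloor>2 ^ l * t\<rfloor> / 2 ^ l \<in> dyadic_times"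
  unfolding dyadic_times_def by (intro CollectI exI[of _ "nat \<lfloor>2 ^ l * t\<rfloor>"] exI[of _ l]) auto

lemma dyadic_times_real: "real k / 2 ^ l \<in> dyadic_times"
  by (auto simp: dyadic_times_def)

lemma dyadic_times_add: "s \<in> dyadic_times \<Longrightarrow> t \<in> dyadic_times \<Longrightarrow> s + t \<in> dyadic_times"
proof -
  assume "s \<in> dyadic_times" "t \<in> dyadic_times"
  then obtain k l k' l' where s: "s = real k / 2 ^ l" and t: "t = real k' / 2 ^ l'"
    by (auto simp: dyadic_times_def)
  have "s + t = real (k * 2 ^ l' + k' * 2 ^ l) / 2 ^ (l + l')"
    by (simp add: s t power_add field_simps)
  then show ?thesis by (simp only: dyadic_times_real)
qed

lemma filterlim_dyadic_steps:
  assumes "t \<in> dyadic_times" "0 < t"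
  shows "filterlim (\<lambda>m. nat \<lfloor>2 ^ m * t\<rfloor>) at_top sequentially"
proof -
  from assms(1) obtain l where l: "\<And>m. l \<le> m \<Longrightarrow> real (nat \<lfloor>2 ^ m * t\<rfloor>) = 2 ^ m * t"
    using dyadic_level by blast
  have "filterlim (\<lambda>m. 2 ^ m * t) at_top sequentially"
    using assms by (intro filterlim_at_top_mult_tendsto_pos[OF tendsto_const] filterlim_at_top_mono[OF filterlim_real_sequentially])
      (auto simp: less_imp_le[OF of_nat_less_two_power])
  then have "filterlim (\<lambda>m. real (nat \<lfloor>2 ^ m * t\<rfloor>)) at_top sequentially"
    by (rule filterlim_cong[THEN iffD1, rotated -1]) (use l in \<open>auto simp del: of_nat_nat simp: eventually_sequentially intro!: exI[of _ l]\<close>)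
  then show ?thesis by (simp add: filterlim_sequentially_iff_filterlim_real)
qed

text \<open>The compound interest limit along the number of steps. Time 0 is separate, as that
  number does not tend to infinity there.\<close>

lemma tendsto_exp_dyadic:
  fixes x :: real
  assumes t: "t \<in> dyadic_times"
  shows "(\<lambda>m. (1 + x * (1/2) ^ m) ^ nat \<lfloor>2 ^ m * t\<rfloor>) \<longlonglongrightarrow> exp (x * t)"
proof (cases "t = 0")
  case False
  with dyadic_times_nonneg[OF t] have pos: "0 < t" by simp
  from t obtain l where l: "\<And>m. l \<le> m \<Longrightarrow> real (nat \<lfloor>2 ^ m * t\<rfloor>) = 2 ^ m * t"
    using dyadic_level by blast
  have A: "(\<lambda>m. (1 + x * t / real (nat \<lfloor>2 ^ m * t\<rfloor>)) ^ nat \<lfloor>2 ^ m * t\<rfloor>) \<longlonglongrightarrow> exp (x * t)"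
    by (rule filterlim_compose[OF tendsto_exp_limit_sequentially filterlim_dyadic_steps[OF t pos]])
  have "x * t / real (nat \<lfloor>2 ^ m * t\<rfloor>) = x * (1/2) ^ m" if "l \<le> m" for m
    using pos by (subst l[OF that]) (simp add: power_divide)
  then have "\<forall>\<^sub>F m in sequentially. (1 + x * t / real (nat \<lfloor>2 ^ m * t\<rfloor>)) ^ nat \<lfloor>2 ^ m * t\<rfloor>
      = (1 + x * (1/2) ^ m) ^ nat \<lfloor>2 ^ m * t\<rfloor>"
    unfolding eventually_sequentially by metis
  then show ?thesis by (rule Lim_transform_eventually[OF A])
qed simp

lemma one_plus_power_le_exp: "0 \<le> x \<Longrightarrow> (1 + x) ^ k \<le> exp (real k * x)"
  by (metis exp_ge_add_one_self exp_of_nat_mult add_increasing power_mono zero_le_one)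

locale matrix_tower = prob_space M for M :: "'w measure" +
  fixes X :: "nat \<Rightarrow> nat \<times> ('n::finite \<times> 'n) \<Rightarrow> 'w \<Rightarrow> real"
  assumes iid_X: "iid_family M std_normal (X l)"
    and refine: "X l (j, i) \<omega> = (X (Suc l) (2 * j, i) \<omega> + X (Suc l) (2 * j + 1, i) \<omega>) / sqrt 2"
begin

sublocale L: skew_walk M "X m" "(1/2)^m" for m
  by unfold_locales (auto simp: iid_X)

text \<open>The factor \<open>sqrt 2\<close> in the refinement of the normals cancels against the
  halving of the variance.\<close>

lemma b_refine: "L.b m j \<omega> = L.b (Suc m) (2 * j) \<omega> + L.b (Suc m) (2 * j + 1) \<omega>"
proof -
  have s: "sqrt ((1/2) ^ m / 2) = sqrt ((1/2) ^ Suc m / 2) * sqrt 2"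
    by (simp add: real_sqrt_mult[symmetric])
  have "r * s * ((a + b) / s - (a' + b') / s) = r * (a - a') + r * (b - b')" if "s \<noteq> 0" for r s a b a' b' :: real
    using that by (simp add: field_simps)
  then show ?thesis
    unfolding L.b_def skew_mat_def refine[of m] s by (simp add: vec_eq_iff)
qed

text \<open>The factor compensates the growth \<open>(1 + c h)\<^sup>k\<close> of the second moments of \<open>V\<close>.\<close>

definition U :: "nat \<Rightarrow> real \<Rightarrow> 'w \<Rightarrow> real ^ 'n ^ 'n" where
  "U m t \<omega> = exp (- L.c * t / 2) *\<^sub>R L.V m (nat \<lfloor>2 ^ m * t\<rfloor>) \<omega>"

lemma U_measurable[measurable]: "U m t \<in> borel_measurable M"
  unfolding U_def by measurable

lemma U_mv: "U m t \<omega> *v z = exp (- L.c * t / 2) *\<^sub>R (L.V m (nat \<lfloor>2 ^ m * t\<rfloor>) \<omega> *v z)"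
  by (simp add: U_def scaleR_matrix_vector_assoc)

lemma fin_momv_U: "fin_momv (\<lambda>\<omega>. U m t \<omega> *v z)"
proof -
  have "fin_momv (\<lambda>\<omega>. L.V m (nat \<lfloor>2 ^ m * t\<rfloor>) \<omega> *v z)" by (intro L.fin)
  then show ?thesis unfolding U_mv by (simp add: fin_momv_def fin_mom_mult)
qed

text \<open>With \<open>2 j\<close> fine steps of size \<open>h\<close> and
  \<open>2 j h = t\<close>, the error \<open>j (c h)^2\<close> of \<open>W_step\<close> is of order
  \<open>h\<close>. Its growth factor is at most \<open>exp (c t)\<close> and is cancelled by the
  normalization.\<close>

lemma U_step:
  assumes l: "\<And>m. l \<le> m \<Longrightarrow> real (nat \<lfloor>2 ^ m * t\<rfloor>) = 2 ^ m * t" and m: "l \<le> m" and t: "0 \<le> t"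
  shows "(\<integral>\<omega>. (norm (U (Suc m) t \<omega> *v z - U m t \<omega> *v z))\<^sup>2 \<partial>M) \<le> L.c\<^sup>2 * t * (norm z)\<^sup>2 * (1/2) ^ m"
proof -
  define j where "j = nat \<lfloor>2 ^ m * t\<rfloor>"
  define h :: real where "h = (1/2) ^ Suc m"
  have j: "real j = 2 ^ m * t" unfolding j_def by (rule l[OF m])
  have "real (nat \<lfloor>2 ^ Suc m * t\<rfloor>) = real (2 * j)"
    using m by (subst l) (auto simp: j)
  then have j2: "nat \<lfloor>2 ^ Suc m * t\<rfloor> = 2 * j" by (simp only: of_nat_eq_iff)
  have jh: "real (2 * j) * h = t" by (simp add: j h_def power_divide)
  have V: "L.V m j \<omega> = mprod (\<lambda>i. L.b (Suc m) (2 * i) \<omega> + L.b (Suc m) (2 * i + 1) \<omega>) j" for \<omega>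
    by (simp add: L.V_def b_refine[of m])
  have "(\<integral>\<omega>. (norm (U (Suc m) t \<omega> *v z - U m t \<omega> *v z))\<^sup>2 \<partial>M)
    = exp (- L.c * t) * (\<integral>\<omega>. (norm (L.V (Suc m) (2 * j) \<omega> *v z - L.V m j \<omega> *v z))\<^sup>2 \<partial>M)"
    unfolding U_mv j2 j_def[symmetric] scaleR_diff_right[symmetric]
    by (simp add: power_mult_distrib exp_of_nat_mult[symmetric] flip: exp_double)
  also have "\<dots> \<le> exp (- L.c * t) * (real j * (L.c * h)\<^sup>2 * (1 + L.c * h) ^ (2 * j) * (norm z)\<^sup>2)"
    unfolding V h_def by (intro mult_left_mono L.W_step) auto
  also have "\<dots> \<le> exp (- L.c * t) * (real j * (L.c * h)\<^sup>2 * exp (L.c * t) * (norm z)\<^sup>2)"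
  proof -
    have "(1 + L.c * h) ^ (2 * j) \<le> exp (real (2 * j) * (L.c * h))"
      using L.c_nonneg by (intro one_plus_power_le_exp) (auto simp: h_def)
    also have "real (2 * j) * (L.c * h) = L.c * t" using jh by (simp add: algebra_simps)
    finally show ?thesis by (intro mult_left_mono mult_right_mono) auto
  qed
  also have "\<dots> = real j * (L.c * h)\<^sup>2 * (norm z)\<^sup>2"
    by (simp add: exp_minus field_simps)
  also have "real j * (L.c * h)\<^sup>2 = L.c\<^sup>2 * (t / 4) * (1/2) ^ m"
    by (simp add: j h_def power2_eq_square power_divide field_simps)
  also have "L.c\<^sup>2 * (t / 4) * (1/2) ^ m * (norm z)\<^sup>2 \<le> L.c\<^sup>2 * t * (norm z)\<^sup>2 * (1/2) ^ m"
    using t by (simp add: mult_ac mult_left_mono)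
  finally show ?thesis .
qed

text \<open>\<open>lim\<close> makes \<open>g\<close> total and measurable without a choice of null
  sets. It is an actual limit almost surely at each dyadic time.\<close>

definition g :: "real \<Rightarrow> 'w \<Rightarrow> real ^ 'n ^ 'n" where
  "g t \<omega> = (\<chi> i j. lim (\<lambda>m. U m t \<omega> $ i $ j))"

lemma g_measurable[measurable]: "g t \<in> borel_measurable M"
  unfolding g_def by measurable

lemma U_inner_Cauchy:
  assumes t: "t \<in> dyadic_times"
  shows "AE \<omega> in M. convergent (\<lambda>m. u \<bullet> (U m t \<omega> *v z))"
    and "Y \<in> borel_measurable M \<Longrightarrow> AE \<omega> in M. (\<lambda>m. u \<bullet> (U m t \<omega> *v z)) \<longlonglongrightarrow> Y \<omega> \<Longrightarrow>
      (\<lambda>m. \<integral>\<omega>. u \<bullet> (U m t \<omega> *v z) \<partial>M) \<longlonglongrightarrow> (\<integral>\<omega>. Y \<omega> \<partial>M) \<and> (\<lambda>m. \<integral>\<omega>. (u \<bullet> (U m t \<omega> *v z))\<^sup>2 \<partial>M) \<longlonglongrightarrow> (\<integral>\<omega>. (Y \<omega>)\<^sup>2 \<partial>M)"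
proof -
  from t obtain l where l: "\<And>m. l \<le> m \<Longrightarrow> real (nat \<lfloor>2 ^ m * t\<rfloor>) = 2 ^ m * t"
    using dyadic_level by blast
  \<comment> \<open>The comparison of successive levels is available only from the level
    \<open>l\<close> of \<open>t\<close> on.\<close>
  define Z where "Z m \<omega> = u \<bullet> (U (m + l) t \<omega> *v z)" for m \<omega>
  let ?C = "(norm u)\<^sup>2 * (L.c\<^sup>2 * t * (norm z)\<^sup>2)"
  have fZ: "fin_mom M (Z m)" for m unfolding Z_def by (intro fin_mom_all fin_momv_U)
  have le: "(\<integral>\<omega>. (Z (Suc m) \<omega> - Z m \<omega>)\<^sup>2 \<partial>M) \<le> ?C * (1/2) ^ m" for m
  proof -
    have "(\<integral>\<omega>. (Z (Suc m) \<omega> - Z m \<omega>)\<^sup>2 \<partial>M) \<le> (\<integral>\<omega>. (norm u)\<^sup>2 * (norm (U (Suc (m + l)) t \<omega> *v z - U (m + l) t \<omega> *v z))\<^sup>2 \<partial>M)"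
    proof (rule integral_mono)
      show "(Z (Suc m) \<omega> - Z m \<omega>)\<^sup>2 \<le> (norm u)\<^sup>2 * (norm (U (Suc (m + l)) t \<omega> *v z - U (m + l) t \<omega> *v z))\<^sup>2" for \<omega>
        unfolding Z_def by (simp add: inner_diff_right[symmetric] power2_norm_eq_inner Cauchy_Schwarz_ineq)
    qed (intro fin_mom_integrable fin_mom_all fin_momv_U fZ)+
    also have "\<dots> = (norm u)\<^sup>2 * (\<integral>\<omega>. (norm (U (Suc (m + l)) t \<omega> *v z - U (m + l) t \<omega> *v z))\<^sup>2 \<partial>M)" by simp
    also have "\<dots> \<le> (norm u)\<^sup>2 * (L.c\<^sup>2 * t * (norm z)\<^sup>2 * (1/2) ^ (m + l))"
      by (intro mult_left_mono U_step[OF l]) (auto simp: dyadic_times_nonneg[OF t])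
    also have "\<dots> \<le> (norm u)\<^sup>2 * (L.c\<^sup>2 * t * (norm z)\<^sup>2 * (1/2) ^ m)"
      using dyadic_times_nonneg[OF t] by (intro mult_left_mono power_decreasing) auto
    finally show ?thesis by (simp add: mult_ac)
  qed
  show "AE \<omega> in M. convergent (\<lambda>m. u \<bullet> (U m t \<omega> *v z))"
    using L2_Cauchy(1)[OF fZ le]
    by eventually_elim (simp add: Z_def convergent_ignore_initial_segment[of "\<lambda>m. u \<bullet> (U m t _ *v z)"])
  assume Y: "Y \<in> borel_measurable M" and lim: "AE \<omega> in M. (\<lambda>m. u \<bullet> (U m t \<omega> *v z)) \<longlonglongrightarrow> Y \<omega>"
  have "AE \<omega> in M. (\<lambda>m. Z m \<omega>) \<longlonglongrightarrow> Y \<omega>"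
    using lim by eventually_elim (auto simp: Z_def intro: LIMSEQ_ignore_initial_segment)
  from L2_Cauchy(2)[OF fZ le Y this] show
     "(\<lambda>m. \<integral>\<omega>. u \<bullet> (U m t \<omega> *v z) \<partial>M) \<longlonglongrightarrow> (\<integral>\<omega>. Y \<omega> \<partial>M) \<and> (\<lambda>m. \<integral>\<omega>. (u \<bullet> (U m t \<omega> *v z))\<^sup>2 \<partial>M) \<longlonglongrightarrow> (\<integral>\<omega>. (Y \<omega>)\<^sup>2 \<partial>M)"
    unfolding Z_def by (auto intro: LIMSEQ_offset)
qed

lemma U_tendsto_g:
  assumes t: "t \<in> dyadic_times"
  shows "AE \<omega> in M. (\<lambda>m. U m t \<omega>) \<longlonglongrightarrow> g t \<omega>"
proof -
  have "AE \<omega> in M. \<forall>i\<in>UNIV. \<forall>j\<in>UNIV. convergent (\<lambda>m. axis i 1 \<bullet> (U m t \<omega> *v axis j 1))"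
    by (intro AE_finite_allI U_inner_Cauchy(1)[OF t]) auto
  then show ?thesis
  proof eventually_elim
    case (elim \<omega>)
    then have "convergent (\<lambda>m. U m t \<omega> $ i $ j)" for i j
      by (simp add: matrix_vector_mult_basis column_def inner_axis')
    then show ?case
      by (intro vec_tendstoI) (simp add: g_def convergent_LIMSEQ_iff)
  qed
qed

lemma U_mv_tendsto_g:
  assumes t: "t \<in> dyadic_times"
  shows "AE \<omega> in M. \<forall>z. (\<lambda>m. U m t \<omega> *v z) \<longlonglongrightarrow> g t \<omega> *v z"
  using U_tendsto_g[OF t]
  by eventually_elim (auto simp: matrix_vector_mult_def intro!: tendsto_intros)

text \<open>The mean is the same at all levels. In the second moment the normalization exactly
  offsets the growth of the isotropic part and adds rate \<open>c\<close> to the rate 1 of the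
  trace-free part, in total \<open>n\<close>.\<close>

lemma g_moments_dyadic:
  assumes t: "t \<in> dyadic_times"
  shows "(\<integral>\<omega>. u \<bullet> (g t \<omega> *v z) \<partial>M) = exp (- L.c * t / 2) * (u \<bullet> z)"
    and "(\<integral>\<omega>. (u \<bullet> (g t \<omega> *v z))\<^sup>2 \<partial>M) = (norm u)\<^sup>2 * (norm z)\<^sup>2 / real CARD('n)
      + exp (- real CARD('n) * t) * ((u \<bullet> z)\<^sup>2 - (norm u)\<^sup>2 * (norm z)\<^sup>2 / real CARD('n))"
proof -
  have ae: "AE \<omega> in M. (\<lambda>m. u \<bullet> (U m t \<omega> *v z)) \<longlonglongrightarrow> u \<bullet> (g t \<omega> *v z)"
    using U_mv_tendsto_g[OF t] by eventually_elim (auto intro!: tendsto_intros)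
  have lim: "(\<lambda>m. \<integral>\<omega>. u \<bullet> (U m t \<omega> *v z) \<partial>M) \<longlonglongrightarrow> (\<integral>\<omega>. u \<bullet> (g t \<omega> *v z) \<partial>M)"
    "(\<lambda>m. \<integral>\<omega>. (u \<bullet> (U m t \<omega> *v z))\<^sup>2 \<partial>M) \<longlonglongrightarrow> (\<integral>\<omega>. (u \<bullet> (g t \<omega> *v z))\<^sup>2 \<partial>M)"
    using U_inner_Cauchy(2)[OF t _ ae] by auto
  have "(\<integral>\<omega>. u \<bullet> (U m t \<omega> *v z) \<partial>M) = exp (- L.c * t / 2) * (u \<bullet> z)" for m
    by (simp add: U_mv L.V_mean)
  with lim(1) show "(\<integral>\<omega>. u \<bullet> (g t \<omega> *v z) \<partial>M) = exp (- L.c * t / 2) * (u \<bullet> z)"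
    by (simp add: LIMSEQ_const_iff)
  let ?A = "(norm u)\<^sup>2 * (norm z)\<^sup>2 / real CARD('n)"
  have "(\<integral>\<omega>. (u \<bullet> (U m t \<omega> *v z))\<^sup>2 \<partial>M) = exp (- L.c * t) * (?A * (1 + L.c * (1/2) ^ m) ^ nat \<lfloor>2 ^ m * t\<rfloor>
      + (1 + (- 1) * (1/2) ^ m) ^ nat \<lfloor>2 ^ m * t\<rfloor> * ((u \<bullet> z)\<^sup>2 - ?A))" for m
    by (simp add: U_mv power_mult_distrib L.V_cov flip: exp_double)
  moreover have "(\<lambda>m. exp (- L.c * t) * (?A * (1 + L.c * (1/2) ^ m) ^ nat \<lfloor>2 ^ m * t\<rfloor>
      + (1 + (- 1) * (1/2) ^ m) ^ nat \<lfloor>2 ^ m * t\<rfloor> * ((u \<bullet> z)\<^sup>2 - ?A))) \<longlonglongrightarrow>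
      exp (- L.c * t) * (?A * exp (L.c * t) + exp ((- 1) * t) * ((u \<bullet> z)\<^sup>2 - ?A))"
    by (intro tendsto_intros tendsto_exp_dyadic t)
  ultimately have "(\<integral>\<omega>. (u \<bullet> (g t \<omega> *v z))\<^sup>2 \<partial>M) = exp (- L.c * t) * (?A * exp (L.c * t) + exp ((- 1) * t) * ((u \<bullet> z)\<^sup>2 - ?A))"
    using LIMSEQ_unique[OF lim(2)] by simp
  also have "\<dots> = (exp (- L.c * t) * exp (L.c * t)) * ?A + (exp (- L.c * t) * exp ((- 1) * t)) * ((u \<bullet> z)\<^sup>2 - ?A)"
    by (simp add: algebra_simps)
  also have "exp (- L.c * t) * exp (L.c * t) = 1" by (simp add: exp_add[symmetric])
  also have "exp (- L.c * t) * exp ((- 1) * t) = exp (- real CARD('n) * t)"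
    by (simp add: exp_add[symmetric] L.c_def algebra_simps)
  finally show "(\<integral>\<omega>. (u \<bullet> (g t \<omega> *v z))\<^sup>2 \<partial>M) = ?A + exp (- real CARD('n) * t) * ((u \<bullet> z)\<^sup>2 - ?A)"
    by simp
qed

text \<open>The expectation of \<open>(|U z|^2 - |z|^2)^2\<close> tends to
  \<open>1 - 2 + 1 = 0\<close> times \<open>|z|^4\<close>. The fourth moment enters only through its
  upper bound, which suffices because the integrand is nonnegative.\<close>

lemma g_norm:
  assumes t: "t \<in> dyadic_times"
  shows "AE \<omega> in M. norm (g t \<omega> *v z) = norm z"
proof -
  from t obtain l where l: "\<And>m. l \<le> m \<Longrightarrow> real (nat \<lfloor>2 ^ m * t\<rfloor>) = 2 ^ m * t"
    using dyadic_level by blast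
  let ?K = "12 * real CARD('n) ^ 4" and ?k = "\<lambda>m. nat \<lfloor>2 ^ m * t\<rfloor>"
  define Y where "Y m \<omega> = ((norm (U m t \<omega> *v z))\<^sup>2 - (norm z)\<^sup>2)\<^sup>2" for m \<omega>
  have fY: "fin_mom M (Y m)" for m unfolding Y_def by (intro fin_mom_all fin_momv_U)
  have EY: "(\<integral>\<omega>. Y m \<omega> \<partial>M) = exp (- 2 * L.c * t) * (\<integral>\<omega>. (norm (L.V m (?k m) \<omega> *v z))^4 \<partial>M)
      - 2 * (norm z)^4 * (exp (- L.c * t) * (1 + L.c * (1/2) ^ m) ^ ?k m) + (norm z)^4" for m
  proof -
    have e: "(exp (- L.c * t / 2))\<^sup>2 = exp (- L.c * t)" "(exp (- L.c * t))\<^sup>2 = exp (- 2 * L.c * t)"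
      by (simp_all flip: exp_double)
    have "Y m \<omega> = (exp (- L.c * t) * (norm (L.V m (?k m) \<omega> *v z))\<^sup>2 - (norm z)\<^sup>2)\<^sup>2" for \<omega>
      unfolding Y_def U_mv by (simp only: norm_scaleR abs_exp_cancel power_mult_distrib e)
    also have "\<dots> \<omega> = exp (- 2 * L.c * t) * (norm (L.V m (?k m) \<omega> *v z))^4
       - 2 * (norm z)\<^sup>2 * exp (- L.c * t) * (norm (L.V m (?k m) \<omega> *v z))\<^sup>2 + (norm z)^4" for \<omega>
      unfolding power2_diff power_mult_distrib e by (simp flip: power_mult)
    finally have "Y m = (\<lambda>\<omega>. exp (- 2 * L.c * t) * (norm (L.V m (?k m) \<omega> *v z))^4
       - 2 * (norm z)\<^sup>2 * exp (- L.c * t) * (norm (L.V m (?k m) \<omega> *v z))\<^sup>2 + (norm z)^4)" by blast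
    then show ?thesis
      by (simp add: L.fin L.V_norm2 prob_space)
  qed
  have le: "(\<integral>\<omega>. Y m \<omega> \<partial>M) \<le> exp (- 2 * L.c * t) * (exp (2 * L.c * t + ?K * t * (1/2) ^ m) * (norm z)^4)
      - 2 * (norm z)^4 * (exp (- L.c * t) * (1 + L.c * (1/2) ^ m) ^ ?k m) + (norm z)^4" if m: "l \<le> m" for m
  proof -
    let ?h = "(1/2::real) ^ m"
    have "(\<integral>\<omega>. (norm (L.V m (?k m) \<omega> *v z))^4 \<partial>M) \<le> (1 + (2 * L.c * ?h + ?K * ?h\<^sup>2)) ^ ?k m * (norm z)^4"
      using L.V_norm4[of m "?k m" z] by (simp add: add.assoc)
    also have "(1 + (2 * L.c * ?h + ?K * ?h\<^sup>2)) ^ ?k m \<le> exp (real (?k m) * (2 * L.c * ?h + ?K * ?h\<^sup>2))"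
      using L.c_nonneg by (intro one_plus_power_le_exp) auto
    also have "real (?k m) * (2 * L.c * ?h + ?K * ?h\<^sup>2) = 2 * L.c * (real (?k m) * ?h) + ?K * (real (?k m) * ?h) * ?h"
      by (simp add: power2_eq_square algebra_simps)
    also have "real (?k m) * ?h = t"
      by (subst l[OF m]) (simp add: power_divide)
    finally show ?thesis unfolding EY by (intro add_right_mono diff_right_mono mult_left_mono) (auto simp: mult_right_mono)
  qed
  have "(\<lambda>m. exp (- 2 * L.c * t) * (exp (2 * L.c * t + ?K * t * (1/2) ^ m) * (norm z)^4)
      - 2 * (norm z)^4 * (exp (- L.c * t) * (1 + L.c * (1/2) ^ m) ^ ?k m) + (norm z)^4) \<longlonglongrightarrow>
      exp (- 2 * L.c * t) * (exp (2 * L.c * t + ?K * t * 0) * (norm z)^4)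
      - 2 * (norm z)^4 * (exp (- L.c * t) * exp (L.c * t)) + (norm z)^4"
    by (intro tendsto_intros tendsto_exp_dyadic t LIMSEQ_power_zero) auto
  also have "exp (- 2 * L.c * t) * (exp (2 * L.c * t + ?K * t * 0) * (norm z)^4)
      - 2 * (norm z)^4 * (exp (- L.c * t) * exp (L.c * t)) + (norm z)^4 = 0"
    by (simp add: mult.assoc[symmetric] exp_add[symmetric])
  finally have ub: "(\<lambda>m. exp (- 2 * L.c * t) * (exp (2 * L.c * t + ?K * t * (1/2) ^ m) * (norm z)^4)
      - 2 * (norm z)^4 * (exp (- L.c * t) * (1 + L.c * (1/2) ^ m) ^ ?k m) + (norm z)^4) \<longlonglongrightarrow> 0" .
  have "(\<lambda>m. \<integral>\<omega>. Y m \<omega> \<partial>M) \<longlonglongrightarrow> 0"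
  proof (rule tendsto_sandwich[OF _ _ tendsto_const ub])
    show "\<forall>\<^sub>F m in sequentially. 0 \<le> (\<integral>\<omega>. Y m \<omega> \<partial>M)"
      by (simp add: Y_def)
  qed (use le in \<open>unfold eventually_sequentially, blast\<close>)
  then have "AE \<omega> in M. ((norm (g t \<omega> *v z))\<^sup>2 - (norm z)\<^sup>2)\<^sup>2 = 0"
  proof (rule AE_zero_if_L1_tendsto_zero[rotated 2])
    show "AE \<omega> in M. (\<lambda>m. Y m \<omega>) \<longlonglongrightarrow> ((norm (g t \<omega> *v z))\<^sup>2 - (norm z)\<^sup>2)\<^sup>2"
      using U_mv_tendsto_g[OF t] by eventually_elim (auto simp: Y_def intro!: tendsto_intros)
    show "integrable M (Y m)" for m by (rule fin_mom_integrable[OF fY])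
  qed (simp add: Y_def)
  then show ?thesis by eventually_elim simp
qed

text \<open>The null set of \<open>g_norm\<close> depends on \<open>z\<close>. A countable dense set
  of vectors leaves a single one, and the set of vectors with preserved norm is closed.\<close>

lemma g_orthogonal:
  assumes t: "t \<in> dyadic_times"
  shows "AE \<omega> in M. orthogonal_matrix (g t \<omega>)"
proof -
  obtain D :: "(real ^ 'n) set" where D: "countable D" "\<And>S. open S \<Longrightarrow> S \<noteq> {} \<Longrightarrow> \<exists>d\<in>D. d \<in> S"
    using countable_dense_setE by auto
  have "AE \<omega> in M. \<forall>z\<in>D. norm (g t \<omega> *v z) = norm z"
    using D(1) g_norm[OF t] by (simp add: AE_ball_countable)
  then show ?thesis
  proof eventually_elim
    case (elim \<omega>)
    have "closed {z. norm (g t \<omega> *v z) = norm z}"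
      by (intro closed_Collect_eq continuous_intros matrix_vector_mult_linear_continuous_on)
    then have "open {z. norm (g t \<omega> *v z) \<noteq> norm z}" by (simp add: closed_def Collect_neg_eq)
    with D(2) elim have "norm (g t \<omega> *v z) = norm z" for z by blast
    then have "orthogonal_transformation ((*v) (g t \<omega>))"
      by (simp add: orthogonal_transformation)
    then show ?case by (simp add: orthogonal_transformation_matrix)
  qed
qed

text \<open>This holds only eventually, since below the levels of \<open>s\<close> and
  \<open>t\<close> the numbers of steps need not add up.\<close>

lemma U_add:
  assumes s: "s \<in> dyadic_times" and t: "t \<in> dyadic_times"
  shows "\<forall>\<^sub>F m in sequentially. \<forall>\<omega>. U m (s + t) \<omega>
    = (exp (- L.c * t / 2) *\<^sub>R mprod (\<lambda>i. L.b m (nat \<lfloor>2 ^ m * s\<rfloor> + i) \<omega>) (nat \<lfloor>2 ^ m * t\<rfloor>)) ** U m s \<omega>"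
proof -
  from s obtain l where l: "\<And>m. l \<le> m \<Longrightarrow> real (nat \<lfloor>2 ^ m * s\<rfloor>) = 2 ^ m * s"
    using dyadic_level by blast
  from t obtain l' where l': "\<And>m. l' \<le> m \<Longrightarrow> real (nat \<lfloor>2 ^ m * t\<rfloor>) = 2 ^ m * t"
    using dyadic_level by blast
  have "U m (s + t) \<omega> = (exp (- L.c * t / 2) *\<^sub>R mprod (\<lambda>i. L.b m (nat \<lfloor>2 ^ m * s\<rfloor> + i) \<omega>) (nat \<lfloor>2 ^ m * t\<rfloor>)) ** U m s \<omega>"
    if m: "max l l' \<le> m" for m \<omega>
  proof -
    have "2 ^ m * (s + t) = real (nat \<lfloor>2 ^ m * s\<rfloor> + nat \<lfloor>2 ^ m * t\<rfloor>)"
      using l[of m] l'[of m] m by (simp add: distrib_left)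
    then have k: "nat \<lfloor>2 ^ m * (s + t)\<rfloor> = nat \<lfloor>2 ^ m * s\<rfloor> + nat \<lfloor>2 ^ m * t\<rfloor>"
      by (metis floor_of_nat nat_int)
    have "(a *\<^sub>R A) ** (b *\<^sub>R B) = (a * b) *\<^sub>R (A ** B)" for a b and A B :: "real ^ 'n ^ 'n"
      by (simp add: matrix_matrix_mult_def vec_eq_iff sum_distrib_left mult_ac)
    moreover have "exp (- L.c * (s + t) / 2) = exp (- L.c * t / 2) * exp (- L.c * s / 2)"
      by (simp add: exp_add[symmetric] algebra_simps add_divide_distrib diff_divide_distrib)
    ultimately show ?thesis
      by (simp add: U_def k L.V_def mprod_add)
  qed
  then show ?thesis unfolding eventually_sequentially by blast
qed

text \<open>\<open>F\<close> is given both the later and the present matrix so that it can measure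
  an increment. The times form a family \<open>\<tau>\<close> instead of a set because rounding real
  times to dyadic ones may make some of them coincide.\<close>

lemma markov_dyadic:
  fixes F :: "real ^ 'n ^ 'n \<Rightarrow> real ^ 'n ^ 'n \<Rightarrow> real" and \<phi> :: "'i \<Rightarrow> real ^ 'n ^ 'n \<Rightarrow> real" and \<tau> :: "'i \<Rightarrow> real"
  assumes s: "s \<in> dyadic_times" and t: "t \<in> dyadic_times"
    and I: "finite I" "\<And>u. u \<in> I \<Longrightarrow> \<tau> u \<in> dyadic_times" "\<And>u. u \<in> I \<Longrightarrow> \<tau> u \<le> s"
    and F: "continuous_on UNIV (\<lambda>p. F (fst p) (snd p))" and Fb: "\<And>A B. \<bar>F A B\<bar> \<le> K"
    and \<phi>: "\<And>u. continuous_on UNIV (\<phi> u)" and \<phi>b: "\<And>u A. \<bar>\<phi> u A\<bar> \<le> 1"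
  shows "(\<integral>\<omega>. F (g (s + t) \<omega>) (g s \<omega>) * (\<Prod>u\<in>I. \<phi> u (g (\<tau> u) \<omega>)) \<partial>M)
    = (\<integral>\<omega>. (\<integral>\<omega>'. F (g t \<omega>' ** g s \<omega>) (g s \<omega>) \<partial>M) * (\<Prod>u\<in>I. \<phi> u (g (\<tau> u) \<omega>)) \<partial>M)"
proof -
  note [measurable] = borel_measurable_continuous_Pair[OF _ _ F] measurable_compose[OF _ borel_measurable_continuous_onI[OF \<phi>]]
  have K: "0 \<le> K" using Fb[of 0 0] by linarith
  have prod_le: "\<bar>\<Prod>u\<in>I. \<phi> u (A u)\<bar> \<le> 1" for A
    unfolding abs_prod by (intro prod_le_1) (auto simp: \<phi>b)
  have prod_lim: "(\<lambda>m. \<Prod>u\<in>I. \<phi> u (A m u)) \<longlonglongrightarrow> (\<Prod>u\<in>I. \<phi> u (B u))"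
    if "\<And>u. u \<in> I \<Longrightarrow> (\<lambda>m. A m u) \<longlonglongrightarrow> B u" for A B
    using that by (intro tendsto_prod continuous_on_tendsto_compose[OF \<phi>]) auto
  have F_lim: "(\<lambda>m. F (A m) (B m)) \<longlonglongrightarrow> F A' B'" if "A \<longlonglongrightarrow> A'" "B \<longlonglongrightarrow> B'" for A B A' B'
    using continuous_on_tendsto_compose[OF F tendsto_Pair[OF that]] by simp
  have bd: "\<bar>x * y\<bar> \<le> K" if "\<bar>x\<bar> \<le> K" "\<bar>y\<bar> \<le> 1" for x y :: real
    using mult_mono[OF that K] by (simp add: abs_mult)
  have aeI: "AE \<omega> in M. \<forall>u\<in>I. (\<lambda>m. U m (\<tau> u) \<omega>) \<longlonglongrightarrow> g (\<tau> u) \<omega>"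
    using I U_tendsto_g by (intro AE_finite_allI) auto
  note aes = U_tendsto_g[OF s] and aet = U_tendsto_g[OF t] and aest = U_tendsto_g[OF dyadic_times_add[OF s t]]
  define R where "R m \<omega> = (\<integral>\<omega>'. F (U m t \<omega>' ** U m s \<omega>) (U m s \<omega>) \<partial>M)" for m \<omega>
  define R' where "R' \<omega> = (\<integral>\<omega>'. F (g t \<omega>' ** g s \<omega>) (g s \<omega>) \<partial>M)" for \<omega>
  have [measurable]: "R m \<in> borel_measurable M" for m unfolding R_def by measurable
  have [measurable]: "R' \<in> borel_measurable M" unfolding R'_def by measurable
  have Rb: "\<bar>R m \<omega>\<bar> \<le> K" if "\<omega> \<in> space M" for m \<omega>
  proof -
    have "\<bar>R m \<omega>\<bar> \<le> (\<integral>\<omega>'. \<bar>F (U m t \<omega>' ** U m s \<omega>) (U m s \<omega>)\<bar> \<partial>M)"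
      unfolding R_def by (rule integral_abs_bound)
    also have "\<dots> \<le> (\<integral>\<omega>'. K \<partial>M)"
      using that K by (intro integral_mono integrable_abs integrable_const_bound[of _ K]) (auto simp: Fb)
    finally show ?thesis by (simp add: prob_space)
  qed
  have level: "\<forall>\<^sub>F m in sequentially. (\<integral>\<omega>. F (U m (s + t) \<omega>) (U m s \<omega>) * (\<Prod>u\<in>I. \<phi> u (U m (\<tau> u) \<omega>)) \<partial>M)
      = (\<integral>\<omega>. R m \<omega> * (\<Prod>u\<in>I. \<phi> u (U m (\<tau> u) \<omega>)) \<partial>M)"
    using U_add[OF s t]
  proof eventually_elim
    case (elim m)
    define k where "k = nat \<lfloor>2 ^ m * s\<rfloor>"
    \<comment> \<open>The past comprises the present matrix and the product of the tests. Both
      depend on the first \<open>k\<close> increments only, since rounding preserves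
      \<open>\<tau> u \<le> s\<close>.\<close>
    define P where "P B = (exp (- L.c * s / 2) *\<^sub>R mprod B k, \<Prod>u\<in>I. \<phi> u (exp (- L.c * \<tau> u / 2) *\<^sub>R mprod B (nat \<lfloor>2 ^ m * \<tau> u\<rfloor>)))" for B
    define Q where "Q B = exp (- L.c * t / 2) *\<^sub>R mprod B (nat \<lfloor>2 ^ m * t\<rfloor>)" for B :: "nat \<Rightarrow> real ^ 'n ^ 'n"
    have Qm[measurable]: "Q \<in> PiM UNIV (\<lambda>_. borel) \<rightarrow>\<^sub>M borel" unfolding Q_def by measurable
    have bm[measurable]: "(\<lambda>\<omega> i. L.b m (j + i) \<omega>) \<in> M \<rightarrow>\<^sub>M PiM UNIV (\<lambda>_. borel)" for j
      by (rule measurable_PiM_UNIV) simp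
    have ind: "indep_pair borel (\<lambda>\<omega>. Q (\<lambda>i. L.b m (k + i) \<omega>)) (borel \<Otimes>\<^sub>M borel) (\<lambda>\<omega>. P (\<lambda>i. L.b m i \<omega>))"
    proof (rule L.past_future[OF _ _ Qm])
      show "P \<in> PiM UNIV (\<lambda>_. borel) \<rightarrow>\<^sub>M borel \<Otimes>\<^sub>M borel" unfolding P_def by measurable
      fix B B' :: "nat \<Rightarrow> real ^ 'n ^ 'n" assume eq: "\<And>j. j < k \<Longrightarrow> B j = B' j"
      have "mprod B j = mprod B' j" if "j \<le> k" for j
        using that by (intro mprod_cong eq) simp
      moreover have "nat \<lfloor>2 ^ m * \<tau> u\<rfloor> \<le> k" if "u \<in> I" for u
        unfolding k_def using I(3)[OF that] by (intro nat_mono floor_mono mult_left_mono) auto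
      ultimately show "P B = P B'" by (simp add: P_def)
    qed
    let ?f = "\<lambda>(q, p, w). F (q ** p) p * w"
    have Pe: "P (\<lambda>i. L.b m i \<omega>) = (U m s \<omega>, \<Prod>u\<in>I. \<phi> u (U m (\<tau> u) \<omega>))" for \<omega>
      by (simp add: P_def U_def L.V_def k_def)
    \<comment> \<open>The product of the increments after \<open>k\<close> has the law of
      \<open>U m t\<close>, by stationarity.\<close>
    have shift: "(\<integral>\<omega>'. f (Q (\<lambda>i. L.b m (k + i) \<omega>')) \<partial>M) = (\<integral>\<omega>'. f (U m t \<omega>') \<partial>M)"
      if [measurable]: "f \<in> borel_measurable borel" for f :: "real ^ 'n ^ 'n \<Rightarrow> real"
    proof -
      have "(\<integral>\<omega>'. f (Q (\<lambda>i. L.b m (k + i) \<omega>')) \<partial>M) = (\<integral>B. f (Q B) \<partial>distr M (PiM UNIV (\<lambda>_. borel)) (\<lambda>\<omega> i. L.b m (k + i) \<omega>))"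
        by (subst integral_distr) auto
      also have "\<dots> = (\<integral>\<omega>'. f (Q (\<lambda>i. L.b m i \<omega>')) \<partial>M)"
        unfolding L.shift_law by (subst integral_distr) (use bm[of 0] in auto)
      finally show ?thesis by (simp add: Q_def U_def L.V_def)
    qed
    have "(\<integral>\<omega>. F (U m (s + t) \<omega>) (U m s \<omega>) * (\<Prod>u\<in>I. \<phi> u (U m (\<tau> u) \<omega>)) \<partial>M)
      = (\<integral>\<omega>. ?f (Q (\<lambda>i. L.b m (k + i) \<omega>), P (\<lambda>i. L.b m i \<omega>)) \<partial>M)"
      using elim by (simp add: Pe) (simp add: Q_def k_def)
    also have "\<dots> = (\<integral>\<omega>. (\<integral>\<omega>'. ?f (Q (\<lambda>i. L.b m (k + i) \<omega>'), P (\<lambda>i. L.b m i \<omega>)) \<partial>M) \<partial>M)"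
    proof (rule indep_pair_Fubini[OF ind])
      show "?f \<in> borel_measurable (borel \<Otimes>\<^sub>M (borel \<Otimes>\<^sub>M borel))" by measurable
      have "(\<lambda>\<omega>. Q (\<lambda>i. L.b m (k + i) \<omega>)) \<in> borel_measurable M" by measurable
      then show "integrable M (\<lambda>\<omega>. ?f (Q (\<lambda>i. L.b m (k + i) \<omega>), P (\<lambda>i. L.b m i \<omega>)))"
        by (intro integrable_const_bound[of _ K]) (auto simp: Pe intro!: bd Fb prod_le)
    qed
    also have "\<dots> = (\<integral>\<omega>. R m \<omega> * (\<Prod>u\<in>I. \<phi> u (U m (\<tau> u) \<omega>)) \<partial>M)"
      unfolding R_def Pe by (simp add: shift[of "\<lambda>q. F (q ** _) _"])
    finally show ?case .
  qed
  have lhs: "(\<lambda>m. \<integral>\<omega>. F (U m (s + t) \<omega>) (U m s \<omega>) * (\<Prod>u\<in>I. \<phi> u (U m (\<tau> u) \<omega>)) \<partial>M)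
     \<longlonglongrightarrow> (\<integral>\<omega>. F (g (s + t) \<omega>) (g s \<omega>) * (\<Prod>u\<in>I. \<phi> u (g (\<tau> u) \<omega>)) \<partial>M)"
  proof (rule integral_dominated_convergence[where w="\<lambda>_. K"])
    show "AE \<omega> in M. (\<lambda>m. F (U m (s + t) \<omega>) (U m s \<omega>) * (\<Prod>u\<in>I. \<phi> u (U m (\<tau> u) \<omega>))) \<longlonglongrightarrow> F (g (s + t) \<omega>) (g s \<omega>) * (\<Prod>u\<in>I. \<phi> u (g (\<tau> u) \<omega>))"
      using aes aest aeI by eventually_elim (intro tendsto_mult F_lim prod_lim, auto)
  qed (auto intro!: bd Fb prod_le)
  have rhs: "(\<lambda>m. \<integral>\<omega>. R m \<omega> * (\<Prod>u\<in>I. \<phi> u (U m (\<tau> u) \<omega>)) \<partial>M) \<longlonglongrightarrow> (\<integral>\<omega>. R' \<omega> * (\<Prod>u\<in>I. \<phi> u (g (\<tau> u) \<omega>)) \<partial>M)"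
  proof (rule integral_dominated_convergence[where w="\<lambda>_. K"])
    show "AE \<omega> in M. (\<lambda>m. R m \<omega> * (\<Prod>u\<in>I. \<phi> u (U m (\<tau> u) \<omega>))) \<longlonglongrightarrow> R' \<omega> * (\<Prod>u\<in>I. \<phi> u (g (\<tau> u) \<omega>))"
      using aes aeI AE_space
    proof eventually_elim
      case (elim \<omega>)
      have "(\<lambda>m. R m \<omega>) \<longlonglongrightarrow> R' \<omega>"
        unfolding R_def R'_def
      proof (rule integral_dominated_convergence[where w="\<lambda>_. K"])
        show "AE \<omega>' in M. (\<lambda>m. F (U m t \<omega>' ** U m s \<omega>) (U m s \<omega>)) \<longlonglongrightarrow> F (g t \<omega>' ** g s \<omega>) (g s \<omega>)"
          using aet
        proof eventually_elim
          case (elim \<omega>')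
          have "(\<lambda>m. U m t \<omega>' ** U m s \<omega>) \<longlonglongrightarrow> g t \<omega>' ** g s \<omega>"
            unfolding matrix_matrix_mult_def using elim \<open>(\<lambda>m. U m s \<omega>) \<longlonglongrightarrow> g s \<omega>\<close> by (intro tendsto_intros)
          then show ?case by (rule F_lim) fact
        qed
      qed (auto simp: Fb elim)
      with elim show ?case by (intro tendsto_mult prod_lim) auto
    qed
    show "AE \<omega> in M. norm (R m \<omega> * (\<Prod>u\<in>I. \<phi> u (U m (\<tau> u) \<omega>))) \<le> K" for m
      using AE_space by eventually_elim (auto intro!: bd Rb prod_le)
  qed auto
  have "(\<lambda>m. \<integral>\<omega>. R m \<omega> * (\<Prod>u\<in>I. \<phi> u (U m (\<tau> u) \<omega>)) \<partial>M)
     \<longlonglongrightarrow> (\<integral>\<omega>. F (g (s + t) \<omega>) (g s \<omega>) * (\<Prod>u\<in>I. \<phi> u (g (\<tau> u) \<omega>)) \<partial>M)"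
    by (rule Lim_transform_eventually[OF lhs level])
  from LIMSEQ_unique[OF this rhs] show ?thesis by (simp add: R'_def)
qed

end

section \<open>The fourth moment of a displacement\<close>

lemma exp_minus_le_quadratic:
  assumes "0 \<le> (x::real)" shows "exp (- x) \<le> 1 - x + x\<^sup>2 / 2"
proof -
  have p: "0 < 1 + x + x\<^sup>2 / 2" using assms by (simp add: add_pos_nonneg)
  have "exp (- x) = 1 / exp x" by (simp add: exp_minus inverse_eq_divide)
  also have "\<dots> \<le> 1 / (1 + x + x\<^sup>2 / 2)"
    using p exp_lower_Taylor_quadratic[OF assms] by (intro divide_left_mono) (auto intro: mult_pos_pos)
  also have "\<dots> \<le> 1 - x + x\<^sup>2 / 2"
  proof -
    \<comment> \<open>The product equals \<open>1 + x^4 / 4\<close>.\<close>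
    have "1 \<le> (1 - x + x\<^sup>2 / 2) * (1 + x + x\<^sup>2 / 2)"
      using zero_le_power2[of "x\<^sup>2"] by (simp add: algebra_simps power2_eq_square)
    then show ?thesis using p by (simp add: pos_divide_le_eq)
  qed
  finally show ?thesis .
qed

text \<open>Between unit vectors, \<open>|A w - w|^2 = 2 (1 - p)\<close> with
  \<open>p = w \<bullet> A w\<close>, so the fourth power is \<open>4 (1 - p)^2\<close> and needs
  two moments of \<open>p\<close> only. The terms of orders 0 and 1 in \<open>t\<close> cancel, and
  \<open>2 (n^2 - n) t^2\<close> remains.\<close>

lemma (in prob_space) displacement_moment4:
  fixes A :: "'a \<Rightarrow> real ^ 'n ^ 'n" and w :: "real ^ 'n"
  assumes [measurable]: "A \<in> borel_measurable M" and w: "norm w = 1" and t: "0 \<le> t"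
    and iso: "AE \<omega> in M. norm (A \<omega> *v w) = norm w"
    and m1: "(\<integral>\<omega>. w \<bullet> (A \<omega> *v w) \<partial>M) = exp (- (real CARD('n) - 1) * t / 2)"
    and m2: "(\<integral>\<omega>. (w \<bullet> (A \<omega> *v w))\<^sup>2 \<partial>M) = 1 / real CARD('n) + exp (- real CARD('n) * t) * (1 - 1 / real CARD('n))"
  shows "(\<integral>\<omega>. (norm (A \<omega> *v w - w))^4 \<partial>M) \<le> 2 * (real CARD('n))\<^sup>2 * t\<^sup>2"
proof -
  let ?n = "real CARD('n)" and ?p = "\<lambda>\<omega>. w \<bullet> (A \<omega> *v w)"
  have n: "1 \<le> ?n" by (simp add: Suc_leI)
  have p1: "AE \<omega> in M. \<bar>?p \<omega>\<bar> \<le> 1"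
    using iso by eventually_elim (use Cauchy_Schwarz_ineq2[of w] w in \<open>metis mult_1\<close>)
  have int: "integrable M ?p" "integrable M (\<lambda>\<omega>. (?p \<omega>)\<^sup>2)"
    using p1 by (auto intro!: integrable_const_bound[of _ 1] simp: abs_square_le_1)
  have "(\<integral>\<omega>. (norm (A \<omega> *v w - w))^4 \<partial>M) = (\<integral>\<omega>. 4 * (1 - 2 * ?p \<omega> + (?p \<omega>)\<^sup>2) \<partial>M)"
  proof (rule integral_cong_AE)
    show "AE \<omega> in M. (norm (A \<omega> *v w - w))^4 = 4 * (1 - 2 * ?p \<omega> + (?p \<omega>)\<^sup>2)"
      using iso
    proof eventually_elim
      case (elim \<omega>)
      have "(norm (A \<omega> *v w - w))\<^sup>2 = (norm (A \<omega> *v w))\<^sup>2 + (norm w)\<^sup>2 - 2 * ?p \<omega>"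
        by (simp add: power2_norm_eq_inner inner_diff_left inner_diff_right inner_commute)
      also have "\<dots> = 2 * (1 - ?p \<omega>)" using elim w by simp
      finally have "((norm (A \<omega> *v w - w))\<^sup>2)\<^sup>2 = (2 * (1 - ?p \<omega>))\<^sup>2" by simp
      then show ?case by (simp add: power_mult_distrib power2_diff flip: power_mult)
    qed
  qed measurable
  also have "\<dots> = 4 * (1 - 2 * exp (- (?n - 1) * t / 2) + (1 / ?n + exp (- ?n * t) * (1 - 1 / ?n)))"
    using int by (simp add: m1 m2 prob_space)
  also have "\<dots> \<le> 4 * (1 - 2 * (1 - (?n - 1) * t / 2) + (1 / ?n + (1 - ?n * t + (?n * t)\<^sup>2 / 2) * (1 - 1 / ?n)))"
  proof -
    have "1 - (?n - 1) * t / 2 \<le> exp (- (?n - 1) * t / 2)"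
      using exp_ge_add_one_self[of "- (?n - 1) * t / 2"] by (simp only: minus_divide_left[symmetric] mult_minus_left)
    moreover have "exp (- ?n * t) * (1 - 1 / ?n) \<le> (1 - ?n * t + (?n * t)\<^sup>2 / 2) * (1 - 1 / ?n)"
      using n t exp_minus_le_quadratic[of "?n * t"] by (intro mult_right_mono) auto
    ultimately show ?thesis by simp
  qed
  also have "\<dots> = 2 * (?n\<^sup>2 - ?n) * t\<^sup>2"
    using n by (simp add: field_simps power2_eq_square)
  also have "\<dots> \<le> 2 * ?n\<^sup>2 * t\<^sup>2"
    using n by (intro mult_right_mono) auto
  finally show ?thesis .
qed

section \<open>Continuity on dyadic times\<close>

text \<open>The roundings of \<open>t\<close> at two successive levels are equal or differ by one
  step of the finer level. The strict bound \<open>t < N\<close> keeps that step inside the window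
  controlled by \<open>inc\<close>.\<close>

lemma dyadic_chain_step:
  fixes f :: "real \<Rightarrow> real"
  assumes inc: "\<And>l k. l0 \<le> l \<Longrightarrow> k < N * 2 ^ l \<Longrightarrow> \<bar>f (real (k + 1) / 2 ^ l) - f (real k / 2 ^ l)\<bar> \<le> r ^ l"
    and t: "0 \<le> t" "t < real N" and l: "l0 \<le> l" and r: "0 \<le> r"
  shows "\<bar>f (real_of_int \<lfloor>2 ^ Suc l * t\<rfloor> / 2 ^ Suc l) - f (real_of_int \<lfloor>2 ^ l * t\<rfloor> / 2 ^ l)\<bar> \<le> r ^ Suc l"
proof -
  define k where "k = nat \<lfloor>2 ^ l * t\<rfloor>"
  have k: "\<lfloor>2 ^ l * t\<rfloor> = int k" using t by (simp add: k_def)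
  have kb: "real k \<le> 2 ^ l * t" "2 ^ l * t < real k + 1"
    using floor_correct[of "2 ^ l * t"] unfolding k by auto
  have kN: "2 * k < N * 2 ^ Suc l"
  proof -
    have "real k < real N * 2 ^ l" using kb(1) t by (smt (verit) mult.commute mult_less_cancel_right_pos zero_less_power)
    then have "real k < real (N * 2 ^ l)" by simp
    then have "k < N * 2 ^ l" by (simp only: of_nat_less_iff)
    then show ?thesis by simp
  qed
  have e: "f (real_of_int (int k) / 2 ^ l) = f (real (2 * k) / 2 ^ Suc l)" by simp
  have "\<lfloor>2 ^ Suc l * t\<rfloor> = int (2 * k) \<or> \<lfloor>2 ^ Suc l * t\<rfloor> = int (2 * k + 1)"
    using kb by (simp add: floor_eq_iff) linarith
  then show ?thesis
  proof
    assume "\<lfloor>2 ^ Suc l * t\<rfloor> = int (2 * k)"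
    then show ?thesis using r unfolding k e by simp
  next
    assume "\<lfloor>2 ^ Suc l * t\<rfloor> = int (2 * k + 1)"
    then show ?thesis using inc[of "Suc l" "2 * k"] l kN unfolding k e by simp
  qed
qed

text \<open>Times at distance at most \<open>2^-l\<close> have equal or adjacent roundings at level
  \<open>l\<close>.\<close>

lemma dyadic_chain_close:
  fixes f :: "real \<Rightarrow> real"
  assumes inc: "\<And>l k. l0 \<le> l \<Longrightarrow> k < N * 2 ^ l \<Longrightarrow> \<bar>f (real (k + 1) / 2 ^ l) - f (real k / 2 ^ l)\<bar> \<le> r ^ l"
    and st: "0 \<le> s" "s \<le> t" "t < real N" "t - s \<le> 1 / 2 ^ l" and l: "l0 \<le> l" and r: "0 \<le> r"
  shows "\<bar>f (real_of_int \<lfloor>2 ^ l * t\<rfloor> / 2 ^ l) - f (real_of_int \<lfloor>2 ^ l * s\<rfloor> / 2 ^ l)\<bar> \<le> r ^ l"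
proof -
  define k where "k = nat \<lfloor>2 ^ l * s\<rfloor>"
  have k: "\<lfloor>2 ^ l * s\<rfloor> = int k" using st by (simp add: k_def)
  have kb: "real k \<le> 2 ^ l * s" "2 ^ l * s < real k + 1"
    using floor_correct[of "2 ^ l * s"] unfolding k by auto
  have "2 ^ l * (t - s) \<le> 2 ^ l * (1 / 2 ^ l)"
    using st by (intro mult_left_mono) auto
  then have d: "2 ^ l * t \<le> 2 ^ l * s + 1" by (simp add: algebra_simps)
  have d': "2 ^ l * s \<le> 2 ^ l * t" using st by simp
  have kN: "k < N * 2 ^ l"
  proof -
    have "2 ^ l * s < 2 ^ l * real N" using st by simp
    with kb(1) have "real k < 2 ^ l * real N" by linarith
    then have "real k < real (N * 2 ^ l)" by (simp add: mult.commute)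
    then show ?thesis by (simp only: of_nat_less_iff)
  qed
  have "\<lfloor>2 ^ l * t\<rfloor> = int k \<or> \<lfloor>2 ^ l * t\<rfloor> = int (k + 1)"
    unfolding floor_eq_iff using kb d d' by (simp only: of_int_of_nat_eq of_nat_add of_nat_1) linarith
  then show ?thesis
  proof
    assume "\<lfloor>2 ^ l * t\<rfloor> = int k"
    then show ?thesis using r unfolding k by simp
  next
    assume "\<lfloor>2 ^ l * t\<rfloor> = int (k + 1)"
    then show ?thesis using inc[OF l kN] unfolding k by simp
  qed
qed

text \<open>The values at successive roundings of \<open>t\<close> telescope, and what lies beyond
  level \<open>l\<close> is the tail of a geometric series.\<close>

lemma dyadic_chain_limit:
  fixes f :: "real \<Rightarrow> real"
  assumes inc: "\<And>l k. l0 \<le> l \<Longrightarrow> k < N * 2 ^ l \<Longrightarrow> \<bar>f (real (k + 1) / 2 ^ l) - f (real k / 2 ^ l)\<bar> \<le> r ^ l"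
    and t: "0 \<le> t" "t < real N" and r: "0 \<le> r" "r < 1"
  defines "F \<equiv> \<lambda>l (t::real). f (real_of_int \<lfloor>2 ^ l * t\<rfloor> / 2 ^ l)"
  shows "convergent (\<lambda>l. F l t)" and "l0 \<le> l \<Longrightarrow> \<bar>lim (\<lambda>l. F l t) - F l t\<bar> \<le> r ^ l / (1 - r)"
proof -
  have step: "\<bar>F (Suc l) t - F l t\<bar> \<le> r ^ Suc l" if "l0 \<le> l" for l
    unfolding F_def by (rule dyadic_chain_step[OF inc t that r(1)])
  have pow: "\<bar>F (l + m) t - F l t\<bar> \<le> (\<Sum>j<m. r ^ (l + j))" if "l0 \<le> l" for l m
  proof (induction m)
    case (Suc m)
    have "r ^ Suc (l + m) \<le> r ^ (l + m)" using r by (intro power_decreasing) auto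
    with step[of "l + m"] that have "\<bar>F (Suc (l + m)) t - F (l + m) t\<bar> \<le> r ^ (l + m)" by simp
    with Suc show ?case by simp
  qed simp
  have geo: "(\<Sum>j<m. r ^ (l + j)) \<le> r ^ l / (1 - r)" for l m
  proof -
    have "(\<Sum>j<m. r ^ j) \<le> (\<Sum>j. r ^ j)"
      using r by (intro sum_le_suminf summable_geometric) auto
    also have "\<dots> = 1 / (1 - r)" using r by (intro suminf_geometric) auto
    finally have "r ^ l * (\<Sum>j<m. r ^ j) \<le> r ^ l * (1 / (1 - r))"
      using r by (intro mult_left_mono) auto
    then show ?thesis by (simp add: power_add sum_distrib_left)
  qed
  have "summable (\<lambda>l. F (Suc (l + l0)) t - F (l + l0) t)"
  proof (rule summable_comparison_test')
    show "summable (\<lambda>l. r ^ l)" using r by (intro summable_geometric) auto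
    fix l
    have "r ^ Suc (l + l0) \<le> r ^ l" using r by (intro power_decreasing) auto
    with step[of "l + l0"] show "norm (F (Suc (l + l0)) t - F (l + l0) t) \<le> r ^ l" by simp
  qed
  then have "convergent (\<lambda>l. F (l + l0) t - F l0 t)"
    unfolding summable_iff_convergent
    using sum_lessThan_telescope[of "\<lambda>l. F (l + l0) t"] by simp
  then have "convergent (\<lambda>l. (F (l + l0) t - F l0 t) + F l0 t)"
    by (intro convergent_add convergent_const)
  then show conv: "convergent (\<lambda>l. F l t)"
    by (simp add: convergent_ignore_initial_segment[of "\<lambda>l. F l t"])
  then have "(\<lambda>m. F (m + l) t) \<longlonglongrightarrow> lim (\<lambda>l. F l t)"
    unfolding convergent_LIMSEQ_iff by (rule LIMSEQ_ignore_initial_segment)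
  then have "(\<lambda>m. \<bar>F (m + l) t - F l t\<bar>) \<longlonglongrightarrow> \<bar>lim (\<lambda>l. F l t) - F l t\<bar>"
    by (intro tendsto_intros)
  moreover assume l: "l0 \<le> l"
  have "\<bar>F (m + l) t - F l t\<bar> \<le> r ^ l / (1 - r)" for m
    using pow[OF l, of m] geo[of l m] by (simp add: add.commute)
  ultimately show "\<bar>lim (\<lambda>l. F l t) - F l t\<bar> \<le> r ^ l / (1 - r)"
    by (intro LIMSEQ_le_const2) auto
qed

text \<open>The deterministic half of Chentsov's argument. Two nearby times are joined through their
  roundings at level \<open>l\<close>, at the cost of two tails and one step. The threshold
  \<open>l0\<close> may depend on the window \<open>N\<close>, as continuity is local.\<close>

lemma dyadic_chain_continuous:
  fixes f :: "real \<Rightarrow> real"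
  assumes inc: "\<And>N. \<exists>l0. \<forall>l\<ge>l0. \<forall>k<N * 2 ^ l. \<bar>f (real (k + 1) / 2 ^ l) - f (real k / 2 ^ l)\<bar> \<le> r ^ l"
    and r: "0 \<le> r" "r < 1"
  defines "F \<equiv> \<lambda>l (t::real). f (real_of_int \<lfloor>2 ^ l * t\<rfloor> / 2 ^ l)"
  shows "\<And>t. 0 \<le> t \<Longrightarrow> convergent (\<lambda>l. F l t)" and "continuous_on {0..} (\<lambda>t. lim (\<lambda>l. F l t))"
proof -
  have N: "\<exists>N. t < real N" for t :: real by (rule reals_Archimedean2)
  show "convergent (\<lambda>l. F l t)" if "0 \<le> t" for t
  proof -
    obtain N where "t < real N" using N by blast
    moreover obtain l0 where "\<forall>l\<ge>l0. \<forall>k<N * 2 ^ l. \<bar>f (real (k + 1) / 2 ^ l) - f (real k / 2 ^ l)\<bar> \<le> r ^ l"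
      using inc by blast
    ultimately show ?thesis
      unfolding F_def using dyadic_chain_limit(1)[of l0 N f r t] that r by blast
  qed
  let ?G = "\<lambda>t. lim (\<lambda>l. F l t)"
  show "continuous_on {0..} ?G"
    unfolding continuous_on_iff
  proof (intro ballI allI impI)
    fix t e :: real assume t: "t \<in> {0..}" and e: "0 < e"
    obtain N where N: "t < real N" using N by blast
    obtain l0 where inc': "\<And>l k. l0 \<le> l \<Longrightarrow> k < N * 2 ^ l \<Longrightarrow> \<bar>f (real (k + 1) / 2 ^ l) - f (real k / 2 ^ l)\<bar> \<le> r ^ l"
      using inc by blast
    have "(\<lambda>l. r ^ l * (2 / (1 - r) + 1)) \<longlonglongrightarrow> 0 * (2 / (1 - r) + 1)"
      using r by (intro tendsto_intros LIMSEQ_power_zero) auto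
    then have "\<forall>\<^sub>F l in sequentially. r ^ l * (2 / (1 - r) + 1) < e"
      using e by (intro order_tendstoD) auto
    then obtain l where l: "l0 \<le> l" "r ^ l * (2 / (1 - r) + 1) < e"
      unfolding eventually_sequentially by (meson nle_le)
    have main: "\<bar>?G b - ?G a\<bar> < e" if ab: "0 \<le> a" "a \<le> b" "b < real N" "b - a \<le> 1 / 2 ^ l" for a b
    proof -
      have "\<bar>?G b - F l b\<bar> \<le> r ^ l / (1 - r)" "\<bar>?G a - F l a\<bar> \<le> r ^ l / (1 - r)"
        unfolding F_def using ab l r by (auto intro!: dyadic_chain_limit(2)[OF inc'])
      moreover have "\<bar>F l b - F l a\<bar> \<le> r ^ l"
        unfolding F_def using ab l r by (intro dyadic_chain_close[OF inc']) auto
      ultimately have "\<bar>?G b - ?G a\<bar> \<le> 2 * (r ^ l / (1 - r)) + r ^ l" by linarith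
      also have "\<dots> = r ^ l * (2 / (1 - r) + 1)" by (simp add: field_simps)
      finally show ?thesis using l(2) by linarith
    qed
    show "\<exists>d>0. \<forall>x'\<in>{0..}. dist x' t < d \<longrightarrow> dist (?G x') (?G t) < e"
    \<comment> \<open>The second bound keeps the nearby times below \<open>N\<close>.\<close>
    proof (intro exI[of _ "min (1 / 2 ^ l) (real N - t)"] conjI ballI impI)
      fix s assume s: "s \<in> {0..}" "dist s t < min (1 / 2 ^ l) (real N - t)"
      then show "dist (?G s) (?G t) < e"
        using main[of s t] main[of t s] t N by (cases "s \<le> t") (auto simp: dist_real_def abs_minus_commute)
    qed (use N in auto)
  qed
qed

section \<open>Brownian motion on the orthogonal group\<close>

text \<open>The pathwise properties hold at every sample point, the null set having been removed
  beforehand. \<open>G_markov\<close> says, tested by finitely many continuous functions of the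
  past, that \<open>G (s + t)\<close> is \<open>G s\<close> multiplied on the left by an independent
  copy of \<open>G t\<close>.\<close>

locale orth_bm = prob_space M for M :: "'w measure" +
  fixes G :: "real \<Rightarrow> 'w \<Rightarrow> real ^ 'n::finite ^ 'n"
  assumes G_measurable[measurable]: "\<And>t. G t \<in> borel_measurable M"
    and G_continuous: "\<And>\<omega>. \<omega> \<in> space M \<Longrightarrow> continuous_on {0..} (\<lambda>t. G t \<omega>)"
    and G_0: "\<And>\<omega>. \<omega> \<in> space M \<Longrightarrow> G 0 \<omega> = mat 1"
    and G_orthogonal: "\<And>\<omega> t. \<omega> \<in> space M \<Longrightarrow> 0 \<le> t \<Longrightarrow> orthogonal_matrix (G t \<omega>)"
    and G_mean: "\<And>t u z. 0 \<le> t \<Longrightarrow> (\<integral>\<omega>. u \<bullet> (G t \<omega> *v z) \<partial>M) = exp (- (real CARD('n) - 1) * t / 2) * (u \<bullet> z)"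
    and G_cov: "\<And>t u z. 0 \<le> t \<Longrightarrow> (\<integral>\<omega>. (u \<bullet> (G t \<omega> *v z))\<^sup>2 \<partial>M) = (norm u)\<^sup>2 * (norm z)\<^sup>2 / real CARD('n)
      + exp (- real CARD('n) * t) * ((u \<bullet> z)\<^sup>2 - (norm u)\<^sup>2 * (norm z)\<^sup>2 / real CARD('n))"
    and G_markov: "\<And>s t I f (K :: real) \<phi>. 0 \<le> s \<Longrightarrow> 0 \<le> t \<Longrightarrow> finite I \<Longrightarrow> I \<subseteq> {0..s} \<Longrightarrow>
      continuous_on UNIV f \<Longrightarrow> (\<And>A. \<bar>f A\<bar> \<le> K) \<Longrightarrow>
      (\<And>u. continuous_on UNIV (\<phi> u)) \<Longrightarrow> (\<And>u A. \<bar>\<phi> u A\<bar> \<le> 1) \<Longrightarrow>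
      (\<integral>\<omega>. f (G (s + t) \<omega>) * (\<Prod>u\<in>I. \<phi> u (G u \<omega>)) \<partial>M)
      = (\<integral>\<omega>. (\<integral>\<omega>'. f (G t \<omega>' ** G s \<omega>) \<partial>M) * (\<Prod>u\<in>I. \<phi> u (G u \<omega>)) \<partial>M)"

lemma orthogonal_matrix_norm: "orthogonal_matrix (A :: real ^ 'n ^ 'n) \<Longrightarrow> norm (A *v x) = norm x"
  using orthogonal_transformation_matrix[of "(*v) A"] by (simp add: orthogonal_transformation)

lemma closed_orthogonal_matrices: "closed {A :: real ^ 'n ^ 'n. orthogonal_matrix A}"
  unfolding orthogonal_matrix matrix_matrix_mult_def transpose_def
  by (intro closed_Collect_eq continuous_intros)

section \<open>Small increments of the limit on dyadic times\<close>

context matrix_tower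
begin

text \<open>The truncation at \<open>16 = 2^4\<close> makes the test function bounded on all pairs
  of matrices, as \<open>markov_dyadic\<close> demands. Almost surely it has no effect, because two
  unit vectors are at distance at most 2.\<close>

lemma g_increment_moment:
  fixes z :: "real ^ 'n"
  assumes s: "s \<in> dyadic_times" and t: "t \<in> dyadic_times" and z: "norm z = 1"
  shows "(\<integral>\<omega>. min 16 ((norm (g (s + t) \<omega> *v z - g s \<omega> *v z))^4) \<partial>M) \<le> 2 * (real CARD('n))\<^sup>2 * t\<^sup>2"
proof -
  let ?F = "\<lambda>A B. min 16 ((norm (A *v z - B *v z))^4)"
  have cont: "continuous_on UNIV (\<lambda>p. ?F (fst p) (snd p))"
    unfolding matrix_vector_mult_def by (intro continuous_intros)
  have "(\<integral>\<omega>. ?F (g (s + t) \<omega>) (g s \<omega>) \<partial>M) = (\<integral>\<omega>. (\<integral>\<omega>'. ?F (g t \<omega>' ** g s \<omega>) (g s \<omega>) \<partial>M) \<partial>M)"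
    using markov_dyadic[OF s t _ _ _ cont, of "{}" "\<lambda>_. 0" 16 "\<lambda>_ _. 1"] by simp
  also have "\<dots> \<le> (\<integral>\<omega>. 2 * (real CARD('n))\<^sup>2 * t\<^sup>2 \<partial>M)"
  proof (rule integral_mono_AE)
    have b: "\<bar>\<integral>\<omega>'. ?F (g t \<omega>' ** g s \<omega>) (g s \<omega>) \<partial>M\<bar> \<le> 16" if "\<omega> \<in> space M" for \<omega>
    proof -
      have "\<bar>\<integral>\<omega>'. ?F (g t \<omega>' ** g s \<omega>) (g s \<omega>) \<partial>M\<bar> \<le> (\<integral>\<omega>'. \<bar>?F (g t \<omega>' ** g s \<omega>) (g s \<omega>)\<bar> \<partial>M)"
        by (rule integral_abs_bound)
      also have "\<dots> \<le> (\<integral>\<omega>'. 16 \<partial>M)"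
        using that by (intro integral_mono integrable_abs integrable_const_bound[of _ 16]) auto
      finally show ?thesis by (simp add: prob_space)
    qed
    show "integrable M (\<lambda>\<omega>. \<integral>\<omega>'. ?F (g t \<omega>' ** g s \<omega>) (g s \<omega>) \<partial>M)"
      by (rule integrable_const_bound[of _ 16]) (use b AE_space in auto)
    show "AE \<omega> in M. (\<integral>\<omega>'. ?F (g t \<omega>' ** g s \<omega>) (g s \<omega>) \<partial>M) \<le> 2 * (real CARD('n))\<^sup>2 * t\<^sup>2"
      using g_norm[OF s, of z] AE_space
    proof eventually_elim
      case (elim \<omega>)
      define w where "w = g s \<omega> *v z"
      have w: "norm w = 1" using elim z by (simp add: w_def)
      have "(\<integral>\<omega>'. ?F (g t \<omega>' ** g s \<omega>) (g s \<omega>) \<partial>M) = (\<integral>\<omega>'. (norm (g t \<omega>' *v w - w))^4 \<partial>M)"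
      proof (rule integral_cong_AE)
        show "AE \<omega>' in M. ?F (g t \<omega>' ** g s \<omega>) (g s \<omega>) = (norm (g t \<omega>' *v w - w))^4"
          using g_norm[OF t, of w]
        proof eventually_elim
          case (elim \<omega>')
          have "norm (g t \<omega>' *v w - w) \<le> 2"
            using norm_triangle_ineq4[of "g t \<omega>' *v w" w] elim w by simp
          then have "(norm (g t \<omega>' *v w - w))^4 \<le> 2 ^ 4" by (intro power_mono) auto
          then show ?case by (simp add: w_def matrix_vector_mul_assoc[symmetric] min_def)
        qed
      qed (use elim in measurable)
      also have "\<dots> \<le> 2 * (real CARD('n))\<^sup>2 * t\<^sup>2"
        using g_moments_dyadic[OF t, of w w] w dyadic_times_nonneg[OF t]
        by (intro displacement_moment4 g_norm[OF t]) (auto simp: L.c_def power2_norm_eq_inner[symmetric])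
      finally show ?case .
    qed
  qed auto
  finally show ?thesis by (simp add: prob_space)
qed

text \<open>At level \<open>l\<close> there are \<open>N * 2^l\<close> increments with fourth
  moments of order \<open>4^-l\<close>, hence the sum \<open>Z l\<close> has mean of order
  \<open>2^-l\<close>. The rate \<open>7/8\<close> is admissible since
  \<open>(8/7)^4 < 2\<close>.\<close>

lemma g_increments_small:
  "AE \<omega> in M. \<forall>i j N. \<exists>l0. \<forall>l\<ge>l0. \<forall>k<N * 2 ^ l.
     \<bar>g (real (k + 1) / 2 ^ l) \<omega> $ i $ j - g (real k / 2 ^ l) \<omega> $ i $ j\<bar> \<le> (7/8) ^ l"
proof -
  have "AE \<omega> in M. \<exists>l0. \<forall>l\<ge>l0. \<forall>k<N * 2 ^ l.
     \<bar>g (real (k + 1) / 2 ^ l) \<omega> $ i $ j - g (real k / 2 ^ l) \<omega> $ i $ j\<bar> \<le> (7/8) ^ l" for i j and N :: nat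
  proof -
    define e :: "real ^ 'n" where "e = axis j 1"
    define D where "D l k \<omega> = min 16 ((norm (g (real (k + 1) / 2 ^ l) \<omega> *v e - g (real k / 2 ^ l) \<omega> *v e))^4)" for l k \<omega>
    define Z where "Z l \<omega> = (\<Sum>k<N * 2 ^ l. D l k \<omega>)" for l \<omega>
    have [measurable]: "D l k \<in> borel_measurable M" for l k unfolding D_def by measurable
    have D0: "0 \<le> D l k \<omega>" for l k \<omega> by (simp add: D_def)
    have intD: "integrable M (D l k)" for l k
      by (rule integrable_const_bound[of _ 16]) (auto simp: D_def)
    have intZ: "integrable M (Z l)" for l unfolding Z_def by (intro Bochner_Integration.integrable_sum intD)
    have "(\<integral>\<omega>. Z l \<omega> \<partial>M) \<le> 2 * (real CARD('n))\<^sup>2 * real N * (1/2) ^ l" for l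
    proof -
      have "(\<integral>\<omega>. Z l \<omega> \<partial>M) = (\<Sum>k<N * 2 ^ l. \<integral>\<omega>. D l k \<omega> \<partial>M)"
        unfolding Z_def by (rule Bochner_Integration.integral_sum) (rule intD)
      also have "\<dots> \<le> (\<Sum>k<N * 2 ^ l. 2 * (real CARD('n))\<^sup>2 * (1 / 2 ^ l)\<^sup>2)"
      proof (rule sum_mono)
        fix k
        have "real (k + 1) / 2 ^ l = real k / 2 ^ l + 1 / 2 ^ l" by (simp add: add_divide_distrib)
        moreover have "1 / 2 ^ l \<in> dyadic_times" using dyadic_times_real[of 1 l] by simp
        ultimately show "(\<integral>\<omega>. D l k \<omega> \<partial>M) \<le> 2 * (real CARD('n))\<^sup>2 * (1 / 2 ^ l)\<^sup>2"
          unfolding D_def using g_increment_moment[OF dyadic_times_real, of "1 / 2 ^ l" e k l]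
          by (simp add: e_def)
      qed
      also have "\<dots> = 2 * (real CARD('n))\<^sup>2 * real N * (1/2) ^ l"
        by (simp add: power_divide power2_eq_square)
      finally show ?thesis .
    qed
    then have "AE \<omega> in M. summable (\<lambda>l. ((8/7)^4) ^ l * Z l \<omega>)"
      by (intro AE_summable_geometric(1)[OF intZ]) (auto simp: Z_def D0 intro: sum_nonneg, auto simp: power_divide)
    then show ?thesis
    proof eventually_elim
      case (elim \<omega>)
      from summable_LIMSEQ_zero[OF elim] have "\<forall>\<^sub>F l in sequentially. ((8/7)^4) ^ l * Z l \<omega> < 1"
        by (rule order_tendstoD) simp
      then obtain l0 where l0: "\<And>l. l0 \<le> l \<Longrightarrow> ((8/7)^4) ^ l * Z l \<omega> < 1"
        unfolding eventually_sequentially by blast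
      have "\<bar>g (real (k + 1) / 2 ^ l) \<omega> $ i $ j - g (real k / 2 ^ l) \<omega> $ i $ j\<bar> \<le> (7/8) ^ l"
        if l: "l0 \<le> l" and k: "k < N * 2 ^ l" for l k
      proof -
        define x where "x = norm (g (real (k + 1) / 2 ^ l) \<omega> *v e - g (real k / 2 ^ l) \<omega> *v e)"
        have "D l k \<omega> \<le> Z l \<omega>"
          unfolding Z_def using k by (intro member_le_sum) (auto simp: D0)
        then have "((8/7)^4) ^ l * D l k \<omega> \<le> ((8/7)^4) ^ l * Z l \<omega>" by (intro mult_left_mono) auto
        from order_trans[OF this less_imp_le[OF l0[OF l]]] have "((8/7)^4) ^ l * D l k \<omega> \<le> 1" .
        then have le: "(7/8) ^ (4 * l) * (((8/7)^4) ^ l * D l k \<omega>) \<le> (7/8) ^ (4 * l) * 1"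
          by (intro mult_left_mono) auto
        have "((7::real)/8) ^ (4 * l) * ((8/7)^4) ^ l = 1"
          by (simp add: power_mult power_mult_distrib[symmetric] power_divide)
        then have "D l k \<omega> = (7/8) ^ (4 * l) * (((8/7)^4) ^ l * D l k \<omega>)"
          by (simp only: mult.assoc[symmetric] mult_1)
        also note le
        also have "((7::real)/8) ^ (4 * l) * 1 = ((7/8) ^ l) ^ 4"
          by (simp add: power_mult[symmetric] mult.commute)
        finally have *: "D l k \<omega> \<le> ((7/8) ^ l) ^ 4" .
        \<comment> \<open>A minimum of 16 and the fourth power that is at most 1 must be the fourth
          power itself.\<close>
        moreover have "((7/8) ^ l) ^ 4 \<le> (1::real)" by (intro power_le_one) auto
        ultimately have "x ^ 4 \<le> ((7/8) ^ l) ^ 4" using *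
          unfolding D_def x_def[symmetric] by (simp add: min_def split: if_splits)
        then have "x \<le> (7/8) ^ l" by (subst (asm) power_mono_iff) (auto simp: x_def)
        moreover have "\<bar>(g (real (k + 1) / 2 ^ l) \<omega> *v e - g (real k / 2 ^ l) \<omega> *v e) $ i\<bar> \<le> x"
          unfolding x_def by (rule component_le_norm_cart)
        ultimately show ?thesis
          by (simp add: e_def matrix_vector_mult_basis column_def)
      qed
      then show ?case by blast
    qed
  qed
  then show ?thesis
    by (simp add: AE_all_countable)
qed

end

text \<open>No sign of \<open>t\<close> is assumed: at \<open>- t\<close> the statement is about
  rounding up, which approximates random times later.\<close>

lemma tendsto_dyadic_floor: "(\<lambda>l. real_of_int \<lfloor>2 ^ l * t\<rfloor> / 2 ^ l) \<longlonglongrightarrow> (t::real)"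
proof (rule tendsto_sandwich)
  have "(\<lambda>l. t - (1/2) ^ l) \<longlonglongrightarrow> t - 0"
    by (intro tendsto_intros LIMSEQ_power_zero) auto
  then show "(\<lambda>l. t - (1/2) ^ l) \<longlonglongrightarrow> t" by simp
  show "\<forall>\<^sub>F l in sequentially. t - (1/2) ^ l \<le> real_of_int \<lfloor>2 ^ l * t\<rfloor> / 2 ^ l"
  proof (intro always_eventually allI)
    fix l
    have "(t - (1/2) ^ l) * 2 ^ l = 2 ^ l * t - 1"
      by (simp add: left_diff_distrib power_divide)
    also have "\<dots> \<le> real_of_int \<lfloor>2 ^ l * t\<rfloor>"
      using floor_correct[of "2 ^ l * t"] by linarith
    finally show "t - (1/2) ^ l \<le> real_of_int \<lfloor>2 ^ l * t\<rfloor> / 2 ^ l" by (simp add: pos_le_divide_eq)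
  qed
  show "\<forall>\<^sub>F l in sequentially. real_of_int \<lfloor>2 ^ l * t\<rfloor> / 2 ^ l \<le> t"
    using floor_correct[of "2 ^ _ * t"] by (intro always_eventually allI) (simp add: pos_divide_le_eq mult.commute)
qed auto

section \<open>Extension of the limit from dyadic to all times\<close>

context matrix_tower
begin

theorem ex_orth_bm: "\<exists>G. orth_bm M (G :: real \<Rightarrow> 'w \<Rightarrow> real ^ 'n ^ 'n)"
proof -
  let ?inc = "\<lambda>\<omega>. \<forall>i j N. \<exists>l0. \<forall>l\<ge>l0. \<forall>k<N * 2 ^ l.
     \<bar>g (real (k + 1) / 2 ^ l) \<omega> $ i $ j - g (real k / 2 ^ l) \<omega> $ i $ j\<bar> \<le> (7/8) ^ l"
  have "AE \<omega> in M. \<forall>d\<in>dyadic_times. orthogonal_matrix (g d \<omega>)"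
    using g_orthogonal by (subst AE_ball_countable[OF countable_dyadics]) auto
  with g_increments_small have "AE \<omega> in M. ?inc \<omega> \<and> (\<forall>d\<in>dyadic_times. orthogonal_matrix (g d \<omega>))"
    by eventually_elim blast
  \<comment> \<open>All exceptional events are collected in one measurable null set.\<close>
  from AE_E[OF this] obtain N0 where N0: "{\<omega> \<in> space M. \<not> (?inc \<omega> \<and> (\<forall>d\<in>dyadic_times. orthogonal_matrix (g d \<omega>)))} \<subseteq> N0"
    "emeasure M N0 = 0" "N0 \<in> sets M" by blast
  have notN: "AE \<omega> in M. \<omega> \<notin> N0" using N0 by (intro AE_not_in) (auto simp: null_sets_def)
  define q where "q l t = real_of_int \<lfloor>2 ^ l * t\<rfloor> / 2 ^ l" for l and t :: real
  \<comment> \<open>On the null set the process rests at the identity, so that continuity and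
    orthogonality hold for every sample point.\<close>
  define G where "G t \<omega> = (if \<omega> \<in> N0 then mat 1 else \<chi> i j. lim (\<lambda>l. g (q l t) \<omega> $ i $ j))" for t \<omega>
  have q_lim: "(\<lambda>l. q l t) \<longlonglongrightarrow> t" for t unfolding q_def by (rule tendsto_dyadic_floor)
  have q_D: "q l t \<in> dyadic_times" if "0 \<le> t" for l t unfolding q_def using that by (rule dyadic_times_floor)
  have q_mono: "q l u \<le> q l s" if "u \<le> s" for l u s
    unfolding q_def using that by (intro divide_right_mono) (auto intro!: floor_mono)
  have G_m[measurable]: "G t \<in> borel_measurable M" for t
    using N0(3) unfolding G_def by measurable
  have good: "?inc \<omega>" "d \<in> dyadic_times \<Longrightarrow> orthogonal_matrix (g d \<omega>)" if "\<omega> \<in> space M" "\<omega> \<notin> N0" for \<omega> d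
    using that N0(1) by blast+
  have chain: "(\<forall>t\<ge>0. convergent (\<lambda>l. g (q l t) \<omega> $ i $ j)) \<and> continuous_on {0..} (\<lambda>t. lim (\<lambda>l. g (q l t) \<omega> $ i $ j))"
    if "\<omega> \<in> space M" "\<omega> \<notin> N0" for \<omega> i j
  proof -
    have inc: "\<exists>l0. \<forall>l\<ge>l0. \<forall>k<N * 2 ^ l. \<bar>g (real (k + 1) / 2 ^ l) \<omega> $ i $ j - g (real k / 2 ^ l) \<omega> $ i $ j\<bar> \<le> (7/8) ^ l" for N
      using good(1)[OF that] by blast
    show ?thesis
      using dyadic_chain_continuous[of "\<lambda>t. g t \<omega> $ i $ j" "7/8", OF inc] unfolding q_def by simp
  qed
  have G_cont: "continuous_on {0..} (\<lambda>t. G t \<omega>)" if "\<omega> \<in> space M" for \<omega>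
    using chain[OF that] unfolding G_def by (cases "\<omega> \<in> N0") (auto intro!: continuous_on_vec_lambda)
  have lim_G: "(\<lambda>l. g (q l t) \<omega>) \<longlonglongrightarrow> G t \<omega>" if "\<omega> \<in> space M" "\<omega> \<notin> N0" "0 \<le> t" for \<omega> t
    using chain[OF that(1,2)] that by (intro vec_tendstoI) (simp add: G_def convergent_LIMSEQ_iff)
  \<comment> \<open>At a dyadic time the roundings are eventually the time itself, so the extension
    does not alter the process there and inherits its moments.\<close>
  have G_D: "G d \<omega> = g d \<omega>" if A: "\<omega> \<in> space M" "\<omega> \<notin> N0" "d \<in> dyadic_times" for \<omega> d
  proof -
    obtain l where l: "\<And>m. l \<le> m \<Longrightarrow> real (nat \<lfloor>2 ^ m * d\<rfloor>) = 2 ^ m * d"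
      using dyadic_level[OF A(3)] by blast
    have "q m d = d" if "l \<le> m" for m
    proof -
      have "real_of_int \<lfloor>2 ^ m * d\<rfloor> = real (nat \<lfloor>2 ^ m * d\<rfloor>)"
        using dyadic_times_nonneg[OF A(3)] by simp
      also have "\<dots> = 2 ^ m * d" by (rule l[OF that])
      finally have e: "real_of_int \<lfloor>2 ^ m * d\<rfloor> = 2 ^ m * d" .
      show ?thesis unfolding q_def e by simp
    qed
    then have "\<forall>\<^sub>F m in sequentially. g d \<omega> = g (q m d) \<omega>"
      unfolding eventually_sequentially by (metis)
    from Lim_transform_eventually[OF tendsto_const this] lim_G[OF A(1,2) dyadic_times_nonneg[OF A(3)]]
    show ?thesis by (metis LIMSEQ_unique)
  qed
  have G_0: "G 0 \<omega> = mat 1" if "\<omega> \<in> space M" for \<omega>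
  proof (cases "\<omega> \<in> N0")
    case False
    have "U m 0 \<omega> = mat 1" for m by (simp add: U_def L.V_def)
    then have "g 0 \<omega> = mat 1" by (simp add: g_def vec_eq_iff)
    then show ?thesis using G_D[OF that False, of 0] dyadic_times_real[of 0 0] by simp
  qed (simp add: G_def)
  have G_orth: "orthogonal_matrix (G t \<omega>)" if "\<omega> \<in> space M" "0 \<le> t" for \<omega> t
  proof (cases "\<omega> \<in> N0")
    case True
    then show ?thesis by (simp add: G_def orthogonal_matrix_id)
  next
    case False
    have "G t \<omega> \<in> {A. orthogonal_matrix A}"
      by (rule Lim_in_closed_set[OF closed_orthogonal_matrices _ _ lim_G[OF that(1) False that(2)]])
         (auto intro!: always_eventually good(2)[OF that(1) False] q_D that)
    then show ?thesis by simp
  qed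
  have G_lim: "(\<lambda>l. G (a l) \<omega>) \<longlonglongrightarrow> G b \<omega>" if "\<omega> \<in> space M" "a \<longlonglongrightarrow> b" "\<And>l. 0 \<le> a l" "0 \<le> b" for \<omega> a b
    by (rule continuous_on_tendsto_compose[OF G_cont[OF that(1)] that(2)]) (use that in auto)
  have q0: "0 \<le> q l t" if "0 \<le> t" for l t using that by (simp add: q_def)
  have AE_G: "AE \<omega> in M. G d \<omega> = g d \<omega>" if "d \<in> dyadic_times" for d
    using notN AE_space by eventually_elim (use that G_D in blast)
  have G_mv_lim: "(\<lambda>l. u \<bullet> (G (q l t) \<omega> *v z)) \<longlonglongrightarrow> u \<bullet> (G t \<omega> *v z)" if "\<omega> \<in> space M" "0 \<le> t" for \<omega> t u z
    unfolding matrix_vector_mult_def using G_lim[OF that(1) q_lim, of t] q0 that by (intro tendsto_intros) auto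
  have G_mv_bd: "\<bar>u \<bullet> (G t \<omega> *v z)\<bar> \<le> norm u * norm z" if "\<omega> \<in> space M" "0 \<le> t" for \<omega> t u z
    using Cauchy_Schwarz_ineq2[of u "G t \<omega> *v z"] orthogonal_matrix_norm[OF G_orth[OF that]] by simp
  show ?thesis
  proof (intro exI[of _ G], unfold_locales)
    show "G t \<in> borel_measurable M" for t by (rule G_m)
    show "continuous_on {0..} (\<lambda>t. G t \<omega>)" if "\<omega> \<in> space M" for \<omega> by (rule G_cont[OF that])
    show "G 0 \<omega> = mat 1" if "\<omega> \<in> space M" for \<omega> by (rule G_0[OF that])
    show "orthogonal_matrix (G t \<omega>)" if "\<omega> \<in> space M" "0 \<le> t" for \<omega> t by (rule G_orth[OF that])
  next
    fix t :: real and u z :: "real ^ 'n" assume t: "0 \<le> t"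
    have "(\<lambda>l. \<integral>\<omega>. u \<bullet> (G (q l t) \<omega> *v z) \<partial>M) \<longlonglongrightarrow> (\<integral>\<omega>. u \<bullet> (G t \<omega> *v z) \<partial>M)"
      by (rule integral_dominated_convergence[where w="\<lambda>_. norm u * norm z"])
         (use t AE_space in \<open>auto intro!: AE_I2 G_mv_lim G_mv_bd q0\<close>)
    moreover have "(\<integral>\<omega>. u \<bullet> (G (q l t) \<omega> *v z) \<partial>M) = exp (- (real CARD('n) - 1) * q l t / 2) * (u \<bullet> z)" for l
    proof -
      have "(\<integral>\<omega>. u \<bullet> (G (q l t) \<omega> *v z) \<partial>M) = (\<integral>\<omega>. u \<bullet> (g (q l t) \<omega> *v z) \<partial>M)"
        using AE_G[OF q_D[OF t, of l]] by (intro integral_cong_AE) auto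
      then show ?thesis by (simp add: g_moments_dyadic(1)[OF q_D[OF t]] L.c_def)
    qed
    moreover have "(\<lambda>l. exp (- (real CARD('n) - 1) * q l t / 2) * (u \<bullet> z)) \<longlonglongrightarrow> exp (- (real CARD('n) - 1) * t / 2) * (u \<bullet> z)"
      by (intro tendsto_intros q_lim) auto
    ultimately show "(\<integral>\<omega>. u \<bullet> (G t \<omega> *v z) \<partial>M) = exp (- (real CARD('n) - 1) * t / 2) * (u \<bullet> z)"
      using LIMSEQ_unique by simp
    let ?c = "\<lambda>t. (norm u)\<^sup>2 * (norm z)\<^sup>2 / real CARD('n)
      + exp (- real CARD('n) * t) * ((u \<bullet> z)\<^sup>2 - (norm u)\<^sup>2 * (norm z)\<^sup>2 / real CARD('n))"
    have "(\<lambda>l. \<integral>\<omega>. (u \<bullet> (G (q l t) \<omega> *v z))\<^sup>2 \<partial>M) \<longlonglongrightarrow> (\<integral>\<omega>. (u \<bullet> (G t \<omega> *v z))\<^sup>2 \<partial>M)"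
    proof (rule integral_dominated_convergence[where w="\<lambda>_. (norm u * norm z)\<^sup>2"])
      show "AE \<omega> in M. norm ((u \<bullet> (G (q l t) \<omega> *v z))\<^sup>2) \<le> (norm u * norm z)\<^sup>2" for l
        using AE_space
      proof eventually_elim
        case (elim \<omega>)
        from power_mono[OF G_mv_bd[OF elim q0[OF t]] abs_ge_zero, of u l z 2] show ?case by simp
      qed
    qed (use t in \<open>auto intro!: AE_I2 tendsto_power G_mv_lim\<close>)
    moreover have "(\<integral>\<omega>. (u \<bullet> (G (q l t) \<omega> *v z))\<^sup>2 \<partial>M) = ?c (q l t)" for l
    proof -
      have "(\<integral>\<omega>. (u \<bullet> (G (q l t) \<omega> *v z))\<^sup>2 \<partial>M) = (\<integral>\<omega>. (u \<bullet> (g (q l t) \<omega> *v z))\<^sup>2 \<partial>M)"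
        using AE_G[OF q_D[OF t, of l]] by (intro integral_cong_AE) auto
      then show ?thesis by (simp add: g_moments_dyadic(2)[OF q_D[OF t]])
    qed
    moreover have "(\<lambda>l. ?c (q l t)) \<longlonglongrightarrow> ?c t"
      by (intro tendsto_intros q_lim)
    ultimately show "(\<integral>\<omega>. (u \<bullet> (G t \<omega> *v z))\<^sup>2 \<partial>M) = ?c t"
      using LIMSEQ_unique by simp
  next
    fix s t :: real and I :: "real set" and f :: "real ^ 'n ^ 'n \<Rightarrow> real" and K :: real and \<phi> :: "real \<Rightarrow> real ^ 'n ^ 'n \<Rightarrow> real"
    assume s: "0 \<le> s" and t: "0 \<le> t" and I: "finite I" "I \<subseteq> {0..s}"
      and f: "continuous_on UNIV f" and fb: "\<And>A. \<bar>f A\<bar> \<le> K"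
      and \<phi>: "\<And>u. continuous_on UNIV (\<phi> u)" and \<phi>b: "\<And>u A. \<bar>\<phi> u A\<bar> \<le> 1"
    note [measurable] = measurable_compose[OF _ borel_measurable_continuous_onI[OF f]] measurable_compose[OF _ borel_measurable_continuous_onI[OF \<phi>]]
    have K: "0 \<le> K" using fb[of 0] by linarith
    have prod_le: "\<bar>\<Prod>u\<in>I. \<phi> u (A u)\<bar> \<le> 1" for A
      unfolding abs_prod by (intro prod_le_1) (auto simp: \<phi>b)
    have bd: "\<bar>x * y\<bar> \<le> K" if "\<bar>x\<bar> \<le> K" "\<bar>y\<bar> \<le> 1" for x y :: real
      using mult_mono[OF that K] by (simp add: abs_mult)
    have prod_lim: "(\<lambda>l. \<Prod>u\<in>I. \<phi> u (G (q l u) \<omega>)) \<longlonglongrightarrow> (\<Prod>u\<in>I. \<phi> u (G u \<omega>))" if "\<omega> \<in> space M" for \<omega>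
      using I that by (intro tendsto_prod continuous_on_tendsto_compose[OF \<phi>] G_lim q_lim) (auto intro!: q0)
    have f_lim: "(\<lambda>m. f (A m)) \<longlonglongrightarrow> f A'" if "A \<longlonglongrightarrow> A'" for A A'
      using continuous_on_tendsto_compose[OF f that] by simp
    define R where "R l \<omega> = (\<integral>\<omega>'. f (G (q l t) \<omega>' ** G (q l s) \<omega>) \<partial>M)" for l \<omega>
    define R' where "R' \<omega> = (\<integral>\<omega>'. f (G t \<omega>' ** G s \<omega>) \<partial>M)" for \<omega>
    have [measurable]: "R l \<in> borel_measurable M" for l unfolding R_def by measurable
    have [measurable]: "R' \<in> borel_measurable M" unfolding R'_def by measurable
    have Rb: "\<bar>R m \<omega>\<bar> \<le> K" if "\<omega> \<in> space M" for m \<omega>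
    proof -
      have "\<bar>R m \<omega>\<bar> \<le> (\<integral>\<omega>'. \<bar>f (G (q m t) \<omega>' ** G (q m s) \<omega>)\<bar> \<partial>M)"
        unfolding R_def by (rule integral_abs_bound)
      also have "\<dots> \<le> (\<integral>\<omega>'. K \<partial>M)"
        using that K by (intro integral_mono integrable_abs integrable_const_bound[of _ K]) (auto simp: fb)
      finally show ?thesis by (simp add: prob_space)
    qed
    \<comment> \<open>The later time is \<open>q l s + q l t\<close>, since the rounding of
      \<open>s + t\<close> need not be that sum. It is dyadic and tends to
      \<open>s + t\<close>.\<close>
    have step: "(\<integral>\<omega>. f (G (q l s + q l t) \<omega>) * (\<Prod>u\<in>I. \<phi> u (G (q l u) \<omega>)) \<partial>M)
      = (\<integral>\<omega>. R l \<omega> * (\<Prod>u\<in>I. \<phi> u (G (q l u) \<omega>)) \<partial>M)" for l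
    proof -
      have aeI: "AE \<omega> in M. \<forall>u\<in>I. G (q l u) \<omega> = g (q l u) \<omega>"
        using I by (intro AE_finite_allI AE_G q_D) auto
      have "(\<integral>\<omega>. f (G (q l s + q l t) \<omega>) * (\<Prod>u\<in>I. \<phi> u (G (q l u) \<omega>)) \<partial>M)
        = (\<integral>\<omega>. f (g (q l s + q l t) \<omega>) * (\<Prod>u\<in>I. \<phi> u (g (q l u) \<omega>)) \<partial>M)"
      proof (rule integral_cong_AE)
        show "AE \<omega> in M. f (G (q l s + q l t) \<omega>) * (\<Prod>u\<in>I. \<phi> u (G (q l u) \<omega>))
          = f (g (q l s + q l t) \<omega>) * (\<Prod>u\<in>I. \<phi> u (g (q l u) \<omega>))"
          using aeI AE_G[OF dyadic_times_add[OF q_D[OF s, of l] q_D[OF t, of l]]] by eventually_elim simp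
      qed measurable
      also have "\<dots> = (\<integral>\<omega>. (\<integral>\<omega>'. f (g (q l t) \<omega>' ** g (q l s) \<omega>) \<partial>M) * (\<Prod>u\<in>I. \<phi> u (g (q l u) \<omega>)) \<partial>M)"
      proof (rule markov_dyadic[OF q_D[OF s] q_D[OF t] I(1) _ _ _ fb \<phi> \<phi>b])
        show "continuous_on UNIV (\<lambda>p. f (fst p))"
          by (rule continuous_on_compose2[OF f]) (auto intro: continuous_intros)
      qed (use I in \<open>auto intro!: q_D q_mono\<close>)
      also have "\<dots> = (\<integral>\<omega>. R l \<omega> * (\<Prod>u\<in>I. \<phi> u (G (q l u) \<omega>)) \<partial>M)"
      proof (rule integral_cong_AE)
        show "AE \<omega> in M. (\<integral>\<omega>'. f (g (q l t) \<omega>' ** g (q l s) \<omega>) \<partial>M) * (\<Prod>u\<in>I. \<phi> u (g (q l u) \<omega>))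
          = R l \<omega> * (\<Prod>u\<in>I. \<phi> u (G (q l u) \<omega>))"
          using aeI AE_G[OF q_D[OF s, of l]] AE_space
        proof eventually_elim
          case (elim \<omega>)
          have "(\<integral>\<omega>'. f (g (q l t) \<omega>' ** g (q l s) \<omega>) \<partial>M) = R l \<omega>"
            unfolding R_def
          proof (rule integral_cong_AE)
            show "AE \<omega>' in M. f (g (q l t) \<omega>' ** g (q l s) \<omega>) = f (G (q l t) \<omega>' ** G (q l s) \<omega>)"
              using AE_G[OF q_D[OF t, of l]] by eventually_elim (simp add: elim)
          qed (use elim in measurable)
          then show ?case using elim by simp
        qed
      qed measurable
      finally show ?thesis .
    qed
    have "(\<lambda>l. \<integral>\<omega>. f (G (q l s + q l t) \<omega>) * (\<Prod>u\<in>I. \<phi> u (G (q l u) \<omega>)) \<partial>M)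
       \<longlonglongrightarrow> (\<integral>\<omega>. f (G (s + t) \<omega>) * (\<Prod>u\<in>I. \<phi> u (G u \<omega>)) \<partial>M)"
      by (rule integral_dominated_convergence[where w="\<lambda>_. K"])
         (use s t in \<open>auto intro!: AE_I2 tendsto_mult f_lim prod_lim G_lim tendsto_add q_lim bd fb prod_le add_nonneg_nonneg q0\<close>)
    moreover have "(\<lambda>l. \<integral>\<omega>. R l \<omega> * (\<Prod>u\<in>I. \<phi> u (G (q l u) \<omega>)) \<partial>M) \<longlonglongrightarrow> (\<integral>\<omega>. R' \<omega> * (\<Prod>u\<in>I. \<phi> u (G u \<omega>)) \<partial>M)"
    proof (rule integral_dominated_convergence[where w="\<lambda>_. K"])
      show "AE \<omega> in M. (\<lambda>l. R l \<omega> * (\<Prod>u\<in>I. \<phi> u (G (q l u) \<omega>))) \<longlonglongrightarrow> R' \<omega> * (\<Prod>u\<in>I. \<phi> u (G u \<omega>))"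
        using AE_space
      proof eventually_elim
        case (elim \<omega>)
        have "(\<lambda>l. R l \<omega>) \<longlonglongrightarrow> R' \<omega>"
          unfolding R_def R'_def
        proof (rule integral_dominated_convergence[where w="\<lambda>_. K"])
          show "AE \<omega>' in M. (\<lambda>l. f (G (q l t) \<omega>' ** G (q l s) \<omega>)) \<longlonglongrightarrow> f (G t \<omega>' ** G s \<omega>)"
            using AE_space
          proof eventually_elim
            case (elim \<omega>')
            have "(\<lambda>l. G (q l t) \<omega>' ** G (q l s) \<omega>) \<longlonglongrightarrow> G t \<omega>' ** G s \<omega>"
              unfolding matrix_matrix_mult_def
              using G_lim[OF elim q_lim q0[OF t] t] G_lim[OF \<open>\<omega> \<in> space M\<close> q_lim q0[OF s] s] by (intro tendsto_intros)
            then show ?case by (rule f_lim)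
          qed
        qed (auto simp: fb elim)
        with prod_lim[OF elim] show ?case by (intro tendsto_mult)
      qed
      show "AE \<omega> in M. norm (R l \<omega> * (\<Prod>u\<in>I. \<phi> u (G (q l u) \<omega>))) \<le> K" for l
        using AE_space by eventually_elim (auto intro!: bd Rb prod_le)
    qed auto
    ultimately show "(\<integral>\<omega>. f (G (s + t) \<omega>) * (\<Prod>u\<in>I. \<phi> u (G u \<omega>)) \<partial>M)
      = (\<integral>\<omega>. (\<integral>\<omega>'. f (G t \<omega>' ** G s \<omega>) \<partial>M) * (\<Prod>u\<in>I. \<phi> u (G u \<omega>)) \<partial>M)"
      unfolding step R'_def[symmetric] by (rule LIMSEQ_unique)
  qed
qed

end

section \<open>Continuous test functions\<close>

text \<open>The empty set is separate because \<open>infdist\<close> to it is 0 by convention, which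
  would give the constant 1 instead of 0.\<close>

definition closed_approx :: "'a::metric_space set \<Rightarrow> nat \<Rightarrow> 'a \<Rightarrow> real" where
  "closed_approx C k x = (if C = {} then 0 else max 0 (1 - real k * infdist x C))"

lemma closed_approx_continuous: "continuous_on UNIV (closed_approx C k)"
  unfolding closed_approx_def by (cases "C = {}") (auto intro!: continuous_intros)

lemma closed_approx_bounds: "0 \<le> closed_approx C k x" "closed_approx C k x \<le> 1"
  by (auto simp: closed_approx_def infdist_nonneg)

lemma closed_approx_tendsto:
  assumes "closed C" shows "(\<lambda>k. closed_approx C k x) \<longlonglongrightarrow> indicator C x"
proof (cases "x \<in> C")
  case True
  then have "closed_approx C k x = 1" for k by (auto simp: closed_approx_def)
  with True show ?thesis by simp
next
  case False
  show ?thesis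
  proof (cases "C = {}")
    case ne: False
    with False assms have pos: "0 < infdist x C"
      using in_closed_iff_infdist_zero[of C x] infdist_nonneg[of x C] by fastforce
    obtain n where n: "1 / infdist x C < real n" using reals_Archimedean2 by blast
    have "closed_approx C k x = 0" if "n \<le> k" for k
    proof -
      have "1 < real n * infdist x C" using n pos by (simp add: pos_divide_less_eq)
      also have "\<dots> \<le> real k * infdist x C" using that pos by (intro mult_right_mono) auto
      finally show ?thesis by (simp add: closed_approx_def)
    qed
    then have "\<forall>\<^sub>F k in sequentially. 0 = closed_approx C k x"
      unfolding eventually_sequentially by metis
    from Lim_transform_eventually[OF tendsto_const this] False show ?thesis by simp
  qed (simp add: closed_approx_def)
qed

lemma sigma_closed: "sigma_sets UNIV {S::'a::topological_space set. closed S} = sets borel"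
proof
  show "sigma_sets UNIV {S::'a set. closed S} \<subseteq> sets borel"
    by (intro sets.sigma_sets_subset') auto
  have "open S \<Longrightarrow> S \<in> sigma_sets UNIV {S::'a set. closed S}" for S
    using sigma_sets.Compl[of "- S" UNIV "{S. closed S}"] sigma_sets.Basic[of "- S" "{S. closed S}" UNIV]
    by (auto simp: Compl_eq_Diff_UNIV[symmetric])
  then have "{S. open S} \<subseteq> sigma_sets UNIV {S::'a set. closed S}" by auto
  moreover have "sets borel = sigma_sets UNIV {S::'a set. open S}"
    unfolding borel_def by (rule sets_measure_of) simp
  ultimately show "sets borel \<subseteq> sigma_sets UNIV {S::'a set. closed S}"
    by (metis sigma_sets_mono)
qed

text \<open>Closed sets form an intersection-stable generator, and their indicators are limits of
  the continuous functions \<open>closed_approx\<close>.\<close>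

lemma measure_eqI_continuous:
  fixes N1 N2 :: "'a::metric_space measure"
  assumes "finite_measure N1" "finite_measure N2" and s: "sets N1 = sets borel" "sets N2 = sets borel"
    and eq: "\<And>h :: 'a \<Rightarrow> real. continuous_on UNIV h \<Longrightarrow> (\<And>x. 0 \<le> h x) \<Longrightarrow> (\<And>x. h x \<le> 1) \<Longrightarrow>
      (\<integral>\<^sup>+x. ennreal (h x) \<partial>N1) = (\<integral>\<^sup>+x. ennreal (h x) \<partial>N2)"
  shows "N1 = N2"
proof -
  interpret N1: finite_measure N1 by fact
  interpret N2: finite_measure N2 by fact
  have em: "(\<lambda>k. \<integral>\<^sup>+x. ennreal (closed_approx C k x) \<partial>N) \<longlonglongrightarrow> emeasure N C"
    if "finite_measure N" and sN: "sets N = sets borel" and C: "closed C" for N and C :: "'a set"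
  proof -
    interpret finite_measure N by fact
    have [measurable]: "C \<in> sets N" using C by (simp add: sN)
    have [measurable]: "closed_approx C k \<in> borel_measurable N" for k
      using borel_measurable_continuous_onI[OF closed_approx_continuous, of C k] by (simp add: sN cong: measurable_cong_sets)
    have "(\<lambda>k. \<integral>\<^sup>+x. ennreal (closed_approx C k x) \<partial>N) \<longlonglongrightarrow> (\<integral>\<^sup>+x. ennreal (indicator C x) \<partial>N)"
    proof (rule nn_integral_dominated_convergence[where w="\<lambda>_. 1"])
      show "(\<integral>\<^sup>+x. 1 \<partial>N) < \<infinity>" using emeasure_finite[of "space N"] by (simp add: less_top[symmetric])
    qed (auto simp: closed_approx_bounds intro!: tendsto_ennrealI closed_approx_tendsto C)
    then show ?thesis by (simp add: ennreal_indicator)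
  qed
  show ?thesis
  proof (rule measure_eqI_generator_eq)
    show "Int_stable {S::'a set. closed S}" by (auto simp: Int_stable_def)
    show "{S::'a set. closed S} \<subseteq> Pow UNIV" by simp
    show "sets N1 = sigma_sets UNIV {S. closed S}" "sets N2 = sigma_sets UNIV {S. closed S}"
      by (simp_all add: s sigma_closed)
    show "range (\<lambda>_::nat. UNIV :: 'a set) \<subseteq> {S. closed S}" by auto
    show "emeasure N1 UNIV \<noteq> \<infinity>" unfolding infinity_ennreal_def by (rule N1.emeasure_finite)
    fix C :: "'a set" assume "C \<in> {S. closed S}"
    then have C: "closed C" by simp
    have "(\<integral>\<^sup>+x. ennreal (closed_approx C k x) \<partial>N1) = (\<integral>\<^sup>+x. ennreal (closed_approx C k x) \<partial>N2)" for k
      by (intro eq closed_approx_continuous closed_approx_bounds)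
    with em[OF assms(1) s(1) C] em[OF assms(2) s(2) C] show "emeasure N1 C = emeasure N2 C"
      by (simp only: LIMSEQ_unique)
  next
    show "(\<Union>i::nat. UNIV) = (UNIV :: 'a set)" by blast
  qed
qed

section \<open>Evaluation of a continuous process at a random time\<close>

text \<open>Rounding gives random times with countably many values, and continuity passes to the
  limit. \<open>N\<close> is arbitrary since the lemma is also applied to a member of a
  filtration.\<close>

lemma measurable_random_time:
  fixes X :: "real \<Rightarrow> 'w \<Rightarrow> 'b::metric_space"
  assumes cont: "\<And>\<omega>. \<omega> \<in> space N \<Longrightarrow> continuous_on {0..} (\<lambda>t. X t \<omega>)"
    and X: "\<And>t. 0 \<le> t \<Longrightarrow> X t \<in> borel_measurable N"
    and \<tau>[measurable]: "\<tau> \<in> borel_measurable N" and \<tau>0: "\<And>\<omega>. \<omega> \<in> space N \<Longrightarrow> 0 \<le> \<tau> \<omega>"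
  shows "(\<lambda>\<omega>. X (\<tau> \<omega>) \<omega>) \<in> borel_measurable N"
proof -
  define q where "q j \<omega> = real_of_int \<lceil>2 ^ j * \<tau> \<omega>\<rceil> / 2 ^ j" for j :: nat and \<omega>
  have q0: "0 \<le> q j \<omega>" if "\<omega> \<in> space N" for j \<omega>
  proof -
    have "0 \<le> 2 ^ j * \<tau> \<omega>" using \<tau>0[OF that] by simp
    then have "0 \<le> real_of_int \<lceil>2 ^ j * \<tau> \<omega>\<rceil>" by linarith
    then show ?thesis by (simp add: q_def)
  qed
  have q_lim: "(\<lambda>j. q j \<omega>) \<longlonglongrightarrow> \<tau> \<omega>" for \<omega>
    using tendsto_minus[OF tendsto_dyadic_floor[of "- \<tau> \<omega>"]] by (simp add: q_def ceiling_def)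
  \<comment> \<open>The countable composition runs over all integers, while \<open>X\<close> is
    controlled at nonnegative times only; \<open>max 0\<close> covers the negative ones.\<close>
  have "(\<lambda>\<omega>. X (max 0 (real_of_int \<lceil>2 ^ j * \<tau> \<omega>\<rceil> / 2 ^ j)) \<omega>) \<in> borel_measurable N" for j :: nat
    by (rule measurable_compose_countable[of "\<lambda>i \<omega>. X (max 0 (real_of_int i / 2 ^ j)) \<omega>"]) (auto intro!: X)
  then have m: "(\<lambda>\<omega>. X (max 0 (q j \<omega>)) \<omega>) \<in> borel_measurable N" for j by (simp add: q_def)
  show ?thesis
  proof (rule borel_measurable_LIMSEQ_metric[OF m])
    fix \<omega> assume \<omega>: "\<omega> \<in> space N"
    have "(\<lambda>j. X (q j \<omega>) \<omega>) \<longlonglongrightarrow> X (\<tau> \<omega>) \<omega>"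
      by (rule continuous_on_tendsto_compose[OF cont[OF \<omega>] q_lim]) (use \<tau>0 q0 \<omega> in auto)
    then show "(\<lambda>j. X (max 0 (q j \<omega>)) \<omega>) \<longlonglongrightarrow> X (\<tau> \<omega>) \<omega>"
      using q0[OF \<omega>] by (simp add: max_def)
  qed
qed

section \<open>Natural filtrations\<close>

lemma space_natural_filtration[simp]: "space (natural_filtration M X t) = space M"
  unfolding natural_filtration_def by (rule space_measure_of) auto

lemma natural_filtration_mono: "s \<le> t \<Longrightarrow> sets (natural_filtration M X s) \<subseteq> sets (natural_filtration M X t)"
  using filtration.sets_F_mono[OF filtration_natural_filtration] .

lemma sets_natural_filtration:
  "sets (natural_filtration M X t) = sigma_sets (space M)
       {X s -` A \<inter> space M | s A. 0 \<le> s \<and> ennreal s \<le> t \<and> A \<in> sets borel}"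
  unfolding natural_filtration_def by (rule sets_measure_of) auto

lemma measurable_natural_filtration:
  assumes "0 \<le> s" "ennreal s \<le> t"
  shows "X s \<in> borel_measurable (natural_filtration M X t)"
  by (rule measurableI) (use assms in \<open>auto simp: sets_natural_filtration intro!: sigma_sets.Basic\<close>)

lemma sets_natural_filtration_le:
  assumes sp: "space N = space M" and X: "\<And>s. 0 \<le> s \<Longrightarrow> ennreal s \<le> t \<Longrightarrow> X s \<in> borel_measurable N"
  shows "sets (natural_filtration M X t) \<subseteq> sets N"
  unfolding sets_natural_filtration sp[symmetric]
  by (rule sets.sigma_sets_subset) (auto intro: measurable_sets[OF X])

text \<open>Cylinders over closed sets: intersection-stable, and approximable by the finite products
  of continuous functions in \<open>G_markov\<close>.\<close>

lemma sets_natural_filtration_cylinders: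
  fixes M :: "'w measure" and X :: "real \<Rightarrow> 'w \<Rightarrow> 'a::topological_space"
  assumes s: "0 \<le> s"
  defines "E \<equiv> {{\<omega>\<in>space M. \<forall>u\<in>I. X u \<omega> \<in> C u} | I C. finite I \<and> I \<subseteq> {0..s} \<and> (\<forall>u. closed (C u))}"
  shows "sets (natural_filtration M X (ennreal s)) = sigma_sets (space M) E" and "Int_stable E"
proof -
  show "Int_stable E"
  proof (rule Int_stableI)
    fix a b assume "a \<in> E" "b \<in> E"
    then obtain I C J D where a: "a = {\<omega>\<in>space M. \<forall>u\<in>I. X u \<omega> \<in> C u}" "finite I" "I \<subseteq> {0..s}" "\<forall>u. closed (C u)"
      and b: "b = {\<omega>\<in>space M. \<forall>u\<in>J. X u \<omega> \<in> D u}" "finite J" "J \<subseteq> {0..s}" "\<forall>u. closed (D u)"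
      unfolding E_def by blast
    have "a \<inter> b = {\<omega>\<in>space M. \<forall>u\<in>I \<union> J. X u \<omega> \<in> (if u \<in> I then C u else UNIV) \<inter> (if u \<in> J then D u else UNIV)}"
      unfolding a b by auto
    then show "a \<inter> b \<in> E"
      unfolding E_def using a b
      by (auto intro!: exI[of _ "I \<union> J"] exI[of _ "\<lambda>u. (if u \<in> I then C u else UNIV) \<inter> (if u \<in> J then D u else UNIV)"])
  qed
  have E: "E \<subseteq> Pow (space M)" unfolding E_def by auto
  let ?N = "sigma (space M) E"
  show "sets (natural_filtration M X (ennreal s)) = sigma_sets (space M) E"
  proof
    have "X u \<in> borel_measurable ?N" if u: "0 \<le> u" "ennreal u \<le> ennreal s" for u
    proof -
      have "X u \<in> measurable ?N (sigma UNIV {S. closed S})"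
      proof (rule measurable_measure_of)
        fix C :: "'a set" assume "C \<in> {S. closed S}"
        then have "X u -` C \<inter> space M \<in> E"
          unfolding E_def using u s by (intro CollectI exI[of _ "{u}"] exI[of _ "\<lambda>_. C"]) auto
        then show "X u -` C \<inter> space ?N \<in> sets ?N" using E by auto
      qed auto
      moreover have "sets (sigma UNIV {S::'a set. closed S}) = sets borel" by (simp add: sigma_closed)
      ultimately show ?thesis by (simp cong: measurable_cong_sets)
    qed
    then have "sets (natural_filtration M X (ennreal s)) \<subseteq> sets ?N"
      using E by (intro sets_natural_filtration_le) auto
    then show "sets (natural_filtration M X (ennreal s)) \<subseteq> sigma_sets (space M) E" using E by simp
    have "E \<subseteq> sets (natural_filtration M X (ennreal s))"
    proof
      fix a assume "a \<in> E"
      then obtain I C where a: "a = {\<omega>\<in>space M. \<forall>u\<in>I. X u \<omega> \<in> C u}" "finite I" "I \<subseteq> {0..s}" "\<forall>u. closed (C u)"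
        unfolding E_def by blast
      have [measurable]: "X u \<in> borel_measurable (natural_filtration M X (ennreal s))" if "u \<in> I" for u
        using that a by (intro measurable_natural_filtration) (auto simp: ennreal_leI)
      have [measurable]: "C u \<in> sets borel" for u using a by auto
      have "{\<omega>\<in>space (natural_filtration M X (ennreal s)). \<forall>u\<in>I. X u \<omega> \<in> C u} \<in> sets (natural_filtration M X (ennreal s))"
      proof (cases "I = {}")
        case False
        with a(2) show ?thesis
          by (intro sets.sets_Collect_finite_All') (auto simp del: space_natural_filtration)
      qed (simp del: space_natural_filtration)
      then show "a \<in> sets (natural_filtration M X (ennreal s))" by (simp add: a)
    qed
    then show "sigma_sets (space M) E \<subseteq> sets (natural_filtration M X (ennreal s))"
      using sets.sigma_sets_subset[of E "natural_filtration M X (ennreal s)"] by simp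
  qed
qed

context orth_bm
begin

lemma sets_natural_filtration_G: "sets (natural_filtration M G t) \<subseteq> sets M"
  by (rule sets_natural_filtration_le) auto

text \<open>Extends the Markov property from test products to all events before \<open>s\<close>:
  both sides are finite measures of \<open>B\<close>, and they agree on closed cylinders.\<close>

lemma markov_filtration:
  fixes f :: "real ^ 'n ^ 'n \<Rightarrow> real"
  assumes s: "0 \<le> s" and t: "0 \<le> t" and f: "continuous_on UNIV f" and f0: "\<And>A. 0 \<le> f A" and f1: "\<And>A. f A \<le> 1"
    and B: "B \<in> sets (natural_filtration M G (ennreal s))"
  shows "(\<integral>\<^sup>+\<omega>. ennreal (f (G (s + t) \<omega>)) * indicator B \<omega> \<partial>M)
    = (\<integral>\<^sup>+\<omega>. (\<integral>\<^sup>+\<omega>'. ennreal (f (G t \<omega>' ** G s \<omega>)) \<partial>M) * indicator B \<omega> \<partial>M)"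
proof -
  note [measurable] = measurable_compose[OF _ borel_measurable_continuous_onI[OF f]]
  let ?F = "natural_filtration M G (ennreal s)"
  define E where "E = {{\<omega>\<in>space M. \<forall>u\<in>I. G u \<omega> \<in> C u} | I C. finite I \<and> I \<subseteq> {0..s} \<and> (\<forall>u. closed (C u))}"
  define R where "R \<omega> = (\<integral>\<omega>'. f (G t \<omega>' ** G s \<omega>) \<partial>M)" for \<omega>
  have R[measurable]: "R \<in> borel_measurable M" unfolding R_def by measurable
  have R0: "0 \<le> R \<omega>" for \<omega> unfolding R_def by (simp add: f0)
  have Rnn: "(\<integral>\<^sup>+\<omega>'. ennreal (f (G t \<omega>' ** G s \<omega>)) \<partial>M) = ennreal (R \<omega>)" if "\<omega> \<in> space M" for \<omega>
    unfolding R_def using that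
    by (intro nn_integral_eq_integral integrable_const_bound[of _ 1]) (auto simp: f0 f1)
  have R1: "R \<omega> \<le> 1" if "\<omega> \<in> space M" for \<omega>
  proof -
    have "R \<omega> \<le> (\<integral>\<omega>'. 1 \<partial>M)"
      unfolding R_def using that by (intro integral_mono integrable_const_bound[of _ 1]) (auto simp: f0 f1)
    then show ?thesis by (simp add: prob_space)
  qed
  define D1 where "D1 = density M (\<lambda>\<omega>. ennreal (f (G (s + t) \<omega>)))"
  define D2 where "D2 = density M (\<lambda>\<omega>. ennreal (R \<omega>))"
  have sub: "sets ?F \<subseteq> sets M" by (rule sets_natural_filtration_G)
  have sub1: "subalgebra D1 ?F" "subalgebra D2 ?F" using sub by (auto simp: subalgebra_def D1_def D2_def)
  have em: "emeasure D1 A = (\<integral>\<^sup>+\<omega>. ennreal (f (G (s + t) \<omega>)) * indicator A \<omega> \<partial>M)"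
    "emeasure D2 A = (\<integral>\<^sup>+\<omega>. ennreal (R \<omega>) * indicator A \<omega> \<partial>M)" if "A \<in> sets M" for A
    unfolding D1_def D2_def using that by (auto simp: emeasure_density)
  have E_sub: "E \<subseteq> sets ?F"
    using sets_natural_filtration_cylinders(1)[OF s, of M G] unfolding E_def by (auto intro: sigma_sets.Basic)
  have onE: "emeasure D1 A = emeasure D2 A" if A: "A \<in> E" for A
  proof -
    have Am[measurable]: "A \<in> sets M" using A E_sub sub by auto
    obtain I C where AI: "A = {\<omega>\<in>space M. \<forall>u\<in>I. G u \<omega> \<in> C u}" "finite I" "I \<subseteq> {0..s}" "\<And>u. closed (C u)"
      using A unfolding E_def by blast
    define p where "p k \<omega> = (\<Prod>u\<in>I. closed_approx (C u) k (G u \<omega>))" for k \<omega>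
    have [measurable]: "p k \<in> borel_measurable M" for k
      unfolding p_def using measurable_compose[OF G_measurable borel_measurable_continuous_onI[OF closed_approx_continuous]] by measurable
    have p01: "0 \<le> p k \<omega>" "p k \<omega> \<le> 1" for k \<omega>
      unfolding p_def by (auto intro!: prod_nonneg prod_le_1 simp: closed_approx_bounds)
    have p_lim: "(\<lambda>k. p k \<omega>) \<longlonglongrightarrow> indicator A \<omega>" if "\<omega> \<in> space M" for \<omega>
    proof -
      have "(\<lambda>k. p k \<omega>) \<longlonglongrightarrow> (\<Prod>u\<in>I. indicator (C u) (G u \<omega>))"
        unfolding p_def by (intro tendsto_prod closed_approx_tendsto AI)
      also have "(\<Prod>u\<in>I. indicator (C u) (G u \<omega>)) = (indicator A \<omega> :: real)"
        using that AI(2) by (auto simp: AI(1) indicator_def prod_zero_iff)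
      finally show ?thesis .
    qed
    have eq: "(\<integral>\<omega>. f (G (s + t) \<omega>) * p k \<omega> \<partial>M) = (\<integral>\<omega>. R \<omega> * p k \<omega> \<partial>M)" for k
      unfolding p_def R_def
      by (rule G_markov[where K=1, OF s t AI(2,3) f _ closed_approx_continuous])
         (simp_all add: f0 f1 closed_approx_bounds)
    have "(\<lambda>k. \<integral>\<omega>. f (G (s + t) \<omega>) * p k \<omega> \<partial>M) \<longlonglongrightarrow> (\<integral>\<omega>. f (G (s + t) \<omega>) * indicator A \<omega> \<partial>M)"
      by (rule integral_dominated_convergence[where w="\<lambda>_. 1"])
         (auto simp: f0 f1 p01 abs_mult intro!: AE_I2 tendsto_mult p_lim mult_le_one)
    moreover have "(\<lambda>k. \<integral>\<omega>. R \<omega> * p k \<omega> \<partial>M) \<longlonglongrightarrow> (\<integral>\<omega>. R \<omega> * indicator A \<omega> \<partial>M)"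
      by (rule integral_dominated_convergence[where w="\<lambda>_. 1"])
         (auto simp: R0 R1 p01 abs_mult intro!: AE_I2 tendsto_mult p_lim mult_le_one)
    ultimately have eqA: "(\<integral>\<omega>. f (G (s + t) \<omega>) * indicator A \<omega> \<partial>M) = (\<integral>\<omega>. R \<omega> * indicator A \<omega> \<partial>M)"
      unfolding eq by (rule LIMSEQ_unique)
    have "emeasure D1 A = ennreal (\<integral>\<omega>. f (G (s + t) \<omega>) * indicator A \<omega> \<partial>M)"
    proof -
      have "emeasure D1 A = (\<integral>\<^sup>+\<omega>. ennreal (f (G (s + t) \<omega>) * indicator A \<omega>) \<partial>M)"
        unfolding em[OF Am] by (intro nn_integral_cong) (simp add: ennreal_mult' f0 ennreal_indicator)
      also have "\<dots> = ennreal (\<integral>\<omega>. f (G (s + t) \<omega>) * indicator A \<omega> \<partial>M)"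
        by (intro nn_integral_eq_integral integrable_const_bound[of _ 1]) (auto simp: f0 f1 indicator_def)
      finally show ?thesis .
    qed
    moreover have "emeasure D2 A = ennreal (\<integral>\<omega>. R \<omega> * indicator A \<omega> \<partial>M)"
    proof -
      have "emeasure D2 A = (\<integral>\<^sup>+\<omega>. ennreal (R \<omega> * indicator A \<omega>) \<partial>M)"
        unfolding em[OF Am] by (intro nn_integral_cong) (simp add: ennreal_mult' R0 ennreal_indicator)
      also have "\<dots> = ennreal (\<integral>\<omega>. R \<omega> * indicator A \<omega> \<partial>M)"
        by (intro nn_integral_eq_integral integrable_const_bound[of _ 1]) (auto simp: R0 R1 indicator_def)
      finally show ?thesis .
    qed
    ultimately show ?thesis using eqA by simp
  qed
  have spE: "space M \<in> E" unfolding E_def by (intro CollectI exI[of _ "{}"] exI[of _ "\<lambda>_. UNIV"]) auto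
  \<comment> \<open>Equality is claimed on the history before \<open>s\<close> only; on all of
    \<open>M\<close> the two densities define different measures in general.\<close>
  have "restr_to_subalg D1 ?F = restr_to_subalg D2 ?F"
  proof (rule measure_eqI_generator_eq)
    show "Int_stable E" unfolding E_def by (rule sets_natural_filtration_cylinders(2)[OF s])
    show "E \<subseteq> Pow (space M)" unfolding E_def by auto
    show "sets (restr_to_subalg D1 ?F) = sigma_sets (space M) E" "sets (restr_to_subalg D2 ?F) = sigma_sets (space M) E"
      unfolding E_def sets_natural_filtration_cylinders(1)[OF s, symmetric] by (simp_all add: sets_restr_to_subalg sub1)
    show "range (\<lambda>_::nat. space M) \<subseteq> E" "(\<Union>i::nat. space M) = space M" using spE by auto
    fix A assume "A \<in> E"
    with E_sub have "A \<in> sets ?F" by auto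
    then show "emeasure (restr_to_subalg D1 ?F) A = emeasure (restr_to_subalg D2 ?F) A"
      using onE[OF \<open>A \<in> E\<close>] by (simp add: emeasure_restr_to_subalg[OF sub1(1)] emeasure_restr_to_subalg[OF sub1(2)])
  next
    have "emeasure D1 (space M) \<le> (\<integral>\<^sup>+\<omega>. 1 \<partial>M)"
      unfolding em(1)[OF sets.top] by (intro nn_integral_mono) (auto simp: f1 indicator_def)
    then have "emeasure D1 (space M) \<noteq> \<infinity>" by (auto simp: emeasure_space_1 top_unique)
    moreover have "space M \<in> sets ?F" using sets.top[of ?F] by simp
    ultimately show "emeasure (restr_to_subalg D1 ?F) (space M) \<noteq> \<infinity>" for i :: nat
      by (simp add: emeasure_restr_to_subalg[OF sub1(1)])
  qed
  then have "emeasure (restr_to_subalg D1 ?F) B = emeasure (restr_to_subalg D2 ?F) B" by simp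
  then have "emeasure D1 B = emeasure D2 B"
    using B by (simp add: emeasure_restr_to_subalg[OF sub1(1)] emeasure_restr_to_subalg[OF sub1(2)])
  then show ?thesis
    using B sub by (simp add: em Rnn subset_eq cong: nn_integral_cong)
qed

end

section \<open>Orbits of Brownian motion on the orthogonal group\<close>

text \<open>Abstracts from the state space, so that a single point on the sphere and a pair of
  points on the product of two spheres are two instances of one argument.\<close>

locale orth_action = orth_bm M G for M :: "'w measure" and G :: "real \<Rightarrow> 'w \<Rightarrow> real ^ 'n::finite ^ 'n" +
  fixes S :: "'a::euclidean_space set" and act :: "real ^ 'n ^ 'n \<Rightarrow> 'a \<Rightarrow> 'a"
  assumes closed_S: "closed S"
    and act_continuous: "continuous_on UNIV (\<lambda>p. act (fst p) (snd p))"
    and act_mult: "\<And>A B x. act (A ** B) x = act A (act B x)"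
    and act_id: "\<And>x. act (mat 1) x = x"
    and act_S: "\<And>A x. orthogonal_matrix A \<Longrightarrow> x \<in> S \<Longrightarrow> act A x \<in> S"
begin

definition P :: "real \<Rightarrow> 'a \<Rightarrow> 'a measure" where
  "P t z = distr M (restrict_space borel S) (\<lambda>\<omega>. act (G t \<omega>) z)"

lemma act_measurable[measurable (raw)]:
  assumes "A \<in> borel_measurable N" "x \<in> borel_measurable N"
  shows "(\<lambda>\<omega>. act (A \<omega>) (x \<omega>)) \<in> borel_measurable N"
  by (rule borel_measurable_continuous_Pair[OF assms act_continuous])

lemma act_tendsto:
  assumes "A \<longlonglongrightarrow> A'" "x \<longlonglongrightarrow> x'" shows "(\<lambda>j. act (A j) (x j)) \<longlonglongrightarrow> act A' x'"
  using continuous_on_tendsto_compose[OF act_continuous tendsto_Pair[OF assms]] by simp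

lemma S_borel[measurable]: "S \<in> sets borel" using closed_S by auto

lemma act_G_S: "\<omega> \<in> space M \<Longrightarrow> 0 \<le> t \<Longrightarrow> z \<in> S \<Longrightarrow> act (G t \<omega>) z \<in> S"
  by (intro act_S G_orthogonal)

lemma act_G_measurable: "0 \<le> t \<Longrightarrow> z \<in> S \<Longrightarrow> (\<lambda>\<omega>. act (G t \<omega>) z) \<in> M \<rightarrow>\<^sub>M restrict_space borel S"
  by (rule measurable_restrict_space2) (simp_all add: act_G_S)

lemma sets_restrict_S: "A \<in> sets (restrict_space borel S) \<longleftrightarrow> A \<in> sets borel \<and> A \<subseteq> S"
  using sets_restrict_space_iff[of S borel A] S_borel by auto

lemma emeasure_P:
  assumes "0 \<le> t" "z \<in> S" and A: "A \<in> sets (restrict_space borel S)"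
  shows "emeasure (P t z) A = (\<integral>\<^sup>+\<omega>. indicator A (act (G t \<omega>) z) \<partial>M)"
proof -
  have "emeasure (P t z) A = (\<integral>\<^sup>+w. indicator A w \<partial>P t z)" using A by (simp add: P_def)
  also have "\<dots> = (\<integral>\<^sup>+\<omega>. indicator A (act (G t \<omega>) z) \<partial>M)"
    unfolding P_def using A by (intro nn_integral_distr act_G_measurable assms) auto
  finally show ?thesis .
qed

lemma prob_space_P: "0 \<le> t \<Longrightarrow> z \<in> S \<Longrightarrow> prob_space (P t z)"
  unfolding P_def by (intro prob_space_distr act_G_measurable)

lemma P_measurable:
  assumes t: "0 \<le> t"
  shows "P t \<in> restrict_space borel S \<rightarrow>\<^sub>M prob_algebra (restrict_space borel S)"
proof (rule measurable_prob_algebraI)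
  show "prob_space (P t z)" if "z \<in> space (restrict_space borel S)" for z
    using that t by (intro prob_space_P) (auto simp: space_restrict_space)
  have id: "(\<lambda>z. z) \<in> restrict_space borel S \<rightarrow>\<^sub>M borel"
    by (rule measurable_restrict_space1) simp
  have [measurable]: "fst \<in> restrict_space borel S \<Otimes>\<^sub>M M \<rightarrow>\<^sub>M borel"
    using measurable_compose[OF measurable_fst[of "restrict_space borel S" M] id] by simp
  have "(\<lambda>p. act (G t (snd p)) (fst p)) \<in> restrict_space borel S \<Otimes>\<^sub>M M \<rightarrow>\<^sub>M restrict_space borel S"
    by (rule measurable_restrict_space2) (use t in \<open>auto simp: space_pair_measure space_restrict_space act_G_S\<close>)
  then have m: "(\<lambda>(z, \<omega>). act (G t \<omega>) z) \<in> restrict_space borel S \<Otimes>\<^sub>M M \<rightarrow>\<^sub>M restrict_space borel S"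
    by (simp add: case_prod_unfold)
  have "subprob_space M" by (rule prob_space_imp_subprob_space) unfold_locales
  then have "(\<lambda>_. M) \<in> restrict_space borel S \<rightarrow>\<^sub>M subprob_algebra M"
    by (intro measurable_const) (simp add: space_subprob_algebra)
  from measurable_distr2[OF m this] show "P t \<in> restrict_space borel S \<rightarrow>\<^sub>M subprob_algebra (restrict_space borel S)"
    unfolding P_def[abs_def] by simp
qed

context
  fixes x0 :: 'a assumes x0: "x0 \<in> S"
begin

definition X :: "real \<Rightarrow> 'w \<Rightarrow> 'a" where
  "X t \<omega> = act (G t \<omega>) x0"

lemma X_measurable[measurable]: "X t \<in> borel_measurable M"
  unfolding X_def by measurable

lemma X_S: "\<omega> \<in> space M \<Longrightarrow> 0 \<le> t \<Longrightarrow> X t \<omega> \<in> S"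
  unfolding X_def by (intro act_G_S x0)

lemma X_continuous:
  assumes "\<omega> \<in> space M" shows "continuous_on {0..} (\<lambda>t. X t \<omega>)"
proof -
  have "continuous_on {0..} (\<lambda>t. (G t \<omega>, x0))"
    by (intro continuous_on_Pair G_continuous assms continuous_on_const)
  from continuous_on_compose2[OF act_continuous this] show ?thesis by (simp add: X_def)
qed

lemma X_tendsto: "\<omega> \<in> space M \<Longrightarrow> a \<longlonglongrightarrow> b \<Longrightarrow> (\<And>j. 0 \<le> a j) \<Longrightarrow> 0 \<le> b \<Longrightarrow> (\<lambda>j. X (a j) \<omega>) \<longlonglongrightarrow> X b \<omega>"
  by (rule continuous_on_tendsto_compose[OF X_continuous]) auto

lemma X_random_measurable:
  assumes "T \<in> borel_measurable M" "\<And>\<omega>. \<omega> \<in> space M \<Longrightarrow> 0 \<le> T \<omega>"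
  shows "(\<lambda>\<omega>. X (T \<omega>) \<omega>) \<in> borel_measurable M"
  by (rule measurable_random_time[of M X T, OF X_continuous X_measurable assms])

lemma strong_markov_continuous:
  fixes h :: "'a \<Rightarrow> real" and \<tau> :: "'w \<Rightarrow> ennreal"
  assumes \<tau>m: "\<tau> \<in> borel_measurable M"
    and B: "\<And>r. {\<omega>\<in>B. \<tau> \<omega> \<le> r} \<in> sets (natural_filtration M G r)"
    and t: "0 \<le> t" and h: "continuous_on UNIV h" and h0: "\<And>x. 0 \<le> h x" and h1: "\<And>x. h x \<le> 1"
  defines "B' \<equiv> {\<omega>\<in>B. \<tau> \<omega> < \<infinity>}" and "T \<equiv> \<lambda>\<omega>. enn2real (\<tau> \<omega>)"
  shows "(\<integral>\<^sup>+\<omega>. ennreal (h (X (T \<omega> + t) \<omega>)) * indicator B' \<omega> \<partial>M)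
    = (\<integral>\<^sup>+\<omega>. (\<integral>\<^sup>+\<omega>'. ennreal (h (act (G t \<omega>') (X (T \<omega>) \<omega>))) \<partial>M) * indicator B' \<omega> \<partial>M)"
proof -
  note [measurable] = \<tau>m
  have [measurable]: "T \<in> borel_measurable M" unfolding T_def by measurable
  have T0: "0 \<le> T \<omega>" for \<omega> by (simp add: T_def)
  note [measurable (raw)] = measurable_compose[OF _ borel_measurable_continuous_onI[OF h]]
  have \<tau>_le: "\<tau> \<omega> \<le> ennreal r \<longleftrightarrow> \<tau> \<omega> < \<infinity> \<and> T \<omega> \<le> r" if "0 \<le> r" for \<omega> r
    unfolding T_def using that
    by (cases "\<tau> \<omega>") (auto simp: top_unique)
  have Bsub: "B' \<subseteq> space M"
  proof
    fix \<omega> assume w: "\<omega> \<in> B'"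
    then have "\<omega> \<in> {\<omega>\<in>B. \<tau> \<omega> \<le> \<infinity>}" by (simp add: B'_def)
    with sets.sets_into_space[OF B[of \<infinity>]] show "\<omega> \<in> space M" by auto
  qed
  have FG: "sets (natural_filtration M G r) \<subseteq> sets M" for r by (rule sets_natural_filtration_G)
  have "{\<omega>\<in>B. \<tau> \<omega> \<le> \<infinity>} \<in> sets M" using B FG by blast
  then have Bm: "B \<in> sets M" by simp
  have B'm[measurable]: "B' \<in> sets M" unfolding B'_def using Bm by measurable
  \<comment> \<open>Rounding up, never down: whether the rounded time equals \<open>k / 2^j\<close>
    is then known at time \<open>k / 2^j\<close>.\<close>
  define q where "q j \<omega> = real_of_int \<lceil>2 ^ j * T \<omega>\<rceil> / 2 ^ j" for j :: nat and \<omega>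
  have q_m[measurable]: "q j \<in> borel_measurable M" for j unfolding q_def by measurable
  have ceil0: "0 \<le> \<lceil>2 ^ j * T \<omega>\<rceil>" for j \<omega>
  proof -
    have "0 \<le> 2 ^ j * T \<omega>" using T0 by simp
    then show ?thesis by linarith
  qed
  have q0: "0 \<le> q j \<omega>" for j \<omega> using ceil0 by (simp add: q_def)
  have q_lim: "(\<lambda>j. q j \<omega>) \<longlonglongrightarrow> T \<omega>" for \<omega>
    using tendsto_minus[OF tendsto_dyadic_floor[of "- T \<omega>"]] by (simp add: q_def ceiling_def)
  have Xq[measurable]: "(\<lambda>\<omega>. X (q j \<omega> + t) \<omega>) \<in> borel_measurable M" "(\<lambda>\<omega>. X (q j \<omega>) \<omega>) \<in> borel_measurable M" for j
    using q0 t by (auto intro!: X_random_measurable add_nonneg_nonneg)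
  have XT[measurable]: "(\<lambda>\<omega>. X (T \<omega> + t) \<omega>) \<in> borel_measurable M" "(\<lambda>\<omega>. X (T \<omega>) \<omega>) \<in> borel_measurable M"
    using T0 t by (auto intro!: X_random_measurable add_nonneg_nonneg)
  define C where "C j k = {\<omega>\<in>B'. \<lceil>2 ^ j * T \<omega>\<rceil> = int k}" for j k :: nat
  have [measurable]: "C j k \<in> sets M" for j k unfolding C_def by measurable
  have nn: "0 \<le> real k / 2 ^ j" for k j :: nat by simp
  have C_F: "C j k \<in> sets (natural_filtration M G (ennreal (real k / 2 ^ j)))" for j k
  proof (cases k)
    \<comment> \<open>The value 0 has no preceding grid point. It is attained exactly at
      \<open>T = 0\<close>, which is the event that \<open>\<tau>\<close> is at most 0.\<close>
    case 0
    have "\<lceil>2 ^ j * T \<omega>\<rceil> = int k \<longleftrightarrow> T \<omega> \<le> real k / 2 ^ j" for \<omega>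
    proof -
      have "0 \<le> 2 ^ j * T \<omega>" using T0 by simp
      then have "\<lceil>2 ^ j * T \<omega>\<rceil> = 0 \<longleftrightarrow> 2 ^ j * T \<omega> \<le> 0" by linarith
      also have "\<dots> \<longleftrightarrow> T \<omega> \<le> 0"
        using mult_le_cancel_left_pos[of "2 ^ j" "T \<omega>" 0] by simp
      finally show ?thesis by (simp add: 0)
    qed
    then have "C j k = {\<omega>\<in>B. \<tau> \<omega> \<le> ennreal (real k / 2 ^ j)}"
      unfolding C_def B'_def \<tau>_le[OF nn] by blast
    with B show ?thesis by simp
  next
    case (Suc i)
    have "C j k = {\<omega>\<in>B. \<tau> \<omega> \<le> ennreal (real k / 2 ^ j)} - {\<omega>\<in>B. \<tau> \<omega> \<le> ennreal (real i / 2 ^ j)}"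
    proof -
      have "\<lceil>2 ^ j * T \<omega>\<rceil> = int k \<longleftrightarrow> T \<omega> \<le> real k / 2 ^ j \<and> \<not> T \<omega> \<le> real i / 2 ^ j" for \<omega>
        by (simp add: ceiling_eq_iff pos_le_divide_eq Suc mult.commute) linarith
      then show ?thesis unfolding C_def B'_def \<tau>_le[OF nn] by blast
    qed
    moreover have "{\<omega>\<in>B. \<tau> \<omega> \<le> ennreal (real i / 2 ^ j)} \<in> sets (natural_filtration M G (ennreal (real k / 2 ^ j)))"
      using B[of "ennreal (real i / 2 ^ j)"] natural_filtration_mono[of "ennreal (real i / 2 ^ j)" "ennreal (real k / 2 ^ j)" M G]
      by (auto simp: Suc divide_right_mono intro!: ennreal_leI)
    ultimately show ?thesis using B[of "ennreal (real k / 2 ^ j)"] by auto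
  qed
  \<comment> \<open>Exactly one summand is nonzero on \<open>B'\<close>. This reduces the rounded
    time to the Markov property at countably many fixed times.\<close>
  have split: "f (q j \<omega>) * indicator B' \<omega> = (\<Sum>k. f (real k / 2 ^ j) * indicator (C j k) \<omega>)" for f :: "real \<Rightarrow> ennreal" and j \<omega>
  proof (cases "\<omega> \<in> B'")
    case True
    define k0 where "k0 = nat \<lceil>2 ^ j * T \<omega>\<rceil>"
    have "(\<lambda>k. f (real k / 2 ^ j) * indicator (C j k) \<omega>) = (\<lambda>k. if k = k0 then f (real k / 2 ^ j) else 0)"
      using True ceil0[of j \<omega>] by (auto simp: fun_eq_iff C_def k0_def indicator_def)
    then have "(\<Sum>k. f (real k / 2 ^ j) * indicator (C j k) \<omega>) = f (real k0 / 2 ^ j)"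
      using sums_single[of k0 "\<lambda>k. f (real k / 2 ^ j)"] by (simp add: sums_iff)
    also have "real k0 / 2 ^ j = q j \<omega>" using ceil0[of j \<omega>] by (simp add: q_def k0_def)
    finally show ?thesis using True by simp
  next
    case False
    then show ?thesis by (simp add: C_def)
  qed
  have level: "(\<integral>\<^sup>+\<omega>. ennreal (h (X (q j \<omega> + t) \<omega>)) * indicator B' \<omega> \<partial>M)
    = (\<integral>\<^sup>+\<omega>. (\<integral>\<^sup>+\<omega>'. ennreal (h (act (G t \<omega>') (X (q j \<omega>) \<omega>))) \<partial>M) * indicator B' \<omega> \<partial>M)" for j
  proof -
    have "(\<integral>\<^sup>+\<omega>. ennreal (h (X (q j \<omega> + t) \<omega>)) * indicator B' \<omega> \<partial>M)
      = (\<integral>\<^sup>+\<omega>. (\<Sum>k. ennreal (h (X (real k / 2 ^ j + t) \<omega>)) * indicator (C j k) \<omega>) \<partial>M)"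
      by (intro nn_integral_cong split[of "\<lambda>r. ennreal (h (X (r + t) _))"])
    also have "\<dots> = (\<Sum>k. \<integral>\<^sup>+\<omega>. ennreal (h (X (real k / 2 ^ j + t) \<omega>)) * indicator (C j k) \<omega> \<partial>M)"
      by (rule nn_integral_suminf) measurable
    also have "\<dots> = (\<Sum>k. \<integral>\<^sup>+\<omega>. (\<integral>\<^sup>+\<omega>'. ennreal (h (act (G t \<omega>') (X (real k / 2 ^ j) \<omega>))) \<partial>M) * indicator (C j k) \<omega> \<partial>M)"
    proof (rule suminf_cong)
      fix k
      have "continuous_on UNIV (\<lambda>A. h (act A x0))"
        by (rule continuous_on_compose2[OF h], rule continuous_on_compose2[OF act_continuous, of UNIV "\<lambda>A. (A, x0)", simplified])
           (auto intro!: continuous_intros)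
      from markov_filtration[OF _ t this h0 h1 C_F[of j k]]
      show "(\<integral>\<^sup>+\<omega>. ennreal (h (X (real k / 2 ^ j + t) \<omega>)) * indicator (C j k) \<omega> \<partial>M)
        = (\<integral>\<^sup>+\<omega>. (\<integral>\<^sup>+\<omega>'. ennreal (h (act (G t \<omega>') (X (real k / 2 ^ j) \<omega>))) \<partial>M) * indicator (C j k) \<omega> \<partial>M)"
        by (simp add: X_def act_mult)
    qed
    also have "\<dots> = (\<integral>\<^sup>+\<omega>. (\<Sum>k. (\<integral>\<^sup>+\<omega>'. ennreal (h (act (G t \<omega>') (X (real k / 2 ^ j) \<omega>))) \<partial>M) * indicator (C j k) \<omega>) \<partial>M)"
      by (rule nn_integral_suminf[symmetric]) measurable
    also have "\<dots> = (\<integral>\<^sup>+\<omega>. (\<integral>\<^sup>+\<omega>'. ennreal (h (act (G t \<omega>') (X (q j \<omega>) \<omega>))) \<partial>M) * indicator B' \<omega> \<partial>M)"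
      by (intro nn_integral_cong split[of "\<lambda>r. \<integral>\<^sup>+\<omega>'. ennreal (h (act (G t \<omega>') (X r _))) \<partial>M", symmetric])
    finally show ?thesis .
  qed
  have h_lim: "(\<lambda>j. ennreal (h (a j))) \<longlonglongrightarrow> ennreal (h b)" if "a \<longlonglongrightarrow> b" for a b
    by (intro tendsto_ennrealI continuous_on_tendsto_compose[OF h that]) auto
  have ind_lim: "(\<lambda>j. a j * indicator B' \<omega>) \<longlonglongrightarrow> b * indicator B' \<omega>" if "a \<longlonglongrightarrow> b" for a :: "nat \<Rightarrow> ennreal" and b \<omega>
    using that by (cases "\<omega> \<in> B'") auto
  have one: "(\<integral>\<^sup>+\<omega>. 1 \<partial>M) < \<infinity>" by (simp add: emeasure_space_1)
  have ind_le: "a * indicator B' \<omega> \<le> 1" if "a \<le> (1 :: ennreal)" for a \<omega>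
    using that by (auto simp: indicator_def)
  have inner_le: "(\<integral>\<^sup>+\<omega>'. ennreal (h (f \<omega>')) \<partial>M) \<le> 1" for f
  proof -
    have "(\<integral>\<^sup>+\<omega>'. ennreal (h (f \<omega>')) \<partial>M) \<le> (\<integral>\<^sup>+\<omega>'. 1 \<partial>M)"
      by (intro nn_integral_mono) (simp add: h1)
    then show ?thesis by (simp add: emeasure_space_1)
  qed
  have "(\<lambda>j. \<integral>\<^sup>+\<omega>. ennreal (h (X (q j \<omega> + t) \<omega>)) * indicator B' \<omega> \<partial>M)
     \<longlonglongrightarrow> (\<integral>\<^sup>+\<omega>. ennreal (h (X (T \<omega> + t) \<omega>)) * indicator B' \<omega> \<partial>M)"
    by (rule nn_integral_dominated_convergence[where w="\<lambda>_. 1"])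
       (use one t in \<open>auto intro!: AE_I2 ind_lim h_lim X_tendsto tendsto_add q_lim add_nonneg_nonneg q0 T0 ind_le simp: h1\<close>)
  moreover have "(\<lambda>j. \<integral>\<^sup>+\<omega>. (\<integral>\<^sup>+\<omega>'. ennreal (h (act (G t \<omega>') (X (q j \<omega>) \<omega>))) \<partial>M) * indicator B' \<omega> \<partial>M)
     \<longlonglongrightarrow> (\<integral>\<^sup>+\<omega>. (\<integral>\<^sup>+\<omega>'. ennreal (h (act (G t \<omega>') (X (T \<omega>) \<omega>))) \<partial>M) * indicator B' \<omega> \<partial>M)"
  proof (rule nn_integral_dominated_convergence[where w="\<lambda>_. 1"])
    show "AE \<omega> in M. (\<lambda>j. (\<integral>\<^sup>+\<omega>'. ennreal (h (act (G t \<omega>') (X (q j \<omega>) \<omega>))) \<partial>M) * indicator B' \<omega>)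
       \<longlonglongrightarrow> (\<integral>\<^sup>+\<omega>'. ennreal (h (act (G t \<omega>') (X (T \<omega>) \<omega>))) \<partial>M) * indicator B' \<omega>"
    proof (rule AE_I2, rule ind_lim)
      fix \<omega> assume \<omega>: "\<omega> \<in> space M"
      show "(\<lambda>j. \<integral>\<^sup>+\<omega>'. ennreal (h (act (G t \<omega>') (X (q j \<omega>) \<omega>))) \<partial>M) \<longlonglongrightarrow> (\<integral>\<^sup>+\<omega>'. ennreal (h (act (G t \<omega>') (X (T \<omega>) \<omega>))) \<partial>M)"
        by (rule nn_integral_dominated_convergence[where w="\<lambda>_. 1"])
           (use one \<omega> in \<open>auto intro!: AE_I2 h_lim act_tendsto X_tendsto q_lim q0 T0 simp: h1\<close>)
    qed
  qed (use one in \<open>auto intro!: ind_le inner_le\<close>)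
  ultimately show ?thesis unfolding level by (rule LIMSEQ_unique)
qed

end
end

context orth_action
begin

context
  fixes x0 :: 'a assumes x0: "x0 \<in> S"
begin

private abbreviation "Y \<equiv> X x0"

lemmas Y_measurable[measurable] = X_measurable[OF x0]

text \<open>For fixed \<open>B\<close>, both sides are finite measures of \<open>A\<close>, already
  compared on continuous functions.\<close>

lemma strong_markov_borel:
  fixes \<tau> :: "'w \<Rightarrow> ennreal"
  assumes \<tau>[measurable]: "\<tau> \<in> borel_measurable M"
    and B: "\<And>r. {\<omega>\<in>B. \<tau> \<omega> \<le> r} \<in> sets (natural_filtration M G r)"
    and t: "0 \<le> t" and A[measurable]: "A \<in> sets borel"
  defines "B' \<equiv> {\<omega>\<in>B. \<tau> \<omega> < \<infinity>}" and "T \<equiv> \<lambda>\<omega>. enn2real (\<tau> \<omega>)"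
  shows "(\<integral>\<^sup>+\<omega>. indicator A (Y (T \<omega> + t) \<omega>) * indicator B' \<omega> \<partial>M)
    = (\<integral>\<^sup>+\<omega>. (\<integral>\<^sup>+\<omega>'. indicator A (act (G t \<omega>') (Y (T \<omega>) \<omega>)) \<partial>M) * indicator B' \<omega> \<partial>M)"
proof -
  have [measurable]: "T \<in> borel_measurable M" unfolding T_def by measurable
  have "{\<omega>\<in>B. \<tau> \<omega> \<le> \<infinity>} \<in> sets M" using B[of \<infinity>] sets_natural_filtration_G by blast
  then have Bm[measurable]: "B \<in> sets M" by simp
  have B'[measurable]: "B' \<in> sets M" unfolding B'_def by measurable
  have XT[measurable]: "(\<lambda>\<omega>. Y (T \<omega> + t) \<omega>) \<in> borel_measurable M"
    by (rule X_random_measurable[OF x0]) (use t in \<open>auto simp: T_def\<close>)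
  have XT'[measurable]: "(\<lambda>\<omega>. Y (T \<omega>) \<omega>) \<in> borel_measurable M"
    by (rule X_random_measurable[OF x0]) (auto simp: T_def)
  define D where "D = density M (indicator B')"
  have [measurable_cong]: "sets D = sets M" by (simp add: D_def)
  interpret D: finite_measure D
  proof (rule finite_measureI)
    have "emeasure D (space D) = emeasure M B'"
      unfolding D_def using B' sets.sets_into_space[OF B'] by (simp add: emeasure_density Int_absorb2 flip: indicator_inter_arith)
    then show "emeasure D (space D) \<noteq> \<infinity>" by simp
  qed
  define N1 where "N1 = distr D borel (\<lambda>\<omega>. Y (T \<omega> + t) \<omega>)"
  \<comment> \<open>The position at time \<open>T\<close> and an independent copy of the motion are
    realized on a product space.\<close>
  define N2 where "N2 = distr (D \<Otimes>\<^sub>M M) borel (\<lambda>p. act (G t (snd p)) (Y (T (fst p)) (fst p)))"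
  have i1: "(\<integral>\<^sup>+x. h x \<partial>N1) = (\<integral>\<^sup>+\<omega>. h (Y (T \<omega> + t) \<omega>) * indicator B' \<omega> \<partial>M)"
    if [measurable]: "h \<in> borel_measurable borel" for h :: "'a \<Rightarrow> ennreal"
    unfolding N1_def D_def by (subst nn_integral_distr) (auto simp: nn_integral_density mult.commute)
  have i2: "(\<integral>\<^sup>+x. h x \<partial>N2) = (\<integral>\<^sup>+\<omega>. (\<integral>\<^sup>+\<omega>'. h (act (G t \<omega>') (Y (T \<omega>) \<omega>)) \<partial>M) * indicator B' \<omega> \<partial>M)"
    if [measurable]: "h \<in> borel_measurable borel" for h :: "'a \<Rightarrow> ennreal"
  proof -
    have "(\<integral>\<^sup>+x. h x \<partial>N2) = (\<integral>\<^sup>+p. h (act (G t (snd p)) (Y (T (fst p)) (fst p))) \<partial>(D \<Otimes>\<^sub>M M))"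
      unfolding N2_def by (rule nn_integral_distr) measurable
    also have "\<dots> = (\<integral>\<^sup>+\<omega>. \<integral>\<^sup>+\<omega>'. h (act (G t \<omega>') (Y (T \<omega>) \<omega>)) \<partial>M \<partial>D)"
      by (subst nn_integral_fst[symmetric]) auto
    also have "\<dots> = (\<integral>\<^sup>+\<omega>. (\<integral>\<^sup>+\<omega>'. h (act (G t \<omega>') (Y (T \<omega>) \<omega>)) \<partial>M) * indicator B' \<omega> \<partial>M)"
      unfolding D_def by (subst nn_integral_density) (auto simp: mult.commute)
    finally show ?thesis .
  qed
  have "N1 = N2"
  proof (rule measure_eqI_continuous)
    show "finite_measure N1" unfolding N1_def by (rule D.finite_measure_distr) measurable
    have "finite_measure (D \<Otimes>\<^sub>M M)"
      by (rule finite_measure_pair_measure) unfold_locales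
    then show "finite_measure N2" unfolding N2_def by (rule finite_measure.finite_measure_distr) measurable
    show "sets N1 = sets borel" "sets N2 = sets borel" by (simp_all add: N1_def N2_def)
    fix h :: "'a \<Rightarrow> real" assume h: "continuous_on UNIV h" "\<And>x. 0 \<le> h x" "\<And>x. h x \<le> 1"
    have [measurable]: "h \<in> borel_measurable borel" by (rule borel_measurable_continuous_onI[OF h(1)])
    show "(\<integral>\<^sup>+x. ennreal (h x) \<partial>N1) = (\<integral>\<^sup>+x. ennreal (h x) \<partial>N2)"
      using strong_markov_continuous[OF x0 \<tau> B t h] by (simp add: i1 i2 B'_def T_def)
  qed
  then show ?thesis using i1[of "indicator A"] i2[of "indicator A"] by simp
qed

text \<open>One characterization of conditional expectations for two uses: \<open>B0\<close> is the
  whole space at a fixed time, and the event of finiteness at a stopping time. \<open>W\<close> is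
  the present and \<open>Z\<close> the later position.\<close>

lemma cond_exp_P:
  assumes sub: "subalgebra M F" and W: "W \<in> borel_measurable F" and WS: "\<And>\<omega>. \<omega> \<in> space M \<Longrightarrow> W \<omega> \<in> S"
    and Z[measurable]: "Z \<in> borel_measurable M" and B0: "B0 \<in> sets F"
    and A: "A \<in> sets (restrict_space borel S)" and t: "0 \<le> t"
    and eq: "\<And>B. B \<in> sets F \<Longrightarrow> (\<integral>\<^sup>+\<omega>. indicator A (Z \<omega>) * indicator (B \<inter> B0) \<omega> \<partial>M)
      = (\<integral>\<^sup>+\<omega>. (\<integral>\<^sup>+\<omega>'. indicator A (act (G t \<omega>') (W \<omega>)) \<partial>M) * indicator (B \<inter> B0) \<omega> \<partial>M)"
  shows "AE \<omega> in M. real_cond_exp M F (indicator {\<omega>\<in>space M. \<omega> \<in> B0 \<and> Z \<omega> \<in> A}) \<omega>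
    = indicator B0 \<omega> * measure (P t (W \<omega>)) A"
proof -
  interpret F: finite_measure_subalgebra M F by unfold_locales (rule sub)
  have spF: "space F = space M" and setF: "sets F \<subseteq> sets M" using sub by (auto simp: subalgebra_def)
  have Ab[measurable]: "A \<in> sets borel" using A by (simp add: sets_restrict_S)
  note W[measurable]
  have WM[measurable]: "W \<in> borel_measurable M" using measurable_from_subalg[OF sub W] .
  have B0M[measurable]: "B0 \<in> sets M" using B0 setF by auto
  define m where "m \<omega> = (\<integral>\<^sup>+\<omega>'. indicator A (act (G t \<omega>') (W \<omega>)) \<partial>M)" for \<omega>
  have mF[measurable]: "m \<in> borel_measurable F" unfolding m_def by measurable
  have mM[measurable]: "m \<in> borel_measurable M" unfolding m_def by measurable
  have m_le: "m \<omega> \<le> 1" for \<omega>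
  proof -
    have "m \<omega> \<le> (\<integral>\<^sup>+\<omega>'. 1 \<partial>M)" unfolding m_def by (intro nn_integral_mono) (auto simp: indicator_def)
    then show ?thesis by (simp add: emeasure_space_1)
  qed
  have m_P: "measure (P t (W \<omega>)) A = enn2real (m \<omega>)" if "\<omega> \<in> space M" for \<omega>
    using emeasure_P[OF t WS[OF that] A] by (simp add: measure_def m_def)
  have m_fin: "ennreal (enn2real (m \<omega>)) = m \<omega>" for \<omega>
    using m_le[of \<omega>] by (intro ennreal_enn2real) (auto simp: le_less_trans[of _ 1])
  let ?f = "indicator {\<omega>\<in>space M. \<omega> \<in> B0 \<and> Z \<omega> \<in> A} :: 'w \<Rightarrow> real"
  define gg where "gg \<omega> = indicator B0 \<omega> * enn2real (m \<omega>)" for \<omega>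
  have gg_le: "gg \<omega> \<le> 1" for \<omega>
    unfolding gg_def using m_le[of \<omega>] by (auto simp: indicator_def enn2real_leI)
  have fm[measurable]: "?f \<in> borel_measurable M" by measurable
  have ggF[measurable]: "gg \<in> borel_measurable F" unfolding gg_def using B0 by measurable
  have ggM[measurable]: "gg \<in> borel_measurable M" unfolding gg_def by measurable
  have gg0: "0 \<le> gg \<omega>" for \<omega> by (simp add: gg_def)
  have "AE \<omega> in M. real_cond_exp M F ?f \<omega> = gg \<omega>"
  proof (rule F.real_cond_exp_charact)
    fix B assume B: "B \<in> sets F"
    then have [measurable]: "B \<in> sets M" using setF by auto
    have "(\<integral>\<omega>\<in>B. ?f \<omega> \<partial>M) = enn2real (\<integral>\<^sup>+\<omega>. ennreal (indicator B \<omega> *\<^sub>R ?f \<omega>) \<partial>M)"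
      unfolding set_lebesgue_integral_def by (rule integral_eq_nn_integral) auto
    also have "(\<integral>\<^sup>+\<omega>. ennreal (indicator B \<omega> *\<^sub>R ?f \<omega>) \<partial>M) = (\<integral>\<^sup>+\<omega>. indicator A (Z \<omega>) * indicator (B \<inter> B0) \<omega> \<partial>M)"
      by (intro nn_integral_cong) (auto simp: indicator_def)
    also have "\<dots> = (\<integral>\<^sup>+\<omega>. m \<omega> * indicator (B \<inter> B0) \<omega> \<partial>M)"
      unfolding m_def by (rule eq[OF B])
    also have "\<dots> = (\<integral>\<^sup>+\<omega>. ennreal (indicator B \<omega> *\<^sub>R gg \<omega>) \<partial>M)"
      by (intro nn_integral_cong) (auto simp: indicator_def gg_def m_fin)
    also have "enn2real \<dots> = (\<integral>\<omega>\<in>B. gg \<omega> \<partial>M)"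
      unfolding set_lebesgue_integral_def by (rule integral_eq_nn_integral[symmetric]) (auto simp: gg0)
    finally show "(\<integral>\<omega>\<in>B. ?f \<omega> \<partial>M) = (\<integral>\<omega>\<in>B. gg \<omega> \<partial>M)" .
  next
    show "integrable M ?f" by (rule integrable_const_bound[of _ 1]) auto
    show "integrable M gg" by (rule integrable_const_bound[of _ 1]) (auto simp: gg0 gg_le)
    show "gg \<in> borel_measurable F" by (rule ggF)
  qed
  then show ?thesis
    using AE_space by eventually_elim (simp add: gg_def m_P)
qed

text \<open>\<open>F\<close> lies anywhere between the present position and the history of
  \<open>G\<close>. Taking for it the history of the pair yields co-adaptedness.\<close>

lemma simple_markov_cond_exp:
  assumes s: "0 \<le> s" and t: "0 \<le> t" and A: "A \<in> sets (restrict_space borel S)"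
    and sp: "space F = space M" and F: "sets F \<subseteq> sets (natural_filtration M G (ennreal s))"
    and Y: "Y s \<in> borel_measurable F"
  shows "AE \<omega> in M. real_cond_exp M F (indicator {\<omega>\<in>space M. Y (s + t) \<omega> \<in> A}) \<omega> = measure (P t (Y s \<omega>)) A"
proof -
  have Ab: "A \<in> sets borel" using A by (simp add: sets_restrict_S)
  have "AE \<omega> in M. real_cond_exp M F (indicator {\<omega>\<in>space M. \<omega> \<in> space M \<and> Y (s + t) \<omega> \<in> A}) \<omega>
    = indicator (space M) \<omega> * measure (P t (Y s \<omega>)) A"
  proof (rule cond_exp_P[OF _ Y _ _ _ A t])
    show "subalgebra M F" using F sets_natural_filtration_G sp unfolding subalgebra_def by blast
    show "Y s \<omega> \<in> S" if "\<omega> \<in> space M" for \<omega> by (rule X_S[OF x0 that s])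
    show "space M \<in> sets F" using sets.top[of F] sp by simp
    fix B assume B: "B \<in> sets F"
    \<comment> \<open>A fixed time is a constant stopping time.\<close>
    have "{\<omega>\<in>B. ennreal s \<le> r} \<in> sets (natural_filtration M G r)" for r
      using B F natural_filtration_mono[of "ennreal s" r M G] by (cases "ennreal s \<le> r") auto
    from strong_markov_borel[of "\<lambda>_. ennreal s", OF _ this t Ab]
    have *: "(\<integral>\<^sup>+\<omega>. indicator A (Y (s + t) \<omega>) * indicator B \<omega> \<partial>M)
      = (\<integral>\<^sup>+\<omega>. (\<integral>\<^sup>+\<omega>'. indicator A (act (G t \<omega>') (Y s \<omega>)) \<partial>M) * indicator B \<omega> \<partial>M)"
      using s by simp
    have "B \<inter> space M = B" using sets.sets_into_space[OF B] sp by auto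
    with * show "(\<integral>\<^sup>+\<omega>. indicator A (Y (s + t) \<omega>) * indicator (B \<inter> space M) \<omega> \<partial>M)
      = (\<integral>\<^sup>+\<omega>. (\<integral>\<^sup>+\<omega>'. indicator A (act (G t \<omega>') (Y s \<omega>)) \<partial>M) * indicator (B \<inter> space M) \<omega> \<partial>M)"
      by simp
  qed simp
  then show ?thesis using AE_space by eventually_elim simp
qed

text \<open>The Markov property at the constant time \<open>s\<close> on the whole space.\<close>

lemma chapman_kolmogorov:
  assumes s: "0 \<le> s" and t: "0 \<le> t"
  shows "P (s + t) x0 = P s x0 \<bind> P t"
proof (rule measure_eqI)
  have Ps: "P s x0 \<in> space (prob_algebra (restrict_space borel S))"
    using measurable_space[OF P_measurable[OF s], of x0] x0 by (simp add: space_restrict_space)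
  have ne: "space (P s x0) \<noteq> {}" using x0 by (auto simp: P_def space_restrict_space)
  have setsPt: "sets (P s x0 \<bind> P t) = sets (restrict_space borel S)"
    by (rule sets_bind[OF _ ne]) (simp add: P_def)
  show "sets (P (s + t) x0) = sets (P s x0 \<bind> P t)" by (simp add: setsPt) (simp add: P_def)
  fix A assume "A \<in> sets (P (s + t) x0)"
  then have A: "A \<in> sets (restrict_space borel S)" by (simp add: P_def)
  then have Ab: "A \<in> sets borel" by (simp add: sets_restrict_S)
  have "{\<omega>\<in>space M. ennreal s \<le> r} \<in> sets (natural_filtration M G r)" for r
    using sets.top[of "natural_filtration M G r"] by (cases "ennreal s \<le> r") auto
  from strong_markov_borel[of "\<lambda>_. ennreal s", OF _ this t Ab]
  have *: "(\<integral>\<^sup>+\<omega>. indicator A (Y (s + t) \<omega>) * indicator (space M) \<omega> \<partial>M)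
    = (\<integral>\<^sup>+\<omega>. (\<integral>\<^sup>+\<omega>'. indicator A (act (G t \<omega>') (Y s \<omega>)) \<partial>M) * indicator (space M) \<omega> \<partial>M)"
    using s by simp
  have "emeasure (P (s + t) x0) A = (\<integral>\<^sup>+\<omega>. indicator A (Y (s + t) \<omega>) \<partial>M)"
    using s t by (subst emeasure_P[OF _ x0 A]) (auto simp: X_def[OF x0])
  also have "\<dots> = (\<integral>\<^sup>+\<omega>. indicator A (Y (s + t) \<omega>) * indicator (space M) \<omega> \<partial>M)"
    by (intro nn_integral_cong) simp
  also have "\<dots> = (\<integral>\<^sup>+\<omega>. emeasure (P t (Y s \<omega>)) A \<partial>M)"
    unfolding * by (intro nn_integral_cong) (simp add: emeasure_P[OF t X_S[OF x0 _ s] A])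
  also have "\<dots> = (\<integral>\<^sup>+w. emeasure (P t w) A \<partial>P s x0)"
  proof -
    have m: "(\<lambda>w. emeasure (P t w) A) \<in> borel_measurable (restrict_space borel S)"
      using measurable_emeasure_kernel[OF measurable_prob_algebraD[OF P_measurable[OF t]] A] .
    have "(\<integral>\<^sup>+w. emeasure (P t w) A \<partial>P s x0) = (\<integral>\<^sup>+\<omega>. emeasure (P t (act (G s \<omega>) x0)) A \<partial>M)"
      unfolding P_def[of s x0] using m by (intro nn_integral_distr act_G_measurable[OF s x0]) simp
    then show ?thesis by (simp add: X_def[OF x0])
  qed
  also have "\<dots> = emeasure (P s x0 \<bind> P t) A"
    by (rule emeasure_bind_prob_algebra[OF Ps P_measurable[OF t] A, symmetric])
  finally show "emeasure (P (s + t) x0) A = emeasure (P s x0 \<bind> P t) A" .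
qed

text \<open>An orbit reveals no more than \<open>G\<close>, so what holds relative to the history of
  \<open>G\<close> descends to the history of the orbit.\<close>

lemma X_filtration: "sets (natural_filtration M Y r) \<subseteq> sets (natural_filtration M G r)"
proof (rule sets_natural_filtration_le)
  fix s :: real assume "0 \<le> s" "ennreal s \<le> r"
  then have [measurable]: "G s \<in> borel_measurable (natural_filtration M G r)"
    by (rule measurable_natural_filtration)
  show "Y s \<in> borel_measurable (natural_filtration M G r)"
    unfolding X_def[OF x0] by measurable
qed simp

text \<open>On the event that \<open>\<tau>\<close> is at most \<open>r\<close>, the process stopped
  at \<open>r\<close> may replace the process. All of its variables belong to the history before
  \<open>r\<close>, and so does its value at the random time \<open>min \<tau> r\<close>.\<close>

lemma stopped_measurable:
  assumes st: "stopping_time (natural_filtration M Y) \<tau>"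
  shows "(\<lambda>\<omega>. Y (enn2real (\<tau> \<omega>)) \<omega>) \<in> borel_measurable (filtration.pre_sigma (space M) (natural_filtration M Y) \<tau>)"
proof -
  let ?F = "natural_filtration M Y"
  interpret Fl: filtration "space M" ?F by (rule filtration_natural_filtration)
  have le: "{\<omega>\<in>space M. \<tau> \<omega> \<le> r} \<in> sets (?F r)" for r
    using stopping_timeD[OF st, of r] by (simp add: Measurable.pred_def)
  have main: "{\<omega>\<in>space M. Y (enn2real (\<tau> \<omega>)) \<omega> \<in> C \<and> \<tau> \<omega> \<le> r} \<in> sets (?F r)" if C: "C \<in> sets borel" for C r
  proof -
    define T' where "T' \<omega> = enn2real (min (\<tau> \<omega>) r)" for \<omega>
    \<comment> \<open>For \<open>r = \<infinity>\<close> there is no stopping, and a case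
      distinction is needed since \<open>enn2real \<infinity>\<close> is 0.\<close>
    define X' where "X' u = (if r = \<infinity> then Y u else Y (min u (enn2real r)))" for u
    have "(\<lambda>\<omega>. min (\<tau> \<omega>) r) \<in> borel_measurable (?F r)"
    proof (rule borel_measurableI_le)
      fix a
      have "{\<omega>\<in>space (?F r). min (\<tau> \<omega>) r \<le> a} = (if r \<le> a then space M else {\<omega>\<in>space M. \<tau> \<omega> \<le> a})"
        by (auto simp: min_le_iff_disj)
      moreover have "space M \<in> sets (?F r)" using sets.top[of "?F r"] by simp
      moreover have "{\<omega>\<in>space M. \<tau> \<omega> \<le> a} \<in> sets (?F r)" if "\<not> r \<le> a"
      proof -
        have "a \<le> r" using that by simp
        from natural_filtration_mono[OF this, of M Y] le[of a] show ?thesis by blast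
      qed
      ultimately show "{\<omega>\<in>space (?F r). min (\<tau> \<omega>) r \<le> a} \<in> sets (?F r)" by (simp split: if_splits)
    qed
    then have T'm: "T' \<in> borel_measurable (?F r)" unfolding T'_def by measurable
    have X'm: "X' u \<in> borel_measurable (?F r)" if "0 \<le> u" for u
    proof (cases "r = \<infinity>")
      case True
      then show ?thesis using that by (auto simp: X'_def intro!: measurable_natural_filtration)
    next
      case False
      then obtain r' where r': "r = ennreal r'" "0 \<le> r'" by (cases r) auto
      then show ?thesis using that by (auto simp: X'_def intro!: measurable_natural_filtration ennreal_leI)
    qed
    have X'c: "continuous_on {0..} (\<lambda>u. X' u \<omega>)" if "\<omega> \<in> space (?F r)" for \<omega>
    proof -
      have c: "continuous_on {0..} (\<lambda>u. Y u \<omega>)" using X_continuous[OF x0] that by simp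
      have "continuous_on {0..} (\<lambda>u. Y (min u (enn2real r)) \<omega>)"
        by (rule continuous_on_compose2[OF c]) (auto intro!: continuous_intros)
      with c show ?thesis by (cases "r = \<infinity>") (simp_all add: X'_def)
    qed
    have m: "(\<lambda>\<omega>. X' (T' \<omega>) \<omega>) \<in> borel_measurable (?F r)"
      by (rule measurable_random_time[of "?F r" X' T', OF X'c X'm T'm]) (auto simp: T'_def)
    have "{\<omega>\<in>space M. X' (T' \<omega>) \<omega> \<in> C} \<in> sets (?F r)"
      using measurable_sets[OF m C] by (simp add: vimage_def Int_def conj_commute)
    then have "{\<omega>\<in>space M. X' (T' \<omega>) \<omega> \<in> C} \<inter> {\<omega>\<in>space M. \<tau> \<omega> \<le> r} \<in> sets (?F r)" using le[of r] by auto
    also have "{\<omega>\<in>space M. X' (T' \<omega>) \<omega> \<in> C} \<inter> {\<omega>\<in>space M. \<tau> \<omega> \<le> r} = {\<omega>\<in>space M. Y (enn2real (\<tau> \<omega>)) \<omega> \<in> C \<and> \<tau> \<omega> \<le> r}"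
    proof -
      have "X' (T' \<omega>) = Y (enn2real (\<tau> \<omega>))" if "\<tau> \<omega> \<le> r" for \<omega>
        using that by (auto simp: X'_def T'_def min_def top.not_eq_extremum antisym enn2real_mono)
      then show ?thesis by auto
    qed
    finally show ?thesis .
  qed
  show ?thesis
  proof (rule measurableI)
    fix C :: "'a set" assume C: "C \<in> sets borel"
    show "(\<lambda>\<omega>. Y (enn2real (\<tau> \<omega>)) \<omega>) -` C \<inter> space (Fl.pre_sigma \<tau>) \<in> sets (Fl.pre_sigma \<tau>)"
      unfolding Fl.space_pre_sigma
    proof (rule Fl.sets_pre_sigmaI[OF st])
      fix r
      have "{\<omega> \<in> (\<lambda>\<omega>. Y (enn2real (\<tau> \<omega>)) \<omega>) -` C \<inter> space M. \<tau> \<omega> \<le> r} = {\<omega>\<in>space M. Y (enn2real (\<tau> \<omega>)) \<omega> \<in> C \<and> \<tau> \<omega> \<le> r}" by auto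
      then show "{\<omega> \<in> (\<lambda>\<omega>. Y (enn2real (\<tau> \<omega>)) \<omega>) -` C \<inter> space M. \<tau> \<omega> \<le> r} \<in> sets (?F r)" using main[OF C] by simp
    qed
  qed simp
qed

lemma strong_markov_X: "strong_markov M S P Y"
  unfolding strong_markov_def
proof (intro allI impI ballI)
  fix \<tau> t A
  assume st: "stopping_time (natural_filtration M Y) \<tau>" and t: "0 \<le> (t::real)" and A: "A \<in> sets (restrict_space borel S)"
  let ?F = "natural_filtration M Y"
  interpret Fl: filtration "space M" ?F by (rule filtration_natural_filtration)
  have FM: "sets (?F r) \<subseteq> sets M" for r using X_filtration sets_natural_filtration_G by blast
  have \<tau>m: "\<tau> \<in> borel_measurable M"
    by (rule measurable_stopping_time[OF st]) (use FM in auto)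
  have Ab: "A \<in> sets borel" using A by (simp add: sets_restrict_S)
  let ?B0 = "{\<omega>\<in>space M. \<tau> \<omega> < \<infinity>}"
  have "AE \<omega> in M. real_cond_exp M (Fl.pre_sigma \<tau>) (indicator {\<omega>\<in>space M. \<omega> \<in> ?B0 \<and> Y (enn2real (\<tau> \<omega>) + t) \<omega> \<in> A}) \<omega>
    = indicator ?B0 \<omega> * measure (P t (Y (enn2real (\<tau> \<omega>)) \<omega>)) A"
  proof (rule cond_exp_P[OF _ stopped_measurable[OF st] _ _ _ A t])
    show "subalgebra M (Fl.pre_sigma \<tau>)"
      unfolding subalgebra_def
    proof (intro conjI subsetI)
      fix B assume "B \<in> sets (Fl.pre_sigma \<tau>)"
      from Fl.sets_pre_sigmaD[OF st this, of \<infinity>] FM show "B \<in> sets M" by auto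
    qed (simp add: Fl.space_pre_sigma)
    show "Y (enn2real (\<tau> \<omega>)) \<omega> \<in> S" if "\<omega> \<in> space M" for \<omega> by (rule X_S[OF x0 that]) simp
    show "(\<lambda>\<omega>. Y (enn2real (\<tau> \<omega>) + t) \<omega>) \<in> borel_measurable M"
      by (rule X_random_measurable[OF x0]) (use \<tau>m t in auto)
    have [measurable]: "\<tau> \<in> borel_measurable (Fl.pre_sigma \<tau>)" by (rule Fl.measurable_stopping_time_pre_sigma[OF st])
    have "{\<omega>\<in>space (Fl.pre_sigma \<tau>). \<tau> \<omega> < \<infinity>} \<in> sets (Fl.pre_sigma \<tau>)" by measurable
    then show "?B0 \<in> sets (Fl.pre_sigma \<tau>)" by (simp add: Fl.space_pre_sigma)
    fix B assume B: "B \<in> sets (Fl.pre_sigma \<tau>)"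
    have Br: "{\<omega>\<in>B. \<tau> \<omega> \<le> r} \<in> sets (natural_filtration M G r)" for r
      using Fl.sets_pre_sigmaD[OF st B, of r] X_filtration by blast
    have "B \<inter> ?B0 = {\<omega>\<in>B. \<tau> \<omega> < \<infinity>}" using sets.sets_into_space[OF B] by (auto simp: Fl.space_pre_sigma)
    then show "(\<integral>\<^sup>+\<omega>. indicator A (Y (enn2real (\<tau> \<omega>) + t) \<omega>) * indicator (B \<inter> ?B0) \<omega> \<partial>M)
      = (\<integral>\<^sup>+\<omega>. (\<integral>\<^sup>+\<omega>'. indicator A (act (G t \<omega>') (Y (enn2real (\<tau> \<omega>)) \<omega>)) \<partial>M) * indicator (B \<inter> ?B0) \<omega> \<partial>M)"
      using strong_markov_borel[OF \<tau>m Br t Ab] by simp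
  qed
  moreover have "{\<omega>\<in>space M. \<omega> \<in> ?B0 \<and> Y (enn2real (\<tau> \<omega>) + t) \<omega> \<in> A} = {\<omega>\<in>space M. \<tau> \<omega> < \<infinity> \<and> Y (enn2real (\<tau> \<omega>) + t) \<omega> \<in> A}"
    by auto
  ultimately have ae: "AE \<omega> in M. real_cond_exp M (Fl.pre_sigma \<tau>) (indicator {\<omega>\<in>space M. \<tau> \<omega> < \<infinity> \<and> Y (enn2real (\<tau> \<omega>) + t) \<omega> \<in> A}) \<omega>
    = indicator ?B0 \<omega> * measure (P t (Y (enn2real (\<tau> \<omega>)) \<omega>)) A"
    by simp
  show "AE \<omega> in M. \<tau> \<omega> < \<infinity> \<longrightarrow>
      real_cond_exp M (Fl.pre_sigma \<tau>) (indicator {\<omega>\<in>space M. \<tau> \<omega> < \<infinity> \<and> Y (enn2real (\<tau> \<omega>) + t) \<omega> \<in> A}) \<omega>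
      = measure (P t (Y (enn2real (\<tau> \<omega>)) \<omega>)) A"
    using ae AE_space by eventually_elim simp
qed

end

lemma transition_function_P: "transition_function S P"
  unfolding transition_function_def
proof (intro conjI allI impI ballI)
  show "P t \<in> restrict_space borel S \<rightarrow>\<^sub>M prob_algebra (restrict_space borel S)" if "0 \<le> t" for t
    by (rule P_measurable[OF that])
  show "P (s + t) z = P s z \<bind> P t" if "0 \<le> s" "0 \<le> t" "z \<in> S" for s t z
    by (rule chapman_kolmogorov[OF that(3,1,2)])
  fix z assume z: "z \<in> S"
  have zr: "z \<in> space (restrict_space borel S)" using z by (simp add: space_restrict_space)
  have "P 0 z = distr M (restrict_space borel S) (\<lambda>_. z)"
    unfolding P_def by (intro distr_cong refl) (simp add: G_0 act_id)
  also have "\<dots> = return (restrict_space borel S) z" by (rule distr_const[OF zr])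
  finally show "P 0 z = return (restrict_space borel S) z" .
qed

lemma diffusion_with_X: "x0 \<in> S \<Longrightarrow> diffusion_with M S P (X x0)"
  unfolding diffusion_with_def
  by (intro conjI allI impI ballI transition_function_P strong_markov_X X_continuous prob_space_axioms)
     (auto intro!: measurable_restrict_space2 X_measurable X_S)

end

section \<open>Calculus on the sphere\<close>

abbreviation (input) unit_sphere :: "'a::euclidean_space set" where
  "unit_sphere \<equiv> sphere 0 1"

text \<open>The unit speed geodesic from \<open>z\<close> in direction \<open>u\<close>, if these
  are orthonormal. It equals minus its second derivative, which is therefore normal to the
  sphere.\<close>

definition great_circle :: "'a::euclidean_space \<Rightarrow> 'a \<Rightarrow> real \<Rightarrow> 'a" where
  "great_circle z u s = cos s *\<^sub>R z + sin s *\<^sub>R u"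

definition great_circle' :: "'a::euclidean_space \<Rightarrow> 'a \<Rightarrow> real \<Rightarrow> 'a" where
  "great_circle' z u s = - sin s *\<^sub>R z + cos s *\<^sub>R u"

lemma great_circle_derivs:
  "(great_circle z u has_vector_derivative great_circle' z u s) (at s within T)"
  "(great_circle' z u has_vector_derivative - great_circle z u s) (at s within T)"
  unfolding great_circle_def[abs_def] great_circle'_def[abs_def] has_vector_derivative_def
  by (auto intro!: derivative_eq_intros simp: fun_eq_iff algebra_simps)

lemma great_circle_norm:
  assumes "norm z = 1" "norm u = 1" "u \<bullet> z = 0"
  shows "norm (great_circle z u s) = 1" "norm (great_circle' z u s) = 1"
    "great_circle' z u s \<bullet> great_circle z u s = 0"
proof -
  have [simp]: "z \<bullet> z = 1" "u \<bullet> u = 1" "z \<bullet> u = 0" using assms by (auto simp: norm_eq_1 inner_commute)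
  show "norm (great_circle z u s) = 1" "norm (great_circle' z u s) = 1" "great_circle' z u s \<bullet> great_circle z u s = 0"
    using sin_cos_squared_add[of s]
    by (auto simp: norm_eq_1 great_circle_def great_circle'_def inner_add_left inner_add_right inner_diff_left inner_diff_right assms power2_eq_square)
qed

lemma great_circle_chain:
  assumes z: "norm z = 1" "norm u = 1" "u \<bullet> z = 0"
    and V: "(V has_derivative D) (at (great_circle z u s) within unit_sphere)"
  shows "((\<lambda>s. V (great_circle z u s)) has_vector_derivative D (great_circle' z u s)) (at s)"
proof -
  have "range (great_circle z u) \<subseteq> unit_sphere" using great_circle_norm(1)[OF z] by auto
  from has_derivative_subset[OF V this]
  have "((\<lambda>s. V (great_circle z u s)) has_derivative (\<lambda>x. D (x *\<^sub>R great_circle' z u s))) (at s)"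
    using has_derivative_in_compose[OF great_circle_derivs(1)[unfolded has_vector_derivative_def, of z u s UNIV]] by simp
  moreover have "D (x *\<^sub>R y) = x *\<^sub>R D y" for x y
    using has_derivative_linear[OF V] by (rule linear_cmul)
  ultimately show ?thesis by (simp add: has_vector_derivative_def)
qed

text \<open>Each unit tangent vector is the initial velocity of a great circle, along which the
  chain rule determines the derivative.\<close>

lemma sphere_derivative_tangent_unique:
  assumes z: "norm z = 1" and D1: "(V has_derivative D1) (at z within unit_sphere)"
    and D2: "(V has_derivative D2) (at z within unit_sphere)" and h: "h \<bullet> z = 0"
  shows "D1 h = D2 h"
proof (cases "h = 0")
  case True
  then show ?thesis
    using linear_0[OF has_derivative_linear[OF D1]] linear_0[OF has_derivative_linear[OF D2]] by simp
next
  case False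
  define u where "u = (1 / norm h) *\<^sub>R h"
  have u: "norm u = 1" "u \<bullet> z = 0" using False h by (auto simp: u_def)
  have 0: "great_circle z u 0 = z" "great_circle' z u 0 = u"
    by (simp_all add: great_circle_def great_circle'_def)
  have "D1 u = D2 u"
    using great_circle_chain[OF z u, of V D1 0] great_circle_chain[OF z u, of V D2 0] D1 D2
    unfolding 0 by (blast intro: vector_derivative_unique_at)
  moreover have "h = norm h *\<^sub>R u" using False by (simp add: u_def)
  ultimately show ?thesis
    using linear_cmul[OF has_derivative_linear[OF D1], of "norm h" u]
      linear_cmul[OF has_derivative_linear[OF D2], of "norm h" u] by simp
qed

text \<open>On the sphere, \<open>w \<bullet> z - 1 = - (norm (w - z))\<^sup>2 / 2\<close>: normal components are of second order.\<close>

lemma sphere_normal_derivative: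
  assumes z: "norm z = 1"
  shows "((\<lambda>w. 0) has_derivative (\<lambda>h. (h \<bullet> z) *\<^sub>R e)) (at z within unit_sphere)"
proof (rule has_derivative_transform)
  show "((\<lambda>w. (w \<bullet> z - 1 + (w - z) \<bullet> (w - z) / 2) *\<^sub>R e) has_derivative (\<lambda>h. (h \<bullet> z) *\<^sub>R e)) (at z within unit_sphere)"
    by (auto intro!: derivative_eq_intros)
  show "z \<in> unit_sphere" using z by simp
  fix w :: 'a assume "w \<in> unit_sphere"
  then have "w \<bullet> z - 1 + (w - z) \<bullet> (w - z) / 2 = 0"
    using z by (simp add: norm_eq_1 inner_diff_left inner_diff_right inner_commute diff_divide_distrib)
  then show "0 = (w \<bullet> z - 1 + (w - z) \<bullet> (w - z) / 2) *\<^sub>R e" by simp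
qed

text \<open>Subtracting \<open>(h \<bullet> z) D0 z\<close> keeps a derivative within the sphere, by
  \<open>sphere_normal_derivative\<close>, and makes it vanish at \<open>z\<close>; its tangential
  part is determined.\<close>

lemma sphere_derivative_ex1:
  assumes z: "norm z = 1" and V: "V differentiable (at z within unit_sphere)"
  shows "\<exists>!D. D z = 0 \<and> (V has_derivative D) (at z within unit_sphere)"
proof -
  obtain D0 where D0: "(V has_derivative D0) (at z within unit_sphere)" using V by (auto simp: differentiable_def)
  have zz: "z \<bullet> z = 1" using z by (simp add: norm_eq_1)
  show ?thesis
  proof (rule ex1I)
    have "((\<lambda>w. V w - 0) has_derivative (\<lambda>h. D0 h - (h \<bullet> z) *\<^sub>R D0 z)) (at z within unit_sphere)"
      by (rule has_derivative_diff[OF D0 sphere_normal_derivative[OF z]])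
    then show "(\<lambda>h. D0 h - (h \<bullet> z) *\<^sub>R D0 z) z = 0 \<and> (V has_derivative (\<lambda>h. D0 h - (h \<bullet> z) *\<^sub>R D0 z)) (at z within unit_sphere)"
      by (simp add: zz)
    fix D assume D: "D z = 0 \<and> (V has_derivative D) (at z within unit_sphere)"
    show "D = (\<lambda>h. D0 h - (h \<bullet> z) *\<^sub>R D0 z)"
    proof
      fix h
      have lin: "linear D" "linear D0" using D D0 has_derivative_linear by auto
      have "D (h - (h \<bullet> z) *\<^sub>R z) = D0 (h - (h \<bullet> z) *\<^sub>R z)"
        by (rule sphere_derivative_tangent_unique[OF z _ D0]) (use D zz in \<open>auto simp: inner_diff_left\<close>)
      then show "D h = D0 h - (h \<bullet> z) *\<^sub>R D0 z"
        using D by (simp add: linear_diff[OF lin(1)] linear_diff[OF lin(2)] linear_cmul[OF lin(1)] linear_cmul[OF lin(2)])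
    qed
  qed
qed

lemma sphere_deriv_props:
  assumes "norm z = 1" "V differentiable (at z within unit_sphere)"
  shows "sphere_deriv V z z = 0" "(V has_derivative sphere_deriv V z) (at z within unit_sphere)"
  using theI'[OF sphere_derivative_ex1[OF assms]] unfolding sphere_deriv_def by auto

text \<open>Riesz representation of the normalized derivative; since this kills \<open>z\<close>,
  its representing vector is tangent. It makes the definite description meaningful.\<close>

lemma sphere_grad_props:
  fixes f :: "'a::euclidean_space \<Rightarrow> real"
  assumes z: "norm z = 1" and f: "f differentiable (at z within unit_sphere)"
  shows "sphere_grad f z \<bullet> z = 0" "(f has_derivative (\<lambda>h. sphere_grad f z \<bullet> h)) (at z within unit_sphere)"
proof -
  obtain D where D: "D z = 0" "(f has_derivative D) (at z within unit_sphere)"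
    using sphere_derivative_ex1[OF z f] by blast
  define v where "v = (\<Sum>b\<in>Basis. D b *\<^sub>R b)"
  have Dv: "D h = v \<bullet> h" for h
  proof -
    have "D h = D (\<Sum>b\<in>Basis. (h \<bullet> b) *\<^sub>R b)" by (simp add: euclidean_representation)
    also have "\<dots> = (\<Sum>b\<in>Basis. (h \<bullet> b) * D b)"
      using has_derivative_linear[OF D(2)] by (simp add: linear_sum linear_cmul)
    finally show ?thesis by (simp add: v_def inner_sum_left) (simp add: inner_commute mult.commute)
  qed
  have v: "v \<bullet> z = 0 \<and> (f has_derivative (\<lambda>h. v \<bullet> h)) (at z within unit_sphere)"
    using D Dv by (metis ext)
  have "sphere_grad f z \<bullet> z = 0 \<and> (f has_derivative (\<lambda>h. sphere_grad f z \<bullet> h)) (at z within unit_sphere)"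
    unfolding sphere_grad_def
  proof (rule theI)
    show "v \<bullet> z = 0 \<and> (f has_derivative (\<lambda>h. v \<bullet> h)) (at z within unit_sphere)" by (rule v)
    fix v' assume v': "v' \<bullet> z = 0 \<and> (f has_derivative (\<lambda>h. v' \<bullet> h)) (at z within unit_sphere)"
    have "(\<lambda>h. v' \<bullet> h) = (\<lambda>h. v \<bullet> h)"
      using sphere_derivative_ex1[OF z f] v v' by blast
    then have "v' \<bullet> (v' - v) = v \<bullet> (v' - v)" by meson
    then have "(v' - v) \<bullet> (v' - v) = 0" by (simp add: inner_diff_left)
    then show "v' = v" by simp
  qed
  then show "sphere_grad f z \<bullet> z = 0" "(f has_derivative (\<lambda>h. sphere_grad f z \<bullet> h)) (at z within unit_sphere)" by auto
qed

section \<open>Second order expansion\<close>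

text \<open>\<open>r\<close> is the geodesic distance. By Taylor,
  \<open>1 - cos r = cos t * r\<^sup>2 / 2\<close> with \<open>t < r\<close>, and
  \<open>norm (w - z) \<le> 1\<close> forces \<open>cos t \<ge> cos r \<ge> 1/2\<close>. As
  \<open>1 - cos r\<close> is half the squared chord, this bounds \<open>r\<close> by the
  chord.\<close>

lemma sphere_polar:
  fixes z w :: "'a::euclidean_space"
  assumes z: "norm z = 1" and w: "norm w = 1" and d: "norm (w - z) \<le> 1" and ne: "w \<noteq> z"
  obtains r u where "0 < r" "r\<^sup>2 \<le> 2 * (norm (w - z))\<^sup>2" "norm u = 1" "u \<bullet> z = 0" "w = great_circle z u r"
proof -
  define a where "a = w \<bullet> z"
  define r where "r = arccos a"
  have zz: "z \<bullet> z = 1" "w \<bullet> w = 1" using z w by (auto simp: norm_eq_1)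
  have d2: "(norm (w - z))\<^sup>2 = 2 - 2 * a"
    by (simp add: power2_norm_eq_inner inner_diff_left inner_diff_right zz a_def inner_commute)
  have "(norm (w - z))\<^sup>2 \<le> 1" using d by (simp add: power_le_one)
  then have a1: "1/2 \<le> a" using d2 by simp
  have "0 < (norm (w - z))\<^sup>2" using ne by simp
  then have a2: "a < 1" using d2 by linarith
  have cr: "cos r = a" unfolding r_def using a1 a2 by (intro cos_arccos) auto
  have r_pos: "0 < r" unfolding r_def using arccos_lt_bounded[of a] a1 a2 by auto
  have r_pi: "r < pi" unfolding r_def using arccos_lt_bounded[of a] a1 a2 by auto
  have sr: "sin r > 0" using r_pos r_pi by (rule sin_gt_zero)
  define u where "u = (1 / sin r) *\<^sub>R (w - a *\<^sub>R z)"
  have "(w - a *\<^sub>R z) \<bullet> (w - a *\<^sub>R z) = 1 - a\<^sup>2"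
    by (simp add: inner_diff_left inner_diff_right zz inner_commute[of z w] flip: a_def) (simp add: power2_eq_square)
  also have "\<dots> = (sin r)\<^sup>2" using sin_cos_squared_add[of r] by (simp add: cr)
  finally have "norm (w - a *\<^sub>R z) = sin r" using sr by (simp add: norm_eq_sqrt_inner)
  then have u1: "norm u = 1" using sr by (simp add: u_def)
  have u2: "u \<bullet> z = 0" by (simp add: u_def inner_diff_left zz a_def)
  have wc: "w = great_circle z u r" using sr by (simp add: great_circle_def u_def cr)
  define diff :: "nat \<Rightarrow> real \<Rightarrow> real" where "diff m = (if m = 0 then (\<lambda>x. 1 - cos x) else if m = 1 then sin else cos)" for m
  have "\<exists>t>0. t < r \<and> 1 - cos r = (\<Sum>m<2. diff m 0 / fact m * r ^ m) + diff 2 t / fact 2 * r ^ 2"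
  proof (rule Maclaurin[OF r_pos, of 2 diff "\<lambda>x. 1 - cos x"])
    show "\<forall>m t. m < 2 \<and> 0 \<le> t \<and> t \<le> r \<longrightarrow> (diff m has_real_derivative diff (Suc m) t) (at t)"
      by (auto simp: diff_def less_2_cases_iff intro!: derivative_eq_intros)
  qed (auto simp: diff_def)
  then obtain t where t: "0 < t" "t < r" "1 - cos r = cos t / 2 * r\<^sup>2"
    by (auto simp: diff_def numeral_2_eq_2)
  have "cos r \<le> cos t" using t r_pi by (intro cos_monotone_0_pi_le) auto
  then have "1/2 / 2 * r\<^sup>2 \<le> cos t / 2 * r\<^sup>2" using a1 cr by (intro mult_right_mono) auto
  then have "r\<^sup>2 \<le> 2 * (norm (w - z))\<^sup>2" using t(3) d2 cr by simp
  with r_pos u1 u2 wc show ?thesis by (intro that)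
qed

lemma great_circle_close:
  assumes "norm z = 1" "norm u = 1" "0 \<le> s"
  shows "norm (great_circle z u s - z) \<le> 2 * s" "norm (great_circle' z u s - u) \<le> 2 * s"
proof -
  have s1: "\<bar>sin s\<bar> \<le> s" using abs_sin_x_le_abs_x[of s] assms by simp
  have c1: "\<bar>cos s - 1\<bar> \<le> s"
  proof -
    have "\<bar>cos s - 1\<bar> = 2 * (sin (s / 2))\<^sup>2" using cos_double_sin[of "s / 2"] by simp
    moreover have "(sin (s / 2))\<^sup>2 \<le> \<bar>sin (s / 2)\<bar>"
      using mult_left_mono[OF abs_sin_le_one[of "s/2"], of "\<bar>sin (s/2)\<bar>"] by (simp add: power2_eq_square flip: abs_mult)
    moreover have "\<bar>sin (s / 2)\<bar> \<le> s / 2" using abs_sin_x_le_abs_x[of "s/2"] assms by simp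
    ultimately show ?thesis by linarith
  qed
  have "norm (great_circle z u s - z) = norm ((cos s - 1) *\<^sub>R z + sin s *\<^sub>R u)" by (simp add: great_circle_def algebra_simps)
  also have "\<dots> \<le> \<bar>cos s - 1\<bar> + \<bar>sin s\<bar>" using norm_triangle_ineq[of "(cos s - 1) *\<^sub>R z" "sin s *\<^sub>R u"] assms by simp
  finally show "norm (great_circle z u s - z) \<le> 2 * s" using s1 c1 by linarith
  have "norm (great_circle' z u s - u) = norm ((- sin s) *\<^sub>R z + (cos s - 1) *\<^sub>R u)" by (simp add: great_circle'_def algebra_simps)
  also have "\<dots> \<le> \<bar>sin s\<bar> + \<bar>cos s - 1\<bar>" using norm_triangle_ineq[of "(- sin s) *\<^sub>R z" "(cos s - 1) *\<^sub>R u"] assms by simp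
  finally show "norm (great_circle' z u s - u) \<le> 2 * s" using s1 c1 by linarith
qed

lemma sphere_C2_grad:
  assumes f: "sphere_C2 f" and z: "norm z = 1"
  shows "sphere_grad f z \<bullet> z = 0" "(f has_derivative (\<lambda>h. sphere_grad f z \<bullet> h)) (at z within unit_sphere)"
    "sphere_deriv (sphere_grad f) z z = 0"
    "(sphere_grad f has_derivative sphere_deriv (sphere_grad f) z) (at z within unit_sphere)"
proof -
  have "f differentiable (at z within unit_sphere)" "sphere_grad f differentiable (at z within unit_sphere)"
    using f z by (auto simp: sphere_C2_def differentiable_on_def)
  then show "sphere_grad f z \<bullet> z = 0" "(f has_derivative (\<lambda>h. sphere_grad f z \<bullet> h)) (at z within unit_sphere)"
    "sphere_deriv (sphere_grad f) z z = 0"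
    "(sphere_grad f has_derivative sphere_deriv (sphere_grad f) z) (at z within unit_sphere)"
    using sphere_grad_props[OF z] sphere_deriv_props[OF z] by auto
qed

text \<open>Differentiating the gradient paired with the velocity yields the derivative of the
  gradient plus a term with the acceleration. The latter vanishes because the gradient is tangent
  and the acceleration normal.\<close>

lemma sphere_C2_taylor:
  assumes f: "sphere_C2 f" and z: "norm z = 1" "norm u = 1" "u \<bullet> z = 0" and r: "0 < r"
  shows "\<exists>s>0. s < r \<and> f (great_circle z u r) = f z + r * (sphere_grad f z \<bullet> u)
    + r\<^sup>2 / 2 * (sphere_deriv (sphere_grad f) (great_circle z u s) (great_circle' z u s) \<bullet> great_circle' z u s)"
proof -
  let ?c = "great_circle z u" and ?c' = "great_circle' z u" and ?N = "sphere_grad f"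
  let ?D = "sphere_deriv (sphere_grad f)"
  note c1 = great_circle_norm(1)[OF z]
  note props = sphere_C2_grad[OF f c1]
  define diff :: "nat \<Rightarrow> real \<Rightarrow> real" where
    "diff m = (if m = 0 then (\<lambda>s. f (?c s)) else if m = 1 then (\<lambda>s. ?N (?c s) \<bullet> ?c' s) else (\<lambda>s. ?D (?c s) (?c' s) \<bullet> ?c' s))" for m
  have d0: "((\<lambda>s. f (?c s)) has_real_derivative ?N (?c s) \<bullet> ?c' s) (at s)" for s
    using great_circle_chain[OF z props(2)] by (simp add: has_real_derivative_iff_has_vector_derivative)
  have d1: "((\<lambda>s. ?N (?c s) \<bullet> ?c' s) has_real_derivative ?D (?c s) (?c' s) \<bullet> ?c' s) (at s)" for s
  proof -
    have "((\<lambda>s. ?N (?c s) \<bullet> ?c' s) has_vector_derivative ?N (?c s) \<bullet> (- ?c s) + ?D (?c s) (?c' s) \<bullet> ?c' s) (at s)"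
      by (rule bounded_bilinear.has_vector_derivative[OF bounded_bilinear_inner great_circle_chain[OF z props(4)] great_circle_derivs(2)])
    then show ?thesis by (simp add: has_real_derivative_iff_has_vector_derivative props(1))
  qed
  have "\<exists>t>0. t < r \<and> f (?c r) = (\<Sum>m<2. diff m 0 / fact m * r ^ m) + diff 2 t / fact 2 * r ^ 2"
  proof (rule Maclaurin[OF r, of 2 diff "\<lambda>s. f (?c s)"])
    show "\<forall>m t. m < 2 \<and> 0 \<le> t \<and> t \<le> r \<longrightarrow> (diff m has_real_derivative diff (Suc m) t) (at t)"
      using d0 d1 by (auto simp: diff_def less_2_cases_iff)
  qed (auto simp: diff_def)
  then show ?thesis
    by (auto simp: diff_def numeral_2_eq_2 great_circle_def great_circle'_def mult.commute)
qed

lemma continuous_on_sphere_bounded: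
  fixes g :: "'a::euclidean_space \<Rightarrow> 'b::real_normed_vector"
  assumes "continuous_on unit_sphere g"
  shows "\<exists>K. \<forall>z. norm z = 1 \<longrightarrow> norm (g z) \<le> K"
proof -
  have "compact (g ` unit_sphere)" by (intro compact_continuous_image assms compact_sphere)
  then have "bounded (g ` unit_sphere)" by (rule compact_imp_bounded)
  then obtain K where "\<forall>y\<in>g ` unit_sphere. norm y \<le> K" unfolding bounded_iff by blast
  then show ?thesis by (intro exI[of _ K]) auto
qed

lemma linear_bound_Basis:
  fixes L :: "'a::euclidean_space \<Rightarrow> 'b::real_normed_vector"
  assumes L: "linear L" and b: "\<And>b. b \<in> Basis \<Longrightarrow> norm (L b) \<le> e"
  shows "norm (L h) \<le> real DIM('a) * e * norm h"
proof -
  have "L h = L (\<Sum>b\<in>Basis. (h \<bullet> b) *\<^sub>R b)" by (simp add: euclidean_representation)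
  also have "\<dots> = (\<Sum>b\<in>Basis. (h \<bullet> b) *\<^sub>R L b)" using L by (simp add: linear_sum linear_cmul)
  also have "norm \<dots> \<le> (\<Sum>b\<in>(Basis :: 'a set). norm h * e)"
    by (rule order_trans[OF norm_sum sum_mono]) (auto intro!: mult_mono Basis_le_norm b)
  finally show ?thesis by (simp add: mult_ac)
qed

text \<open>Compactness of the sphere, applied to each of the finitely many basis directions;
  linearity in \<open>h\<close> extends the bounds to all directions.\<close>

lemma sphere_C2_bounds:
  assumes f: "sphere_C2 (f :: 'a::euclidean_space \<Rightarrow> real)"
  shows "\<exists>K\<ge>1. \<forall>z. norm z = 1 \<longrightarrow> \<bar>f z\<bar> \<le> K \<and> norm (sphere_grad f z) \<le> K \<and> (\<forall>h. norm (sphere_deriv (sphere_grad f) z h) \<le> K * norm h)"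
    and "0 < e \<Longrightarrow> \<exists>\<delta>>0. \<forall>z w h. norm z = 1 \<longrightarrow> norm w = 1 \<longrightarrow> norm (w - z) < \<delta> \<longrightarrow>
      norm (sphere_deriv (sphere_grad f) w h - sphere_deriv (sphere_grad f) z h) \<le> e * norm h"
proof -
  let ?D = "sphere_deriv (sphere_grad f)"
  have cD: "continuous_on unit_sphere (\<lambda>z. ?D z h)" for h using f by (simp add: sphere_C2_def)
  have lin: "linear (?D z)" if "norm z = 1" for z
    using sphere_C2_grad(4)[OF f that] by (rule has_derivative_linear)
  have "continuous_on unit_sphere f" "continuous_on unit_sphere (sphere_grad f)"
    using f by (auto simp: sphere_C2_def intro: differentiable_imp_continuous_on)
  then obtain K1 K2 where K1: "\<And>z. norm z = 1 \<Longrightarrow> norm (f z) \<le> K1" and K2: "\<And>z. norm z = 1 \<Longrightarrow> norm (sphere_grad f z) \<le> K2"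
    using continuous_on_sphere_bounded[of f] continuous_on_sphere_bounded[of "sphere_grad f"] by blast
  have "\<forall>b. \<exists>K. \<forall>z. norm z = 1 \<longrightarrow> norm (?D z b) \<le> K" using continuous_on_sphere_bounded[OF cD] by blast
  then obtain k where k: "\<And>b z. norm z = 1 \<Longrightarrow> norm (?D z b) \<le> k b" by metis
  define K3 where "K3 = (\<Sum>b\<in>Basis. \<bar>k b\<bar>)"
  have K3: "norm (?D z h) \<le> real DIM('a) * K3 * norm h" if "norm z = 1" for z h
  proof (rule linear_bound_Basis[OF lin[OF that]])
    fix b :: 'a assume b: "b \<in> Basis"
    have "norm (?D z b) \<le> \<bar>k b\<bar>" using k[OF that, of b] by simp
    also have "\<dots> \<le> K3" unfolding K3_def using b by (intro member_le_sum) auto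
    finally show "norm (?D z b) \<le> K3" .
  qed
  define K where "K = 1 + \<bar>K1\<bar> + \<bar>K2\<bar> + real DIM('a) * K3"
  have K30: "0 \<le> K3" unfolding K3_def by (rule sum_nonneg) simp
  have "1 \<le> K \<and> (\<forall>z. norm z = 1 \<longrightarrow> \<bar>f z\<bar> \<le> K \<and> norm (sphere_grad f z) \<le> K \<and> (\<forall>h. norm (?D z h) \<le> K * norm h))"
  proof (intro conjI allI impI)
    show "1 \<le> K" using K30 by (simp add: K_def)
    fix z :: 'a assume z: "norm z = 1"
    have "0 \<le> real DIM('a) * K3" using K30 by simp
    then show "\<bar>f z\<bar> \<le> K" "norm (sphere_grad f z) \<le> K" using K1[OF z] K2[OF z] by (auto simp: K_def)
    fix h :: 'a
    have "real DIM('a) * K3 * norm h \<le> K * norm h" by (intro mult_right_mono) (auto simp: K_def)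
    with K3[OF z, of h] show "norm (?D z h) \<le> K * norm h" by simp
  qed
  then show "\<exists>K\<ge>1. \<forall>z. norm z = 1 \<longrightarrow> \<bar>f z\<bar> \<le> K \<and> norm (sphere_grad f z) \<le> K \<and> (\<forall>h. norm (?D z h) \<le> K * norm h)" by blast
  assume e: "0 < e"
  define e' where "e' = e / real DIM('a)"
  have e': "0 < e'" using e by (simp add: e'_def)
  have "\<forall>b. \<exists>\<delta>>0. \<forall>z\<in>unit_sphere. \<forall>w\<in>unit_sphere. dist w z < \<delta> \<longrightarrow> dist (?D w b) (?D z b) < e'"
    using compact_uniformly_continuous[OF cD compact_sphere] e' unfolding uniformly_continuous_on_def by blast
  from choice[OF this] obtain \<delta> where d: "\<forall>b. 0 < \<delta> b \<and> (\<forall>z\<in>unit_sphere. \<forall>w\<in>unit_sphere. dist w z < \<delta> b \<longrightarrow> dist (?D w b) (?D z b) < e')"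
    by blast
  have \<delta>: "0 < \<delta> b" "norm z = 1 \<Longrightarrow> norm w = 1 \<Longrightarrow> norm (w - z) < \<delta> b \<Longrightarrow> norm (?D w b - ?D z b) < e'" for b z w
    using d[THEN spec, of b] by (auto simp: dist_norm)
  show "\<exists>\<delta>>0. \<forall>z w h. norm z = 1 \<longrightarrow> norm w = 1 \<longrightarrow> norm (w - z) < \<delta> \<longrightarrow> norm (?D w h - ?D z h) \<le> e * norm h"
  proof (intro exI[of _ "Min (\<delta> ` Basis)"] conjI allI impI)
    show "0 < Min (\<delta> ` Basis)" using \<delta>(1) by (subst Min_gr_iff) auto
    fix z w h :: 'a assume zw: "norm z = 1" "norm w = 1" "norm (w - z) < Min (\<delta> ` Basis)"
    have "norm ((\<lambda>h. ?D w h - ?D z h) h) \<le> real DIM('a) * e' * norm h"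
    proof (rule linear_bound_Basis)
      show "linear (\<lambda>h. ?D w h - ?D z h)" by (intro linear_compose_sub lin zw)
      fix b :: 'a assume "b \<in> Basis"
      then have "norm (w - z) < \<delta> b" using zw(3) by simp
      from less_imp_le[OF \<delta>(2)[OF zw(1,2) this]] show "norm (?D w b - ?D z b) \<le> e'" .
    qed
    then show "norm (?D w h - ?D z h) \<le> e * norm h" by (simp add: e'_def)
  qed
qed

lemma sin_cos_small:
  fixes r :: real
  assumes r: "0 \<le> r" "r \<le> 2"
  shows "\<bar>r - sin r\<bar> \<le> r ^ 3" "\<bar>r\<^sup>2 - (sin r)\<^sup>2\<bar> \<le> r ^ 3" "\<bar>sin r * (cos r - 1)\<bar> \<le> r ^ 3"
proof -
  have s: "\<bar>sin r\<bar> \<le> r" using abs_sin_x_le_abs_x[of r] r by simp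
  have "\<bar>sin r - (\<Sum>m<3. sin_coeff m * r ^ m)\<bar> \<le> inverse (fact 3) * \<bar>r\<bar> ^ 3" by (rule Maclaurin_sin_bound)
  moreover have "(\<Sum>m<3. sin_coeff m * r ^ m) = r" by (simp add: sin_coeff_def numeral_3_eq_3)
  ultimately have b: "\<bar>r - sin r\<bar> \<le> r ^ 3 / 6" using r by (simp add: fact_numeral abs_minus_commute)
  have r3: "0 \<le> r ^ 3" using r by simp
  show "\<bar>r - sin r\<bar> \<le> r ^ 3" using b r3 by linarith
  have "\<bar>r\<^sup>2 - (sin r)\<^sup>2\<bar> = \<bar>r - sin r\<bar> * \<bar>r + sin r\<bar>" by (simp add: power2_eq_square square_diff_square_factored abs_mult mult.commute)
  also have "\<dots> \<le> (r ^ 3 / 6) * 4" using b s r by (intro mult_mono) auto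
  also have "\<dots> \<le> r ^ 3" using r3 by simp
  finally show "\<bar>r\<^sup>2 - (sin r)\<^sup>2\<bar> \<le> r ^ 3" .
  have "cos r - 1 = - 2 * (sin (r / 2))\<^sup>2" using cos_double_sin[of "r / 2"] by simp
  moreover have "(sin (r / 2))\<^sup>2 \<le> (r / 2)\<^sup>2"
    using power_mono[OF abs_sin_x_le_abs_x[of "r / 2"] abs_ge_zero, of 2] by (simp only: power2_abs)
  moreover have "0 \<le> (sin (r / 2))\<^sup>2" "(r / 2)\<^sup>2 = r\<^sup>2 / 4" by (simp_all add: power_divide)
  ultimately have "\<bar>cos r - 1\<bar> \<le> r\<^sup>2" using zero_le_power2[of r] by linarith
  then have "\<bar>sin r * (cos r - 1)\<bar> \<le> r * r\<^sup>2" unfolding abs_mult using s r by (intro mult_mono) auto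
  then show "\<bar>sin r * (cos r - 1)\<bar> \<le> r ^ 3" by (simp add: power2_eq_square power3_eq_cube)
qed

text \<open>The polynomial is written in \<open>w\<close> and not in polar coordinates, so that its
  mean over \<open>w = G t z\<close> follows from exact moments. Pairing with \<open>w - z\<close>
  instead of \<open>w\<close> matters: the derivative of the gradient has a normal component, which
  would leave a first order term. Far from \<open>z\<close> the remainder is bounded by
  \<open>4 K\<close> and absorbed by the fourth power.\<close>

lemma sphere_C2_remainder:
  fixes f :: "'a::euclidean_space \<Rightarrow> real"
  assumes f: "sphere_C2 f" and e: "0 < e"
  shows "\<exists>C\<ge>0. \<forall>z w. norm z = 1 \<longrightarrow> norm w = 1 \<longrightarrow>
    \<bar>f w - f z - sphere_grad f z \<bullet> w - (sphere_deriv (sphere_grad f) z w \<bullet> (w - z)) / 2\<bar>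
      \<le> e * (norm (w - z))\<^sup>2 + C * (norm (w - z))^4"
proof -
  let ?N = "sphere_grad f" and ?D = "sphere_deriv (sphere_grad f)"
  let ?R = "\<lambda>z w. \<bar>f w - f z - ?N z \<bullet> w - (?D z w \<bullet> (w - z)) / 2\<bar>"
  obtain K where K: "1 \<le> K" "\<And>z. norm z = 1 \<Longrightarrow> \<bar>f z\<bar> \<le> K" "\<And>z. norm z = 1 \<Longrightarrow> norm (?N z) \<le> K"
    "\<And>z h. norm z = 1 \<Longrightarrow> norm (?D z h) \<le> K * norm h"
    using sphere_C2_bounds(1)[OF f] by blast
  obtain \<delta>1 where \<delta>1: "0 < \<delta>1" "\<And>z w h. norm z = 1 \<Longrightarrow> norm w = 1 \<Longrightarrow> norm (w - z) < \<delta>1 \<Longrightarrow> norm (?D w h - ?D z h) \<le> (e / 2) * norm h"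
    using sphere_C2_bounds(2)[OF f, of "e / 2"] e by (auto simp: half_gt_zero_iff)
  \<comment> \<open>The bound 1 serves \<open>sphere_polar\<close>. The intermediate point is within
    \<open>2 s < 2 r \<le> 4 d\<close> of \<open>z\<close>, whence \<open>\<delta>1 / 4\<close>. The
    last bound gives \<open>8 K d \<le> e / 4\<close> in the final estimate.\<close>
  define \<delta> where "\<delta> = min 1 (min (\<delta>1 / 4) (e / (32 * K)))"
  have \<delta>: "0 < \<delta>" "\<delta> \<le> 1" "\<delta> \<le> \<delta>1 / 4" "\<delta> \<le> e / (32 * K)" using \<delta>1(1) e K(1) by (auto simp: \<delta>_def)
  have in_le: "\<bar>x \<bullet> y\<bar> \<le> a * b" if "norm x \<le> a" "norm y \<le> b" for x y :: 'a and a b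
    by (rule order_trans[OF Cauchy_Schwarz_ineq2 mult_mono[OF that(1) that(2) order_trans[OF norm_ge_zero that(1)] norm_ge_zero]])
  have abs_sum_bound: "\<bar>x\<bar> \<le> a' + (b' + c' + d') / 2"
    if "x = a + (b + c - d) / 2" "\<bar>a\<bar> \<le> a'" "\<bar>c\<bar> \<le> c'" "\<bar>d\<bar> \<le> d'" "\<bar>b\<bar> \<le> b'"
    for x a b c d a' b' c' d' :: real
    using that by (auto simp: abs_le_iff field_simps)
  have near: "?R z w \<le> e * (norm (w - z))\<^sup>2" if z: "norm z = 1" and w: "norm w = 1" and d: "norm (w - z) < \<delta>" for z w
  proof (cases "w = z")
    case True
    then show ?thesis using sphere_C2_grad[OF f z] by simp
  next
    case False
    define d where "d = norm (w - z)"
    have dd: "0 \<le> d" "d < \<delta>" "d \<le> 1" using d \<delta> by (auto simp: d_def)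
    obtain r u where r: "0 < r" "r\<^sup>2 \<le> 2 * d\<^sup>2" and u: "norm u = 1" "u \<bullet> z = 0" and wr: "w = great_circle z u r"
      using sphere_polar[OF z w _ False] dd unfolding d_def by metis
    have "r\<^sup>2 \<le> 4 * d\<^sup>2" using r(2) zero_le_power2[of d] by linarith
    then have "r\<^sup>2 \<le> (2 * d)\<^sup>2" by (simp add: power_mult_distrib)
    then have r2d: "r \<le> 2 * d" by (rule power2_le_imp_le) (simp add: dd)
    then have r2: "r \<le> 2" using dd by linarith
    obtain s where s: "0 < s" "s < r" and fw: "f w = f z + r * (?N z \<bullet> u)
      + r\<^sup>2 / 2 * (?D (great_circle z u s) (great_circle' z u s) \<bullet> great_circle' z u s)"
      using sphere_C2_taylor[OF f z u r(1)] unfolding wr by blast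
    define c where "c = great_circle z u s"
    define X where "X = great_circle' z u s"
    have c: "norm c = 1" "norm X = 1" unfolding c_def X_def using great_circle_norm[OF z u] by auto
    have cl: "norm (c - z) \<le> 2 * s" "norm (X - u) \<le> 2 * s"
      unfolding c_def X_def using great_circle_close[OF z u(1), of s] s by auto
    define Q where "Q = ?D c X \<bullet> X"
    define q where "q = ?D z u \<bullet> u"
    define p where "p = ?D z u \<bullet> z"
    define \<nu> where "\<nu> = ?N z \<bullet> u"
    have lin: "linear (?D z)" using sphere_C2_grad(4)[OF f z] by (rule has_derivative_linear)
    have Du: "norm (?D z u) \<le> K" using K(4)[OF z, of u] u by simp
    have qb: "\<bar>q\<bar> \<le> K" unfolding q_def using in_le[OF Du, of u 1] u by simp
    have pb: "\<bar>p\<bar> \<le> K" unfolding p_def using in_le[OF Du, of z 1] z by simp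
    have \<nu>b: "\<bar>\<nu>\<bar> \<le> K" unfolding \<nu>_def using in_le[OF K(3)[OF z], of u 1] u by simp
    have Qq: "\<bar>Q - q\<bar> \<le> e / 2 + 4 * K * r"
    proof -
      have "norm (c - z) < \<delta>1" using cl(1) s r2d dd \<delta>(3) by linarith
      then have "norm (?D c X - ?D z X) \<le> e / 2" using \<delta>1(2)[OF z c(1), of X] c by simp
      from in_le[OF this, of X 1] have 1: "\<bar>(?D c X - ?D z X) \<bullet> X\<bar> \<le> e / 2" using c by simp
      have DX: "norm (?D z (X - u)) \<le> K * (2 * s)"
        by (rule order_trans[OF K(4)[OF z] mult_left_mono[OF cl(2)]]) (use K(1) in simp)
      from in_le[OF DX, of X 1] have 2: "\<bar>?D z (X - u) \<bullet> X\<bar> \<le> 2 * K * s" using c by simp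
      from in_le[OF Du cl(2)] have 3: "\<bar>?D z u \<bullet> (X - u)\<bar> \<le> 2 * K * s" by simp
      have "Q - q = (?D c X - ?D z X) \<bullet> X + ?D z (X - u) \<bullet> X + ?D z u \<bullet> (X - u)"
        unfolding Q_def q_def linear_diff[OF lin] by (simp add: inner_diff_left inner_diff_right)
      moreover have "4 * K * s \<le> 4 * K * r" using s K(1) by simp
      ultimately show ?thesis using 1 2 3 by linarith
    qed
    have w1: "?N z \<bullet> w = sin r * \<nu>"
      using sphere_C2_grad(1)[OF f z] by (simp add: wr great_circle_def inner_add_right \<nu>_def)
    have "?D z w = sin r *\<^sub>R ?D z u"
      using sphere_C2_grad(3)[OF f z] by (simp add: wr great_circle_def linear_add[OF lin] linear_cmul[OF lin])
    \<comment> \<open>The normal component \<open>p\<close> survives only with the factor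
      \<open>sin r (cos r - 1)\<close>, which is of third order.\<close>
    then have w2: "?D z w \<bullet> (w - z) = sin r * (cos r - 1) * p + (sin r)\<^sup>2 * q"
      by (simp add: wr great_circle_def inner_diff_right inner_add_right p_def q_def power2_eq_square algebra_simps)
    have "f w - f z - ?N z \<bullet> w - (?D z w \<bullet> (w - z)) / 2
      = (r - sin r) * \<nu> + (r\<^sup>2 * (Q - q) + (r\<^sup>2 - (sin r)\<^sup>2) * q - sin r * (cos r - 1) * p) / 2"
    proof -
      have "(F + r * n + r\<^sup>2 / 2 * q') - F - S * n - (S * c' * p' + S\<^sup>2 * q'') / 2
        = (r - S) * n + (r\<^sup>2 * (q' - q'') + (r\<^sup>2 - S\<^sup>2) * q'' - S * c' * p') / 2" for F n q' S c' p' q'' :: real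
        by (simp add: algebra_simps add_divide_distrib diff_divide_distrib)
      moreover have "f w = f z + r * \<nu> + r\<^sup>2 / 2 * Q" unfolding fw Q_def c_def X_def \<nu>_def ..
      ultimately show ?thesis unfolding w1 w2 by (simp only:)
    qed
    moreover have "\<bar>(r - sin r) * \<nu>\<bar> \<le> r ^ 3 * K" "\<bar>(r\<^sup>2 - (sin r)\<^sup>2) * q\<bar> \<le> r ^ 3 * K" "\<bar>sin r * (cos r - 1) * p\<bar> \<le> r ^ 3 * K"
      using sin_cos_small[OF less_imp_le[OF r(1)] r2] \<nu>b qb pb r(1)
      unfolding abs_mult[of _ \<nu>] abs_mult[of _ q] abs_mult[of _ p] by (auto intro!: mult_mono)
    moreover have "\<bar>r\<^sup>2 * (Q - q)\<bar> \<le> r\<^sup>2 * (e / 2 + 4 * K * r)"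
      unfolding abs_mult using Qq by (intro mult_mono) auto
    ultimately have "?R z w \<le> r ^ 3 * K + (r\<^sup>2 * (e / 2 + 4 * K * r) + r ^ 3 * K + r ^ 3 * K) / 2"
      by (rule abs_sum_bound)
    also have "\<dots> = r\<^sup>2 * (e / 4 + 4 * K * r)" by (simp add: power2_eq_square power3_eq_cube algebra_simps)
    also have "\<dots> \<le> (2 * d\<^sup>2) * (e / 4 + 4 * K * (2 * d))"
      using r r2d K(1) e dd by (intro mult_mono add_mono) auto
    also have "\<dots> \<le> (2 * d\<^sup>2) * (e / 2)"
    proof -
      have "d \<le> e / (32 * K)" using dd \<delta>(4) by linarith
      then have "32 * K * d \<le> e" using K(1) by (simp add: pos_le_divide_eq mult.commute)
      then show ?thesis by (intro mult_left_mono) auto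
    qed
    finally show ?thesis by (simp add: d_def mult.commute)
  qed
  have far: "?R z w \<le> 4 * K / \<delta> ^ 4 * (norm (w - z))^4" if z: "norm z = 1" and w: "norm w = 1" and d: "\<delta> \<le> norm (w - z)" for z w
  proof -
    have "norm (w - z) \<le> 2" using norm_triangle_ineq4[of w z] z w by simp
    from in_le[OF K(4)[OF z, of w] this] have "\<bar>?D z w \<bullet> (w - z)\<bar> \<le> K * 2" using w by simp
    moreover from in_le[OF K(3)[OF z], of w 1] have "\<bar>?N z \<bullet> w\<bar> \<le> K" using w by simp
    ultimately have "?R z w \<le> 4 * K" using K(2)[OF z] K(2)[OF w] by linarith
    also have "\<dots> \<le> 4 * K / \<delta> ^ 4 * (norm (w - z))^4"
    proof -
      have "\<delta> ^ 4 \<le> (norm (w - z))^4" using d \<delta>(1) by (intro power_mono) auto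
      then have "4 * K * \<delta> ^ 4 \<le> 4 * K * (norm (w - z))^4" using K(1) by (intro mult_left_mono) auto
      then show ?thesis using \<delta>(1) by (simp add: pos_le_divide_eq)
    qed
    finally show ?thesis .
  qed
  have C0: "0 \<le> 4 * K / \<delta> ^ 4" using K(1) \<delta>(1) by simp
  have "?R z w \<le> e * (norm (w - z))\<^sup>2 + 4 * K / \<delta> ^ 4 * (norm (w - z))^4" if "norm z = 1" "norm w = 1" for z w
  proof (cases "norm (w - z) < \<delta>")
    case True
    have "0 \<le> 4 * K / \<delta> ^ 4 * (norm (w - z))^4" by (rule mult_nonneg_nonneg[OF C0]) simp
    with near[OF that True] show ?thesis by linarith
  next
    case False
    have "0 \<le> e * (norm (w - z))\<^sup>2" using e by simp
    with far[OF that leI[OF False]] show ?thesis by linarith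
  qed
  with C0 show ?thesis by blast
qed

section \<open>Moments and generator on the sphere\<close>

sublocale orth_bm \<subseteq> sph: orth_action M G unit_sphere "(*v)"
proof
  show "continuous_on UNIV (\<lambda>p :: (real ^ 'n ^ 'n) \<times> (real ^ 'n). fst p *v snd p)"
    unfolding matrix_vector_mult_def by (intro continuous_intros)
qed (auto simp: matrix_vector_mul_assoc orthogonal_matrix_norm)

context orth_bm
begin

text \<open>Polarization of \<open>G_cov\<close>.\<close>

lemma G_product_moment:
  assumes t: "0 \<le> t" and z: "norm z = 1"
  shows "(\<integral>\<omega>. (a \<bullet> (G t \<omega> *v z)) * (b \<bullet> (G t \<omega> *v z)) \<partial>M)
    = (a \<bullet> b) / real CARD('n) + exp (- real CARD('n) * t) * ((a \<bullet> z) * (b \<bullet> z) - (a \<bullet> b) / real CARD('n))"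
proof -
  let ?n = "real CARD('n)" and ?E = "exp (- real CARD('n) * t)"
  have bd: "\<bar>u \<bullet> (G t \<omega> *v z)\<bar> \<le> norm u" if "\<omega> \<in> space M" for u \<omega>
    using Cauchy_Schwarz_ineq2[of u "G t \<omega> *v z"] orthogonal_matrix_norm[OF G_orthogonal[OF that t]] z by simp
  have int: "integrable M (\<lambda>\<omega>. (u \<bullet> (G t \<omega> *v z))\<^sup>2)" for u
  proof (rule integrable_const_bound[of _ "(norm u)\<^sup>2"])
    show "AE \<omega> in M. norm ((u \<bullet> (G t \<omega> *v z))\<^sup>2) \<le> (norm u)\<^sup>2"
      using AE_space
    proof eventually_elim
      case (elim \<omega>)
      from power_mono[OF bd[OF elim] abs_ge_zero, of u 2] show ?case by simp
    qed
  qed measurable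
  have "(\<integral>\<omega>. (a \<bullet> (G t \<omega> *v z)) * (b \<bullet> (G t \<omega> *v z)) \<partial>M)
    = (\<integral>\<omega>. (((a + b) \<bullet> (G t \<omega> *v z))\<^sup>2 - ((a - b) \<bullet> (G t \<omega> *v z))\<^sup>2) / 4 \<partial>M)"
    by (intro Bochner_Integration.integral_cong) (auto simp: inner_add_left inner_diff_left power2_eq_square algebra_simps)
  also have "\<dots> = ((\<integral>\<omega>. ((a + b) \<bullet> (G t \<omega> *v z))\<^sup>2 \<partial>M) - (\<integral>\<omega>. ((a - b) \<bullet> (G t \<omega> *v z))\<^sup>2 \<partial>M)) / 4"
    using int by simp
  also have "\<dots> = (((norm (a + b))\<^sup>2 - (norm (a - b))\<^sup>2) / 4) / ?n
    + ?E * ((((a + b) \<bullet> z)\<^sup>2 - ((a - b) \<bullet> z)\<^sup>2) / 4 - (((norm (a + b))\<^sup>2 - (norm (a - b))\<^sup>2) / 4) / ?n)"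
  proof -
    have "((p * 1 / ?n + E * (x - p * 1 / ?n)) - (q * 1 / ?n + E * (y - q * 1 / ?n))) / 4
        = ((p - q) / 4) / ?n + E * ((x - y) / 4 - ((p - q) / 4) / ?n)" for p q x y E :: real
      by (simp add: field_simps)
    then show ?thesis unfolding G_cov[OF t] z power_one by blast
  qed
  also have "((norm (a + b))\<^sup>2 - (norm (a - b))\<^sup>2) / 4 = a \<bullet> b"
    by (simp add: power2_norm_eq_inner inner_add_left inner_add_right inner_diff_left inner_diff_right inner_commute)
  also have "(((a + b) \<bullet> z)\<^sup>2 - ((a - b) \<bullet> z)\<^sup>2) / 4 = (a \<bullet> z) * (b \<bullet> z)"
    by (simp add: inner_add_left inner_diff_left power2_eq_square algebra_simps)
  finally show ?thesis .
qed

text \<open>The isotropic part of the second moment produces the trace of \<open>L\<close>. What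
  depends on \<open>z\<close> contains \<open>L z \<bullet> z\<close> and vanishes.\<close>

lemma G_quadratic_moment:
  fixes L :: "real ^ 'n \<Rightarrow> real ^ 'n"
  assumes t: "0 \<le> t" and z: "norm z = 1" and L: "linear L" and Lz: "L z = 0"
  shows "(\<integral>\<omega>. L (G t \<omega> *v z) \<bullet> (G t \<omega> *v z - z) \<partial>M)
    = (1 - exp (- real CARD('n) * t)) / real CARD('n) * (\<Sum>b\<in>Basis. L b \<bullet> b)"
proof -
  let ?n = "real CARD('n)" and ?E = "exp (- real CARD('n) * t)" and ?B = "Basis :: (real ^ 'n) set"
  have bd: "\<bar>u \<bullet> (G t \<omega> *v z)\<bar> \<le> norm u" if "\<omega> \<in> space M" for u \<omega>
    using Cauchy_Schwarz_ineq2[of u "G t \<omega> *v z"] orthogonal_matrix_norm[OF G_orthogonal[OF that t]] z by simp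
  have int1: "integrable M (\<lambda>\<omega>. u \<bullet> (G t \<omega> *v z))" for u
    by (rule integrable_const_bound[of _ "norm u"]) (use bd in \<open>auto\<close>)
  have int2: "integrable M (\<lambda>\<omega>. (a \<bullet> (G t \<omega> *v z)) * (b \<bullet> (G t \<omega> *v z)))" for a b
  proof (rule integrable_const_bound[of _ "norm a * norm b"])
    show "AE \<omega> in M. norm ((a \<bullet> (G t \<omega> *v z)) * (b \<bullet> (G t \<omega> *v z))) \<le> norm a * norm b"
      using AE_space by eventually_elim (auto simp: abs_mult intro!: mult_mono bd)
  qed measurable
  have rep: "L w = (\<Sum>b\<in>?B. (b \<bullet> w) *\<^sub>R L b)" for w
  proof -
    have "L w = L (\<Sum>b\<in>?B. (w \<bullet> b) *\<^sub>R b)" by (simp add: euclidean_representation)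
    then show ?thesis using L by (simp add: linear_sum linear_cmul inner_commute)
  qed
  have pt: "L w \<bullet> (w - z) = (\<Sum>b\<in>?B. (b \<bullet> w) * (L b \<bullet> w)) - (\<Sum>b\<in>?B. (L b \<bullet> z) * (b \<bullet> w))" for w
    by (subst rep) (simp add: inner_sum_left inner_diff_right sum_subtractf algebra_simps)
  have "(\<integral>\<omega>. L (G t \<omega> *v z) \<bullet> (G t \<omega> *v z - z) \<partial>M)
    = (\<Sum>b\<in>?B. \<integral>\<omega>. (b \<bullet> (G t \<omega> *v z)) * (L b \<bullet> (G t \<omega> *v z)) \<partial>M) - (\<Sum>b\<in>?B. (L b \<bullet> z) * (\<integral>\<omega>. b \<bullet> (G t \<omega> *v z) \<partial>M))"
    unfolding pt using int1 int2 by (subst Bochner_Integration.integral_diff) auto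
  also have "\<dots> = (\<Sum>b\<in>?B. (b \<bullet> L b) / ?n + ?E * ((b \<bullet> z) * (L b \<bullet> z) - (b \<bullet> L b) / ?n))
      - exp (- (?n - 1) * t / 2) * (\<Sum>b\<in>?B. (b \<bullet> z) * (L b \<bullet> z))"
    unfolding G_product_moment[OF t z] G_mean[OF t] by (simp add: sum_distrib_left sum_distrib_right mult_ac)
  also have "(\<Sum>b\<in>?B. (b \<bullet> L b) / ?n + ?E * ((b \<bullet> z) * (L b \<bullet> z) - (b \<bullet> L b) / ?n))
    = (\<Sum>b\<in>?B. b \<bullet> L b) / ?n + ?E * ((\<Sum>b\<in>?B. (b \<bullet> z) * (L b \<bullet> z)) - (\<Sum>b\<in>?B. b \<bullet> L b) / ?n)"
    by (simp add: sum.distrib sum_distrib_left[symmetric] sum_subtractf sum_divide_distrib)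
  also have "(\<Sum>b\<in>?B. (b \<bullet> z) * (L b \<bullet> z)) = 0"
  proof -
    have "0 = L z \<bullet> z" by (simp add: Lz)
    also have "\<dots> = (\<Sum>b\<in>?B. (b \<bullet> z) * (L b \<bullet> z))" by (subst rep) (simp add: inner_sum_left)
    finally show ?thesis by simp
  qed
  finally show ?thesis by (simp add: inner_commute algebra_simps diff_divide_distrib)
qed

end

lemma one_minus_exp_bounds:
  fixes c t :: real
  assumes c: "0 < c" and t: "0 \<le> t"
  shows "\<bar>(1 - exp (- c * t)) / c - t\<bar> \<le> c * t\<^sup>2 / 2"
proof -
  have "1 - exp (- c * t) \<le> c * t" using exp_ge_add_one_self[of "- c * t"] by simp
  moreover have "c * t - (c * t)\<^sup>2 / 2 \<le> 1 - exp (- c * t)"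
    using exp_minus_le_quadratic[of "c * t"] c t by simp
  ultimately have "\<bar>1 - exp (- c * t) - c * t\<bar> \<le> (c * t)\<^sup>2 / 2" by (simp add: abs_le_iff)
  then have "\<bar>1 - exp (- c * t) - c * t\<bar> / c \<le> (c * t)\<^sup>2 / 2 / c" using c by (intro divide_right_mono) auto
  moreover have "\<bar>1 - exp (- c * t) - c * t\<bar> / c = \<bar>(1 - exp (- c * t)) / c - t\<bar>"
  proof -
    have "(1 - exp (- c * t)) / c - t = (1 - exp (- c * t) - c * t) / c" using c by (simp add: diff_divide_distrib)
    then show ?thesis using c by (simp add: abs_divide)
  qed
  moreover have "(c * t)\<^sup>2 / 2 / c = c * t\<^sup>2 / 2" using c by (simp add: power2_eq_square)
  ultimately show ?thesis by simp
qed

lemma laplace_beltrami_bound: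
  fixes f :: "real ^ 'n \<Rightarrow> real"
  assumes "\<And>h. norm (sphere_deriv (sphere_grad f) z h) \<le> K * norm h"
  shows "\<bar>laplace_beltrami f z\<bar> \<le> real CARD('n) * K"
proof -
  let ?D = "sphere_deriv (sphere_grad f) z"
  have "\<bar>?D b \<bullet> b\<bar> \<le> K" if "b \<in> Basis" for b
    using order_trans[OF Cauchy_Schwarz_ineq2[of "?D b" b]] assms[of b] that by simp
  then have "\<bar>\<Sum>b\<in>Basis. ?D b \<bullet> b\<bar> \<le> (\<Sum>b\<in>(Basis :: (real ^ 'n) set). K)"
    by (intro order_trans[OF sum_abs] sum_mono) auto
  then show ?thesis by (simp add: laplace_beltrami_def sphere_div_def)
qed

context orth_bm
begin

lemma G_norm: "\<omega> \<in> space M \<Longrightarrow> 0 \<le> t \<Longrightarrow> norm (G t \<omega> *v z) = norm z"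
  by (intro orthogonal_matrix_norm G_orthogonal)

lemma integral_P:
  assumes t: "0 \<le> t" and z: "norm z = 1" and f: "continuous_on unit_sphere (f :: _ \<Rightarrow> real)"
  shows "(\<integral>w. f w \<partial>sph.P t z) = (\<integral>\<omega>. f (G t \<omega> *v z) \<partial>M)"
    and "(\<lambda>\<omega>. f (G t \<omega> *v z)) \<in> borel_measurable M"
proof -
  have m: "(\<lambda>\<omega>. G t \<omega> *v z) \<in> M \<rightarrow>\<^sub>M restrict_space borel unit_sphere"
    using z by (intro sph.act_G_measurable t) simp
  have fm: "f \<in> borel_measurable (restrict_space borel unit_sphere)"
    using f by (rule borel_measurable_continuous_on_restrict)
  show "(\<integral>w. f w \<partial>sph.P t z) = (\<integral>\<omega>. f (G t \<omega> *v z) \<partial>M)"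
    unfolding sph.P_def by (rule integral_distr[OF m fm])
  show "(\<lambda>\<omega>. f (G t \<omega> *v z)) \<in> borel_measurable M" by (rule measurable_compose[OF m fm])
qed

text \<open>The means of the two powers in \<open>sphere_C2_remainder\<close>: the first is of order
  \<open>t\<close> and comes with a small factor, the second is of order \<open>t^2\<close>.\<close>

lemma displacement_moments:
  assumes t: "0 \<le> t" and z: "norm z = 1"
  shows "(\<integral>\<omega>. (norm (G t \<omega> *v z - z))\<^sup>2 \<partial>M) \<le> real CARD('n) * t"
    and "(\<integral>\<omega>. (norm (G t \<omega> *v z - z))^4 \<partial>M) \<le> 2 * (real CARD('n))\<^sup>2 * t\<^sup>2"
proof -
  let ?n = "real CARD('n)"
  have zz: "z \<bullet> z = 1" using z by (simp add: norm_eq_1)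
  have bd: "\<bar>z \<bullet> (G t \<omega> *v z)\<bar> \<le> 1" if "\<omega> \<in> space M" for \<omega>
    using Cauchy_Schwarz_ineq2[of z "G t \<omega> *v z"] G_norm[OF that t] z by simp
  have int: "integrable M (\<lambda>\<omega>. z \<bullet> (G t \<omega> *v z))"
    by (rule integrable_const_bound[of _ 1]) (use bd in \<open>auto\<close>)
  have "(\<integral>\<omega>. (norm (G t \<omega> *v z - z))\<^sup>2 \<partial>M) = (\<integral>\<omega>. 2 - 2 * (z \<bullet> (G t \<omega> *v z)) \<partial>M)"
  proof (rule Bochner_Integration.integral_cong[OF refl])
    fix \<omega> assume "\<omega> \<in> space M"
    then have "(G t \<omega> *v z) \<bullet> (G t \<omega> *v z) = 1" using G_norm[of \<omega> t z] t z by (simp add: norm_eq_1)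
    then show "(norm (G t \<omega> *v z - z))\<^sup>2 = 2 - 2 * (z \<bullet> (G t \<omega> *v z))"
      by (simp add: power2_norm_eq_inner inner_diff_left inner_diff_right zz inner_commute)
  qed
  also have "\<dots> = 2 - 2 * exp (- (?n - 1) * t / 2)"
    using int by (simp add: G_mean[OF t] zz prob_space)
  also have "\<dots> \<le> (?n - 1) * t" using exp_ge_add_one_self[of "- (?n - 1) * t / 2"] by (simp add: field_simps)
  also have "\<dots> \<le> ?n * t" using t by (intro mult_right_mono) auto
  finally show "(\<integral>\<omega>. (norm (G t \<omega> *v z - z))\<^sup>2 \<partial>M) \<le> ?n * t" .
  show "(\<integral>\<omega>. (norm (G t \<omega> *v z - z))^4 \<partial>M) \<le> 2 * ?n\<^sup>2 * t\<^sup>2"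
  proof (rule displacement_moment4[OF G_measurable z t])
    show "AE \<omega> in M. norm (G t \<omega> *v z) = norm z"
      using AE_space by eventually_elim (rule G_norm[OF _ t])
    show "(\<integral>\<omega>. z \<bullet> (G t \<omega> *v z) \<partial>M) = exp (- (?n - 1) * t / 2)"
      unfolding G_mean[OF t] zz by simp
    show "(\<integral>\<omega>. (z \<bullet> (G t \<omega> *v z))\<^sup>2 \<partial>M) = 1 / ?n + exp (- ?n * t) * (1 - 1 / ?n)"
      unfolding G_cov[OF t] zz z by simp
  qed
qed

text \<open>The mean of \<open>G t z\<close> is a multiple of \<open>z\<close>, so the gradient term
  drops out. The quadratic term yields the Laplacian by \<open>G_quadratic_moment\<close>, and the
  Taylor remainder is bounded in the mean.\<close>

lemma generator_remainder:
  assumes f: "sphere_C2 f" and t: "0 \<le> t" and z: "norm z = 1" and e: "0 \<le> e" and C: "0 \<le> C"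
    and R: "\<And>w. norm w = 1 \<Longrightarrow>
      \<bar>f w - f z - sphere_grad f z \<bullet> w - (sphere_deriv (sphere_grad f) z w \<bullet> (w - z)) / 2\<bar>
      \<le> e * (norm (w - z))\<^sup>2 + C * (norm (w - z))^4"
  shows "\<bar>(\<integral>w. f w \<partial>sph.P t z) - f z - (1 - exp (- real CARD('n) * t)) / real CARD('n) * laplace_beltrami f z / 2\<bar>
    \<le> e * (real CARD('n) * t) + C * (2 * (real CARD('n))\<^sup>2 * t\<^sup>2)"
proof -
  let ?n = "real CARD('n)" and ?W = "\<lambda>\<omega>. G t \<omega> *v z"
  let ?N = "sphere_grad f z" and ?D = "sphere_deriv (sphere_grad f) z"
  obtain K where K: "1 \<le> K" "\<And>z. norm z = 1 \<Longrightarrow> \<bar>f z\<bar> \<le> K" "\<And>h. norm (?D h) \<le> K * norm h"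
    using sphere_C2_bounds(1)[OF f] z by blast
  have lin: "linear ?D" using sphere_C2_grad(4)[OF f z] by (rule has_derivative_linear)
  have [measurable]: "?D \<in> borel_measurable borel"
    by (rule borel_measurable_continuous_onI) (rule linear_continuous_on[OF linear_conv_bounded_linear[THEN iffD1, OF lin]])
  have fc: "continuous_on unit_sphere f"
    using f by (auto simp: sphere_C2_def intro: differentiable_imp_continuous_on)
  note fm[measurable] = integral_P(2)[OF t z fc]
  have W1: "norm (?W \<omega>) = 1" if "\<omega> \<in> space M" for \<omega> using G_norm[OF that t] z by simp
  have W2: "norm (?W \<omega> - z) \<le> 2" if "\<omega> \<in> space M" for \<omega>
    using norm_triangle_ineq4[of "?W \<omega>" z] W1[OF that] z by simp
  have If: "integrable M (\<lambda>\<omega>. f (?W \<omega>))"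
    by (rule integrable_const_bound[of _ K]) (use K(2) W1 in auto)
  have IN: "integrable M (\<lambda>\<omega>. ?N \<bullet> ?W \<omega>)"
  proof (rule integrable_const_bound[of _ "norm ?N"])
    show "AE \<omega> in M. norm (?N \<bullet> ?W \<omega>) \<le> norm ?N"
      using AE_space
    proof eventually_elim
      case (elim \<omega>)
      from Cauchy_Schwarz_ineq2[of ?N "?W \<omega>"] W1[OF elim] show ?case by simp
    qed
  qed measurable
  have ID: "integrable M (\<lambda>\<omega>. ?D (?W \<omega>) \<bullet> (?W \<omega> - z))"
  proof (rule integrable_const_bound[of _ "K * 2"])
    show "AE \<omega> in M. norm (?D (?W \<omega>) \<bullet> (?W \<omega> - z)) \<le> K * 2"
      using AE_space
    proof eventually_elim
      case (elim \<omega>)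
      have "norm (?D (?W \<omega>)) * norm (?W \<omega> - z) \<le> K * 2"
        using K(3)[of "?W \<omega>"] K(1) W1[OF elim] W2[OF elim] by (intro mult_mono) auto
      then show ?case using Cauchy_Schwarz_ineq2[of "?D (?W \<omega>)" "?W \<omega> - z"] by simp
    qed
  qed measurable
  have Ip: "integrable M (\<lambda>\<omega>. (norm (?W \<omega> - z)) ^ k)" for k
  proof (rule integrable_const_bound[of _ "2 ^ k"])
    show "AE \<omega> in M. norm ((norm (?W \<omega> - z)) ^ k) \<le> 2 ^ k"
      using AE_space
    proof eventually_elim
      case (elim \<omega>)
      from power_mono[OF W2[OF elim] norm_ge_zero, of k] show ?case by simp
    qed
  qed measurable
  let ?r = "\<lambda>\<omega>. f (?W \<omega>) - f z - ?N \<bullet> ?W \<omega> - (?D (?W \<omega>) \<bullet> (?W \<omega> - z)) / 2"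
  have "(\<integral>\<omega>. ?r \<omega> \<partial>M) = (\<integral>\<omega>. f (?W \<omega>) \<partial>M) - f z - (\<integral>\<omega>. ?N \<bullet> ?W \<omega> \<partial>M) - (\<integral>\<omega>. ?D (?W \<omega>) \<bullet> (?W \<omega> - z) \<partial>M) / 2"
    using If IN ID by (simp add: prob_space)
  also have "(\<integral>\<omega>. ?N \<bullet> ?W \<omega> \<partial>M) = 0"
    using sphere_C2_grad(1)[OF f z] by (simp add: G_mean[OF t])
  also have "(\<integral>\<omega>. ?D (?W \<omega>) \<bullet> (?W \<omega> - z) \<partial>M) = (1 - exp (- ?n * t)) / ?n * laplace_beltrami f z"
    unfolding laplace_beltrami_def sphere_div_def
    by (rule G_quadratic_moment[OF t z lin sphere_C2_grad(3)[OF f z]])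
  finally have eq: "(\<integral>w. f w \<partial>sph.P t z) - f z - (1 - exp (- ?n * t)) / ?n * laplace_beltrami f z / 2 = (\<integral>\<omega>. ?r \<omega> \<partial>M)"
    unfolding integral_P(1)[OF t z fc] by simp
  have le: "\<bar>?r \<omega>\<bar> \<le> e * (norm (?W \<omega> - z))\<^sup>2 + C * (norm (?W \<omega> - z))^4" if "\<omega> \<in> space M" for \<omega>
    by (rule R[OF W1[OF that]])
  have Ir: "integrable M (\<lambda>\<omega>. \<bar>?r \<omega>\<bar>)" by (rule integrable_abs) (use If IN ID in simp)
  have Ib: "integrable M (\<lambda>\<omega>. e * (norm (?W \<omega> - z))\<^sup>2 + C * (norm (?W \<omega> - z))^4)"
    using Ip[of 2] Ip[of 4] by simp
  have "\<bar>\<integral>\<omega>. ?r \<omega> \<partial>M\<bar> \<le> (\<integral>\<omega>. \<bar>?r \<omega>\<bar> \<partial>M)" by (rule integral_abs_bound)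
  also have "\<dots> \<le> (\<integral>\<omega>. e * (norm (?W \<omega> - z))\<^sup>2 + C * (norm (?W \<omega> - z))^4 \<partial>M)"
    by (rule integral_mono[OF Ir Ib le])
  also have "\<dots> = e * (\<integral>\<omega>. (norm (?W \<omega> - z))\<^sup>2 \<partial>M) + C * (\<integral>\<omega>. (norm (?W \<omega> - z))^4 \<partial>M)"
    using Ip[of 2] Ip[of 4] by simp
  also have "\<dots> \<le> e * (?n * t) + C * (2 * ?n\<^sup>2 * t\<^sup>2)"
    using displacement_moments[OF t z] e C by (intro add_mono mult_left_mono) auto
  finally show ?thesis unfolding eq .
qed

text \<open>Uniformity in the starting point comes for free, because every bound in
  \<open>generator_remainder\<close> is independent of \<open>z\<close>.\<close>

lemma in_generator_laplace:
  assumes f: "sphere_C2 f"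
  shows "in_generator unit_sphere sph.P f (\<lambda>z. laplace_beltrami f z / 2)"
  unfolding in_generator_def
proof (rule uniform_limitI)
  fix e :: real assume e: "0 < e"
  let ?n = "real CARD('n)"
  have n: "0 < ?n" by simp
  obtain K where K: "1 \<le> K" "\<And>z h. norm z = 1 \<Longrightarrow> norm (sphere_deriv (sphere_grad f) z h) \<le> K * norm h"
    using sphere_C2_bounds(1)[OF f] by blast
  have e4: "0 < e / (4 * ?n)" using e n by simp
  obtain C where C: "0 \<le> C" "\<And>z w. norm z = 1 \<Longrightarrow> norm w = 1 \<Longrightarrow>
      \<bar>f w - f z - sphere_grad f z \<bullet> w - (sphere_deriv (sphere_grad f) z w \<bullet> (w - z)) / 2\<bar>
      \<le> e / (4 * ?n) * (norm (w - z))\<^sup>2 + C * (norm (w - z))^4"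
    using sphere_C2_remainder[OF f e4] by blast
  \<comment> \<open>\<open>B\<close> dominates the coefficient of \<open>t^2\<close> in the error.
    The other part contributes \<open>e / 4\<close> per unit time, by the choice of
    \<open>e / (4 n)\<close>, so \<open>B t < e / 2\<close> leaves a total below
    \<open>e\<close>.\<close>
  define B where "B = 2 * C * ?n\<^sup>2 + ?n\<^sup>2 * K"
  have B: "0 < B" unfolding B_def using C(1) K(1) n by (intro add_nonneg_pos) auto
  show "\<forall>\<^sub>F t in at_right 0. \<forall>z\<in>unit_sphere.
    dist (((\<integral>w. f w \<partial>sph.P t z) - f z) / t) (laplace_beltrami f z / 2) < e"
  proof (rule eventually_at_rightI[of 0 "e / (2 * B)"])
    show "0 < e / (2 * B)" using e B by simp
    fix t assume "t \<in> {0<..<e / (2 * B)}"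
    then have t: "0 < t" and tB: "B * t < e / 2" using B by (auto simp: field_simps)
    show "\<forall>z\<in>unit_sphere. dist (((\<integral>w. f w \<partial>sph.P t z) - f z) / t) (laplace_beltrami f z / 2) < e"
    proof
      fix z :: "real ^ 'n" assume "z \<in> unit_sphere"
      then have z: "norm z = 1" by simp
      define I where "I = (\<integral>w. f w \<partial>sph.P t z) - f z"
      define l where "l = laplace_beltrami f z"
      define q where "q = (1 - exp (- ?n * t)) / ?n"
      have 1: "\<bar>I - q * l / 2\<bar> \<le> e / (4 * ?n) * (?n * t) + C * (2 * ?n\<^sup>2 * t\<^sup>2)"
        unfolding I_def q_def l_def
        by (rule generator_remainder[OF f less_imp_le[OF t] z less_imp_le[OF e4] C(1) C(2)[OF z]])
      have "\<bar>l\<bar> \<le> ?n * K" unfolding l_def by (rule laplace_beltrami_bound[OF K(2)[OF z]])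
      moreover have "\<bar>q - t\<bar> \<le> ?n * t\<^sup>2 / 2" unfolding q_def by (rule one_minus_exp_bounds[OF n less_imp_le[OF t]])
      ultimately have 2: "\<bar>(q - t) * l\<bar> \<le> (?n * t\<^sup>2 / 2) * (?n * K)"
        unfolding abs_mult by (intro mult_mono) auto
      have "I - t * (l / 2) = (I - q * l / 2) + (q - t) * l / 2" by (simp add: field_simps)
      then have "\<bar>I - t * (l / 2)\<bar> \<le> \<bar>I - q * l / 2\<bar> + \<bar>(q - t) * l\<bar> / 2"
        using abs_triangle_ineq[of "I - q * l / 2" "(q - t) * l / 2"] by simp
      also have "\<dots> \<le> e / (4 * ?n) * (?n * t) + C * (2 * ?n\<^sup>2 * t\<^sup>2) + (?n * t\<^sup>2 / 2) * (?n * K) / 2"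
        using 1 2 by linarith
      also have "\<dots> = (e / 4 + (2 * C * ?n\<^sup>2 + ?n\<^sup>2 * K / 4) * t) * t"
        using n by (simp add: field_simps power2_eq_square)
      also have "\<dots> \<le> (e / 4 + B * t) * t"
        unfolding B_def using t K(1) n C(1) by (intro mult_right_mono add_mono) auto
      also have "\<dots> < e * t"
        using t tB e by (intro mult_strict_right_mono) auto
      finally have "\<bar>I - t * (l / 2)\<bar> < e * t" .
      then have "\<bar>I - t * (l / 2)\<bar> / t < e" using t by (simp add: pos_divide_less_eq)
      moreover have "\<bar>I - t * (l / 2)\<bar> / t = \<bar>I / t - l / 2\<bar>"
      proof -
        have "I / t - l / 2 = (I - t * (l / 2)) / t" using t by (simp add: diff_divide_distrib)
        then show ?thesis using t by (simp add: abs_divide)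
      qed
      ultimately show "dist (((\<integral>w. f w \<partial>sph.P t z) - f z) / t) (laplace_beltrami f z / 2) < e"
        by (simp add: dist_real_def I_def l_def)
    qed
  qed
qed

lemma brownian_transition_P: "brownian_transition sph.P"
  unfolding brownian_transition_def
  by (intro conjI allI impI in_generator_laplace sph.transition_function_P)

end

section \<open>Isometry invariance of the geodesic distance\<close>

text \<open>An orthogonal matrix preserves the speed wherever the curve is differentiable.\<close>

lemma has_length_orthogonal:
  fixes A :: "real ^ 'n ^ 'n"
  assumes A: "orthogonal_matrix A" and \<gamma>: "has_length \<gamma> l"
  shows "has_length (\<lambda>s. A *v \<gamma> s) l"
proof -
  obtain T where c: "continuous_on {0..1} \<gamma>" and T: "finite T" "\<gamma> C1_differentiable_on ({0..1} - T)"
    using \<gamma> unfolding has_length_def valid_path_def piecewise_C1_differentiable_on_def by blast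
  obtain D where D: "\<And>s. s \<in> {0..1} - T \<Longrightarrow> (\<gamma> has_vector_derivative D s) (at s)" "continuous_on ({0..1} - T) D"
    using T(2) unfolding C1_differentiable_on_def by blast
  have bl: "bounded_linear ((*v) A)" by (rule matrix_vector_mul_bounded_linear)
  have AD: "((\<lambda>s. A *v \<gamma> s) has_vector_derivative A *v D s) (at s)" if "s \<in> {0..1} - T" for s
    by (rule bounded_linear.has_vector_derivative[OF bl D(1)[OF that]])
  have "valid_path (\<lambda>s. A *v \<gamma> s)"
    unfolding valid_path_def piecewise_C1_differentiable_on_def C1_differentiable_on_def
  proof (intro conjI exI[of _ T] exI[of _ "\<lambda>s. A *v D s"] ballI AD T(1))
    show "continuous_on {0..1} (\<lambda>s. A *v \<gamma> s)" by (rule bounded_linear.continuous_on[OF bl c])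
    show "continuous_on ({0..1} - T) (\<lambda>s. A *v D s)" by (rule bounded_linear.continuous_on[OF bl D(2)])
  qed
  moreover have "((\<lambda>s. norm (vector_derivative (\<lambda>s. A *v \<gamma> s) (at s))) has_integral l) {0..1}"
  \<comment> \<open>At the finitely many exceptional parameters nothing is known about the two
    vector derivatives.\<close>
  proof (rule has_integral_spike_finite[OF T(1)])
    show "((\<lambda>s. norm (vector_derivative \<gamma> (at s))) has_integral l) {0..1}"
      using \<gamma> by (simp add: has_length_def)
    show "norm (vector_derivative (\<lambda>s. A *v \<gamma> s) (at s)) = norm (vector_derivative \<gamma> (at s))" if "s \<in> {0..1} - T" for s
      using vector_derivative_at[OF AD[OF that]] vector_derivative_at[OF D(1)[OF that]]
      by (simp add: orthogonal_matrix_norm[OF A])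
  qed
  ultimately show ?thesis by (simp add: has_length_def)
qed

text \<open>The two sets of lengths coincide, by the inclusion for \<open>A\<close> and for its
  transpose, which is its inverse. No formula for the distance and no minimizing curve
  enters.\<close>

lemma sphere_dist_orthogonal:
  fixes A :: "real ^ 'n ^ 'n"
  assumes A: "orthogonal_matrix A"
  shows "sphere_dist (A *v x) (A *v y) = sphere_dist x y"
proof -
  let ?L = "\<lambda>x y :: real ^ 'n. {l. \<exists>\<gamma>. has_length \<gamma> l \<and> path_image \<gamma> \<subseteq> sphere 0 1 \<and> pathstart \<gamma> = x \<and> pathfinish \<gamma> = y}"
  have sub: "?L x y \<subseteq> ?L (B *v x) (B *v y)" if B: "orthogonal_matrix B" for B x y
  proof
    fix l assume "l \<in> ?L x y"
    then obtain \<gamma> where \<gamma>: "has_length \<gamma> l" "path_image \<gamma> \<subseteq> sphere 0 1" "pathstart \<gamma> = x" "pathfinish \<gamma> = y" by blast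
    have "has_length (\<lambda>s. B *v \<gamma> s) l" by (rule has_length_orthogonal[OF B \<gamma>(1)])
    moreover have "path_image (\<lambda>s. B *v \<gamma> s) \<subseteq> sphere 0 1"
      using \<gamma>(2) by (auto simp: path_image_def orthogonal_matrix_norm[OF B])
    moreover have "pathstart (\<lambda>s. B *v \<gamma> s) = B *v x" "pathfinish (\<lambda>s. B *v \<gamma> s) = B *v y"
      using \<gamma>(3,4) by (auto simp: pathstart_def pathfinish_def)
    ultimately show "l \<in> ?L (B *v x) (B *v y)" by blast
  qed
  have "orthogonal_matrix (transpose A)" using A by (simp add: orthogonal_matrix_transpose)
  from sub[OF this, of "A *v x" "A *v y"] have "?L (A *v x) (A *v y) \<subseteq> ?L x y"
    using A by (simp add: matrix_vector_mul_assoc orthogonal_matrix_def)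
  with sub[OF A, of x y] have "?L (A *v x) (A *v y) = ?L x y" by blast
  then show ?thesis unfolding sphere_dist_def by simp
qed

theorem corollary6p2:
  fixes x y :: "real ^ 'n"
  assumes "CARD('n) \<ge> 2"
    and "x \<in> sphere 0 1" and "y \<in> sphere 0 1"
  shows "\<exists>(M :: (real \<Rightarrow> (real ^ 'n) \<times> (real ^ 'n)) measure) X Y.
    coadapted_coupling M X Y \<and>
    (\<forall>\<omega>\<in>space M. X 0 \<omega> = x \<and> Y 0 \<omega> = y) \<and>
    (\<forall>\<omega>\<in>space M. \<forall>t\<ge>0. sphere_dist (X t \<omega>) (Y t \<omega>) = sphere_dist x y) \<and>
    diffusion M (sphere 0 1 \<times> sphere 0 1) (\<lambda>t \<omega>. (X t \<omega>, Y t \<omega>))"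
proof -
  obtain M :: "(real \<Rightarrow> (real ^ 'n) \<times> (real ^ 'n)) measure" and Z :: "nat \<Rightarrow> nat \<times> ('n \<times> 'n) \<Rightarrow> _ \<Rightarrow> real"
    where M: "prob_space M" "\<And>l. iid_family M std_normal (Z l)"
      "\<And>l j i \<omega>. Z l (j, i) \<omega> = (Z (Suc l) (2 * j, i) \<omega> + Z (Suc l) (2 * j + 1, i) \<omega>) / sqrt 2"
    using ex_normal_tower[where 'b = "(real ^ 'n) \<times> (real ^ 'n)" and 'i = "'n \<times> 'n"] by blast
  interpret tower: matrix_tower M Z
    by (rule matrix_tower.intro[OF M(1)], rule matrix_tower_axioms.intro) (rule M(2), rule M(3))
  obtain G :: "real \<Rightarrow> _ \<Rightarrow> real ^ 'n ^ 'n" where "orth_bm M G" using tower.ex_orth_bm by blast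
  then interpret orth_bm M G .
  \<comment> \<open>The diagonal action on pairs makes the coupling itself an orbit, so that it is a
    diffusion for the same reason as each of its components.\<close>
  interpret pr: orth_action M G "unit_sphere \<times> unit_sphere" "\<lambda>A p. (A *v fst p, A *v snd p)"
  proof
    show "continuous_on UNIV (\<lambda>p :: (real ^ 'n ^ 'n) \<times> (real ^ 'n) \<times> (real ^ 'n). (fst p *v fst (snd p), fst p *v snd (snd p)))"
      unfolding matrix_vector_mult_def by (intro continuous_intros)
  qed (auto simp: matrix_vector_mul_assoc orthogonal_matrix_norm intro!: closed_Times)
  note xy = assms(2,3)
  have xyS: "(x, y) \<in> unit_sphere \<times> unit_sphere" using xy by simp
  define X where "X = sph.X x"
  define Y where "Y = sph.X y"
  have X: "X t \<omega> = G t \<omega> *v x" and Y: "Y t \<omega> = G t \<omega> *v y" for t \<omega>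
    by (simp_all add: X_def Y_def sph.X_def[OF xy(1)] sph.X_def[OF xy(2)])
  have XY: "(\<lambda>t \<omega>. (X t \<omega>, Y t \<omega>)) = pr.X (x, y)"
    by (simp add: fun_eq_iff X Y pr.X_def[OF xyS])
  \<comment> \<open>The history of the pair lies in that of \<open>G\<close> and makes both present
    positions measurable, as \<open>simple_markov_cond_exp\<close> requires.\<close>
  let ?F = "\<lambda>s. natural_filtration M (\<lambda>t \<omega>. (X t \<omega>, Y t \<omega>)) (ennreal s)"
  have FG: "sets (?F s) \<subseteq> sets (natural_filtration M G (ennreal s))" for s
    unfolding XY by (rule pr.X_filtration[OF xyS])
  have mF: "X s \<in> borel_measurable (?F s)" "Y s \<in> borel_measurable (?F s)" if "0 \<le> s" for s
  proof -
    have *: "(\<lambda>\<omega>. (X s \<omega>, Y s \<omega>)) \<in> borel_measurable (?F s)"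
      using measurable_natural_filtration[OF that order_refl, where M = M and X = "\<lambda>t \<omega>. (X t \<omega>, Y t \<omega>)"] by simp
    have c: "fst \<in> borel_measurable borel" "snd \<in> borel_measurable borel"
      by (auto intro!: borel_measurable_continuous_onI continuous_intros)
    show "X s \<in> borel_measurable (?F s)" "Y s \<in> borel_measurable (?F s)"
      using measurable_compose[OF * c(1)] measurable_compose[OF * c(2)] by simp_all
  qed
  have "sphere_brownian_motion M X" "sphere_brownian_motion M Y"
    unfolding sphere_brownian_motion_def X_def Y_def
    using brownian_transition_P sph.diffusion_with_X[OF xy(1)] sph.diffusion_with_X[OF xy(2)] by blast+
  moreover have "AE \<omega> in M. real_cond_exp M (?F s) (indicator {\<omega> \<in> space M. X (s + t) \<omega> \<in> A}) \<omega> = measure (sph.P t (X s \<omega>)) A"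
    if "0 \<le> s" "0 \<le> t" "A \<in> sets (restrict_space borel unit_sphere)" for s t A
    using sph.simple_markov_cond_exp[OF xy(1) that _ FG] mF(1)[OF that(1)] unfolding X_def by simp
  moreover have "AE \<omega> in M. real_cond_exp M (?F s) (indicator {\<omega> \<in> space M. Y (s + t) \<omega> \<in> A}) \<omega> = measure (sph.P t (Y s \<omega>)) A"
    if "0 \<le> s" "0 \<le> t" "A \<in> sets (restrict_space borel unit_sphere)" for s t A
    using sph.simple_markov_cond_exp[OF xy(2) that _ FG] mF(2)[OF that(1)] unfolding Y_def by simp
  ultimately have "coadapted_coupling M X Y"
    unfolding coadapted_coupling_def brownian_coupling_def using brownian_transition_P by blast
  moreover have "X 0 \<omega> = x \<and> Y 0 \<omega> = y" if "\<omega> \<in> space M" for \<omega>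
    using G_0[OF that] by (simp add: X Y)
  moreover have "sphere_dist (X t \<omega>) (Y t \<omega>) = sphere_dist x y" if "\<omega> \<in> space M" "0 \<le> t" for t \<omega>
    unfolding X Y by (rule sphere_dist_orthogonal[OF G_orthogonal[OF that]])
  moreover have "diffusion M (sphere 0 1 \<times> sphere 0 1) (\<lambda>t \<omega>. (X t \<omega>, Y t \<omega>))"
    unfolding XY diffusion_def using pr.diffusion_with_X[OF xyS] by blast
  ultimately show ?thesis by blast
qed

end
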